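(* Let $K,M,T\ge 1$ be integers and $G=([K],E)$ a strongly observable directed graph. There is a policy $\pi$, implementable in polynomial time and not requiring knowledge of the context sequence in advance, whose regret over self-avoiding context sequences satisfies $$R_T(\pi;G,M,\mathcal{C}_{\mathsf{SA}})=\widetilde{O}\big(\sqrt{\beta_M(G)\,T}\big),$$ where $$\beta_M(G)=\max\Big\{\sum_{c=1}^M |I_c| : I_1,\dots,I_M \text{ disjoint independent subsets of } [K],\ \text{and } I_i\not\to I_j \text{ for all } i<j\Big\},$$ and $I_i\not\to I_j$ means that $(u,v)\notin E$ whenever $u\in I_i$ and $v\in I_j$ (the sets $I_c$ may be empty).
   Context: Graph conventions: $[n]=\{1,\dots,n\}$. For a directed graph $G=([K],E)$ (self-loops allowed), $u\to v$ means $(u,v)\in E$. A set $I\subseteq[K]$ is independent if $(u,v)\notin E$ for all distinct $u,v\in I$. $G$ is strongly observable if for every $a\in[K]$, either $a\to a$ or $a'\to a$ for all $a'\ne a$. Stochastic contextual bandits with graph feedback and complete cross-learning: there are $M$ contexts, $K$ actions, a horizon $T$, and a known feedback graph $G$ on the actions. An environment consists of unknown means $\mu=(\mu_{c,a})_{c\in[M],a\in[K]}\in[0,1]^{M\times K}$ and reward vectors $(r_{t,c,a})_{c\in[M],a\in[K]}$, $t\in[T]$, independent across $t$, with $r_{t,c,a}\in[0,1]$ and $\mathbb{E}[r_{t,c,a}]=\mu_{c,a}$. An oblivious adversary fixes a context sequence $c^T=(c_1,\dots,c_T)\in[M]^T$. In each round $t$, the context $c_t$ is revealed, the learner (knowing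 $T,K,M,G$) chooses an action $a_t=\pi_t(c_t)\in[K]$ (possibly at random) based on past observations and $c_t$, and then observes $r_{t,c,a}$ for all $c\in[M]$ and all $a$ with $(a_t,a)\in E$. For a class $\mathcal{C}\subseteq[M]^T$ of context sequences, $$R_T(\pi;G,M,\mathcal{C})=\sup_{c^T\in\mathcal{C}}\ \sup_{\mu}\ \mathbb{E}\Big[\sum_{t=1}^T\big(\max_{a\in[K]}\mu_{c_t,a}-\mu_{c_t,a_t}\big)\Big],$$ the supremum being over $c^T\in\mathcal{C}$ and all environments. Self-avoiding contexts: $\mathcal{C}_{\mathsf{SA}}$ is the set of sequences $(c_1,\dots,c_T)$ such that $c_s=c_t$ with $s<t$ implies $c_s=c_{s+1}=\cdots=c_t$. $\widetilde{O}(\cdot)$ hides absolute constants and factors polylogarithmic in $K,M,T$. *)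

theory Defs
  imports "HOL-Probability.Probability"
begin

text \<open>
  Actions, contexts and rounds are numbered from \<open>0\<close>: the actions are \<open>{..<K}\<close>, the contexts
  \<open>{..<M}\<close> and the rounds \<open>{..<T}\<close>. A directed graph on the actions is given by its edge
  relation \<open>E\<close>; \<open>(u, v) \<in> E\<close> means that playing \<open>u\<close> reveals the reward of \<open>v\<close>.
\<close>

section \<open>Feedback graphs\<close>

definition digraph_on :: "nat \<Rightarrow> (nat \<times> nat) set \<Rightarrow> bool" where
  "digraph_on K E \<longleftrightarrow> E \<subseteq> {..<K} \<times> {..<K}"

definition strongly_observable :: "nat \<Rightarrow> (nat \<times> nat) set \<Rightarrow> bool" where
  "strongly_observable K E \<longleftrightarrow>
     (\<forall>a<K. (a, a) \<in> E \<or> (\<forall>a'<K. a' \<noteq> a \<longrightarrow> (a', a) \<in> E))"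

definition independent_in :: "nat \<Rightarrow> (nat \<times> nat) set \<Rightarrow> nat set \<Rightarrow> bool" where
  "independent_in K E I \<longleftrightarrow>
     I \<subseteq> {..<K} \<and> (\<forall>u\<in>I. \<forall>v\<in>I. u \<noteq> v \<longrightarrow> (u, v) \<notin> E)"

definition beta :: "nat \<Rightarrow> (nat \<times> nat) set \<Rightarrow> nat \<Rightarrow> nat" where
  "beta K E M = Max {\<Sum>c<M. card (I c) | I :: nat \<Rightarrow> nat set.
     disjoint_family_on I {..<M} \<and>
     (\<forall>c<M. independent_in K E (I c)) \<and>
     (\<forall>i j. i < j \<and> j < M \<longrightarrow> (\<forall>u\<in>I i. \<forall>v\<in>I j. (u, v) \<notin> E))}"


section \<open>Context sequences\<close>

definition context_seqs :: "nat \<Rightarrow> nat \<Rightarrow> nat list set" where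
  "context_seqs M T = {cs. length cs = T \<and> set cs \<subseteq> {..<M}}"

definition self_avoiding :: "nat \<Rightarrow> nat \<Rightarrow> nat list set" where
  "self_avoiding M T = {cs \<in> context_seqs M T.
     \<forall>s t. s < t \<and> t < T \<and> cs ! s = cs ! t \<longrightarrow> (\<forall>u\<in>{s..t}. cs ! u = cs ! s)}"


section \<open>Interaction of learner and environment\<close>

text \<open>The reward vector of one round, indexed by (context, action).\<close>

type_synonym rewards = "nat \<times> nat \<Rightarrow> real"

text \<open>
  A history is the list of past triples (context, action played, observation). A (randomized)
  policy maps the past and the current context to the law of the next action; it does not see
  future contexts.
\<close>

type_synonym history = "(nat \<times> nat \<times> rewards) list"
type_synonym policy = "history \<Rightarrow> nat \<Rightarrow> nat pmf"

text \<open>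
  What is observed after playing \<open>a\<close>: the reward of every out-neighbour of \<open>a\<close> in every context
  (complete cross-learning). Unobserved entries are masked by \<open>0\<close>; as the learner knows \<open>E\<close> and
  its own past actions, it can tell a mask from an observed reward \<open>0\<close>.
\<close>

definition observe :: "nat \<Rightarrow> (nat \<times> nat) set \<Rightarrow> nat \<Rightarrow> rewards \<Rightarrow> rewards" where
  "observe M E a x = (\<lambda>(c, b). if c < M \<and> (a, b) \<in> E then x (c, b) else 0)"

text \<open>The history after the rounds in which the actions \<open>as\<close> were played.\<close>

definition history_of ::
  "nat \<Rightarrow> (nat \<times> nat) set \<Rightarrow> nat list \<Rightarrow> (nat \<Rightarrow> rewards) \<Rightarrow> nat list \<Rightarrow> history" where
  "history_of M E cs r as =
     map (\<lambda>s. (cs ! s, as ! s, observe M E (as ! s) (r s))) [0..<length as]"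

definition reward_space :: "nat \<Rightarrow> nat \<Rightarrow> rewards measure" where
  "reward_space K M = PiM ({..<M} \<times> {..<K}) (\<lambda>_. borel)"

text \<open>
  Besides choosing actions in \<open>{..<K}\<close>, a policy has to depend measurably on the observed
  rewards: Bochner integrals of non-measurable functions are \<open>0\<close> by convention, which would make
  the regret below meaningless.
\<close>

definition is_policy :: "nat \<Rightarrow> nat \<Rightarrow> nat \<Rightarrow> (nat \<times> nat) set \<Rightarrow> policy \<Rightarrow> bool" where
  "is_policy K M T E \<pi> \<longleftrightarrow>
     (\<forall>cs\<in>context_seqs M T. \<forall>as. length as < T \<and> set as \<subseteq> {..<K} \<longrightarrow>
        (\<forall>r. set_pmf (\<pi> (history_of M E cs r as) (cs ! length as)) \<subseteq> {..<K}) \<and>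
        (\<forall>a<K. (\<lambda>r. pmf (\<pi> (history_of M E cs r as) (cs ! length as)) a)
           \<in> borel_measurable (PiM {..<length as} (\<lambda>_. reward_space K M))))"

text \<open>
  The law of the first \<open>t\<close> actions, conditionally on the context sequence and on the rewards of
  all rounds (the policy's own randomization is independent of the rewards).
\<close>

primrec play ::
  "nat \<Rightarrow> (nat \<times> nat) set \<Rightarrow> policy \<Rightarrow> nat list \<Rightarrow> (nat \<Rightarrow> rewards) \<Rightarrow> nat \<Rightarrow> nat list pmf" where
  "play M E \<pi> cs r 0 = return_pmf []"
| "play M E \<pi> cs r (Suc t) =
     bind_pmf (play M E \<pi> cs r t)
       (\<lambda>as. map_pmf (\<lambda>a. as @ [a]) (\<pi> (history_of M E cs r as) (cs ! t)))"

text \<open>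
  An environment consists of means \<open>\<mu>\<close> and, for each round \<open>t\<close>, a law \<open>D t\<close> of the reward vector
  of that round. Within a round the entries may be arbitrarily dependent, and the laws may differ
  from round to round; independence across rounds is the product measure in \<open>expected_regret\<close>.
\<close>

definition environments ::
  "nat \<Rightarrow> nat \<Rightarrow> nat \<Rightarrow> ((nat \<Rightarrow> nat \<Rightarrow> real) \<times> (nat \<Rightarrow> rewards measure)) set" where
  "environments K M T = {(\<mu>, D).
     (\<forall>c<M. \<forall>a<K. \<mu> c a \<in> {0..1}) \<and>
     (\<forall>t<T. prob_space (D t) \<and> sets (D t) = sets (reward_space K M) \<and>
        (\<forall>c<M. \<forall>a<K. (AE x in D t. x (c, a) \<in> {0..1}) \<and>
                      prob_space.expectation (D t) (\<lambda>x. x (c, a)) = \<mu> c a))}"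

definition expected_regret ::
  "nat \<Rightarrow> nat \<Rightarrow> nat \<Rightarrow> (nat \<times> nat) set \<Rightarrow> policy \<Rightarrow> nat list \<Rightarrow>
   (nat \<Rightarrow> nat \<Rightarrow> real) \<Rightarrow> (nat \<Rightarrow> rewards measure) \<Rightarrow> real" where
  "expected_regret K M T E \<pi> cs \<mu> D =
     (\<integral>r. measure_pmf.expectation (play M E \<pi> cs r T)
            (\<lambda>as. \<Sum>t<T. Max (\<mu> (cs ! t) ` {..<K}) - \<mu> (cs ! t) (as ! t))
      \<partial>PiM {..<T} D)"

definition regret ::
  "nat \<Rightarrow> nat \<Rightarrow> nat \<Rightarrow> (nat \<times> nat) set \<Rightarrow> policy \<Rightarrow> nat list set \<Rightarrow> ereal" where
  "regret K M T E \<pi> \<C> =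
     (SUP cs\<in>\<C>. SUP (\<mu>, D)\<in>environments K M T. ereal (expected_regret K M T E \<pi> cs \<mu> D))"


section \<open>Polynomial-time implementability\<close>

text \<open>
  As rewards are real numbers, running time is measured on a randomized real RAM, programmed in a
  small while-language. There are two memories, one of natural and one of real numbers; a cell is
  addressed by a constant array name and two computed indices. Each assignment, coin toss and test
  takes one step. Reals can be added, subtracted, multiplied, divided and compared, but not rounded
  or converted to naturals. Naturals have no multiplication: with unit costs, repeated squaring
  would create indices of exponential length.
\<close>

record input =
  num_actions :: nat
  num_contexts :: nat
  total_rounds :: nat
  graph :: "(nat \<times> nat) set"
  past :: history
  current :: nat

type_synonym 'v memory = "nat \<times> nat \<times> nat \<Rightarrow> 'v"
type_synonym store = "nat memory \<times> real memory"

datatype nexp =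
    NConst nat
  | NMem nat nexp nexp
  | NAdd nexp nexp
  | NSub nexp nexp
  | NumActions | NumContexts | Horizon
  | Round
  | CurrentContext
  | Edge nexp nexp
  | PastContext nexp
  | PastAction nexp

datatype rexp =
    OfNat nexp
  | RMem nat nexp nexp
  | RAdd rexp rexp
  | RSub rexp rexp
  | RMul rexp rexp
  | RDiv rexp rexp
  | Observed nexp nexp nexp  \<comment> \<open>round, context, action\<close>

datatype bexp =
    NLess nexp nexp
  | RLess rexp rexp
  | Neg bexp
  | Conj bexp bexp

datatype com =
    Skip
  | NAssign nat nexp nexp nexp
  | RAssign nat nexp nexp rexp
  | Toss nat nexp nexp rexp  \<comment> \<open>stores the outcome of a coin with the given bias\<close>
  | Seq com com
  | Cond bexp com com
  | While bexp com

primrec neval :: "input \<Rightarrow> store \<Rightarrow> nexp \<Rightarrow> nat" where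
  "neval x s (NConst k) = k"
| "neval x s (NMem n i j) = fst s (n, neval x s i, neval x s j)"
| "neval x s (NAdd e f) = neval x s e + neval x s f"
| "neval x s (NSub e f) = neval x s e - neval x s f"
| "neval x s NumActions = num_actions x"
| "neval x s NumContexts = num_contexts x"
| "neval x s Horizon = total_rounds x"
| "neval x s Round = length (past x)"
| "neval x s CurrentContext = current x"
| "neval x s (Edge e f) = of_bool ((neval x s e, neval x s f) \<in> graph x)"
| "neval x s (PastContext e) =
     (let k = neval x s e in if k < length (past x) then fst (past x ! k) else 0)"
| "neval x s (PastAction e) =
     (let k = neval x s e in if k < length (past x) then fst (snd (past x ! k)) else 0)"

primrec reval :: "input \<Rightarrow> store \<Rightarrow> rexp \<Rightarrow> real" where
  "reval x s (OfNat e) = real (neval x s e)"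
| "reval x s (RMem n i j) = snd s (n, neval x s i, neval x s j)"
| "reval x s (RAdd e f) = reval x s e + reval x s f"
| "reval x s (RSub e f) = reval x s e - reval x s f"
| "reval x s (RMul e f) = reval x s e * reval x s f"
| "reval x s (RDiv e f) = reval x s e / reval x s f"
| "reval x s (Observed e f g) =
     (let k = neval x s e in
      if k < length (past x) then snd (snd (past x ! k)) (neval x s f, neval x s g) else 0)"

primrec beval :: "input \<Rightarrow> store \<Rightarrow> bexp \<Rightarrow> bool" where
  "beval x s (NLess e f) \<longleftrightarrow> neval x s e < neval x s f"
| "beval x s (RLess e f) \<longleftrightarrow> reval x s e < reval x s f"
| "beval x s (Neg b) \<longleftrightarrow> \<not> beval x s b"
| "beval x s (Conj b d) \<longleftrightarrow> beval x s b \<and> beval x s d"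

definition nstore :: "input \<Rightarrow> store \<Rightarrow> nat \<Rightarrow> nexp \<Rightarrow> nexp \<Rightarrow> nat \<Rightarrow> store" where
  "nstore x s n i j v = ((fst s)((n, neval x s i, neval x s j) := v), snd s)"

definition rstore :: "input \<Rightarrow> store \<Rightarrow> nat \<Rightarrow> nexp \<Rightarrow> nexp \<Rightarrow> real \<Rightarrow> store" where
  "rstore x s n i j v = (fst s, (snd s)((n, neval x s i, neval x s j) := v))"

text \<open>Small steps; \<open>Skip\<close> is the halting configuration.\<close>

primrec step :: "input \<Rightarrow> com \<Rightarrow> store \<Rightarrow> (com \<times> store) pmf" where
  "step x Skip s = return_pmf (Skip, s)"
| "step x (NAssign n i j e) s = return_pmf (Skip, nstore x s n i j (neval x s e))"
| "step x (RAssign n i j e) s = return_pmf (Skip, rstore x s n i j (reval x s e))"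
| "step x (Toss n i j e) s =
     map_pmf (\<lambda>b. (Skip, nstore x s n i j (of_bool b)))
       (bernoulli_pmf (min 1 (max 0 (reval x s e))))"
| "step x (Seq p q) s =
     (if p = Skip then return_pmf (q, s) else map_pmf (\<lambda>(p', s'). (Seq p' q, s')) (step x p s))"
| "step x (Cond b p q) s = return_pmf (if beval x s b then p else q, s)"
| "step x (While b p) s = return_pmf (if beval x s b then Seq p (While b p) else Skip, s)"

primrec run :: "input \<Rightarrow> com \<Rightarrow> nat \<Rightarrow> (com \<times> store) pmf" where
  "run x p 0 = return_pmf (p, (\<lambda>_. 0, \<lambda>_. 0))"
| "run x p (Suc n) = bind_pmf (run x p n) (\<lambda>(q, s). step x q s)"

definition halts_within :: "input \<Rightarrow> com \<Rightarrow> nat \<Rightarrow> bool" where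
  "halts_within x p n \<longleftrightarrow> (\<forall>(q, s)\<in>set_pmf (run x p n). q = Skip)"

text \<open>The result is read off cell \<open>(0, 0, 0)\<close> of the memory of natural numbers.\<close>

definition output_law :: "input \<Rightarrow> com \<Rightarrow> nat \<Rightarrow> nat pmf" where
  "output_law x p n = map_pmf (\<lambda>(q, s). fst s (0, 0, 0)) (run x p n)"

text \<open>
  A family of policies, one for each \<open>K\<close>, \<open>M\<close>, \<open>T\<close> and strongly observable graph, is implementable
  in polynomial time if a single program, given these data, the past and the current context,
  samples the next action within a number of steps polynomial in \<open>K\<close>, \<open>M\<close> and \<open>T\<close>.
\<close>

definition poly_time_implementable ::
  "(nat \<Rightarrow> nat \<Rightarrow> nat \<Rightarrow> (nat \<times> nat) set \<Rightarrow> policy) \<Rightarrow> bool" where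
  "poly_time_implementable \<pi> \<longleftrightarrow> (\<exists>p C d. \<forall>K M T E.
     K \<ge> 1 \<and> M \<ge> 1 \<and> T \<ge> 1 \<and> digraph_on K E \<and> strongly_observable K E \<longrightarrow>
     (\<forall>cs\<in>context_seqs M T. \<forall>as r.
        length as < T \<and> set as \<subseteq> {..<K} \<and> (\<forall>s z. r s z \<in> {0..1}) \<longrightarrow>
        (let h = history_of M E cs r as;
             c = cs ! length as;
             x = \<lparr>num_actions = K, num_contexts = M, total_rounds = T, graph = E,
                  past = h, current = c\<rparr>;
             n = C * (K + M + T) ^ d
         in halts_within x p n \<and> output_law x p n = \<pi> K M T E h c)))"

end

theory Submission
  imports Defs "HOL-Library.Discrete_Functions" "HOL-Analysis.Harmonic_Numbers"
begin

text \<open>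
  The policy is a deterministic arm elimination. Rounds are organised in layers: while context \<open>c\<close> is
  current, the layer is the least \<open>l\<close> such that some active action has not yet been observed by a play
  in layer \<open>l\<close>, in whatever context. All active actions then have \<open>l\<close> observations, so their gaps are
  at most of order \<open>sqrt (log / l)\<close>, and it remains to bound the number of plays in one layer by
  \<open>beta K E M\<close> up to a logarithm.

  Let \<open>W\<close> be the set of active actions with self-loop that are not yet covered in layer \<open>l\<close>. An epoch
  repeatedly plays a vertex \<open>v\<close> of \<open>W\<close> whose indegree in \<open>W\<close> is at most its outdegree, and removes \<open>v\<close>
  and all its in- and out-neighbours from \<open>W\<close>. The plays of an epoch are independent, and they cover
  at least half of the initial \<open>W\<close>; hence a context has at most \<open>log K + 1\<close> epochs in a layer. If the
  epochs are classified by the dyadic size of their initial \<open>W\<close>, then for each class there is at most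
  one independent set per context, and no arrow leads from an earlier to a later set, because a vertex
  that has been covered in layer \<open>l\<close> is not played there any more. So each class contributes at most
  \<open>beta K E M\<close>. A vertex without self-loop is revealed by every other play, so such vertices cost
  only two further plays per layer.

  The concentration of the adaptively sampled means comes from the exponential supermartingale
  \<open>exp (l S - l\<^sup>2 N / 8)\<close>, where \<open>N\<close> counts the observations of an arm and \<open>S\<close> sums their deviations.
\<close>

section \<open>The policy\<close>

text \<open>Independence within one context excludes arrows in both directions, while between
  contexts only arrows from earlier to later plays are excluded. Coverage of a layer gives the
  latter at no cost; the former forces an epoch to discard in-neighbours of its plays although they
  have not been observed. Playing vertices with at least as many out- as in-neighbours keeps this
  loss no larger than the gain, at the price of logarithmically many epochs instead of one. Coverage
  is shared by all contexts because a play reveals its out-neighbours in every context; only the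
  active set and the epoch start afresh with a new context.

  Two more choices come from the machine model. It has neither logarithms nor roots, so the
  confidence level is a harmonic number and the elimination test compares squares. It keeps nothing
  between rounds, so the state is a function of the history, rebuilt in every round.

  Statistics and combinatorics meet only in the sets \<open>Z t\<close> of actions passing the test:
  the count of plays per layer uses only that a fixed optimal action of the context always
  passes.\<close>

primrec last_such :: "(nat \<Rightarrow> bool) \<Rightarrow> nat \<Rightarrow> nat" where
  "last_such P 0 = 0"
| "last_such P (Suc n) = (if P n then n else last_such P n)"

lemma last_such_less: "0 < n \<Longrightarrow> last_such P n < n"
  by (induction n) (auto simp: less_Suc_eq)

text \<open>A greatest witness is what remains in a cell that a counting loop overwrites at every
  hit, so each search made by the policy is directly a \<open>For\<close> loop of the
  program.\<close>

lemma last_such_holds: "v < n \<Longrightarrow> P v \<Longrightarrow> P (last_such P n) \<and> v \<le> last_such P n"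
  by (induction n) (auto simp: less_Suc_eq)

text \<open>
  The field \<open>origin\<close> is bookkeeping for the analysis only: it is the value of \<open>pending\<close> at the start
  of the current epoch.
\<close>

record sim =
  active :: "nat set"
  pending :: "nat set"
  origin :: "nat set"
  layer :: nat
  covered :: "nat \<Rightarrow> nat set"

text \<open>As \<open>last_such\<close> finds a greatest index, scanning \<open>t - j\<close> over
  \<open>j\<close> yields the least exposed layer up to \<open>t\<close>. If there is none, the
  default \<open>0\<close> gives layer \<open>t\<close>; \<open>exposed\<close> rules this out by
  showing that in a run layer \<open>t\<close> itself is exposed.\<close>

definition layer_of :: "nat \<Rightarrow> nat set \<Rightarrow> (nat \<Rightarrow> nat set) \<Rightarrow> nat" where
  "layer_of t A C = t - last_such (\<lambda>j. \<not> A \<subseteq> C (t - j)) (Suc t)"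

text \<open>Elimination takes effect only between epochs: while \<open>pending\<close> is nonempty
  and the context stays, active set and layer are fixed, which keeps the invariants of the epoch
  intact. A new context discards the unfinished epoch but not \<open>covered\<close>.\<close>

definition prep :: "nat \<Rightarrow> (nat \<times> nat) set \<Rightarrow> nat \<Rightarrow> bool \<Rightarrow> nat set \<Rightarrow> sim \<Rightarrow> sim" where
  "prep K E t new Z s =
     (if \<not> new \<and> pending s \<noteq> {} then s
      else let A = (if new then {..<K} else active s) \<inter> Z;
               l = layer_of t A (covered s);
               W = {a\<in>A. a \<notin> covered s l \<and> (a, a) \<in> E}
           in \<lparr>active = A, pending = W, origin = W, layer = l, covered = covered s\<rparr>)"

definition balanced :: "(nat \<times> nat) set \<Rightarrow> nat set \<Rightarrow> nat \<Rightarrow> bool" where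
  "balanced E W v \<longleftrightarrow> v \<in> W \<and> card {u\<in>W. (u, v) \<in> E} \<le> card {u\<in>W. (v, u) \<in> E}"

definition bare :: "nat \<Rightarrow> sim \<Rightarrow> nat" where
  "bare K s = last_such (\<lambda>v. v \<in> active s \<and> v \<notin> covered s (layer s)) K"

text \<open>With \<open>pending\<close> empty, an exposed active vertex has no self-loop, and by
  strong observability any other active action reveals it. If there is no other one,
  \<open>bare K s\<close> is the only active action, hence the optimal one as long as the optimum
  survives, and playing it is free.\<close>

definition next_action :: "nat \<Rightarrow> (nat \<times> nat) set \<Rightarrow> sim \<Rightarrow> nat" where
  "next_action K E s =
     (if pending s \<noteq> {} then last_such (balanced E (pending s)) K
      else if \<exists>b<K. b \<in> active s \<and> b \<noteq> bare K s
           then last_such (\<lambda>b. b \<in> active s \<and> b \<noteq> bare K s) K else bare K s)"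

definition post :: "(nat \<times> nat) set \<Rightarrow> nat \<Rightarrow> sim \<Rightarrow> sim" where
  "post E a s = s\<lparr>pending := {u\<in>pending s. u \<noteq> a \<and> (u, a) \<notin> E \<and> (a, u) \<notin> E},
     covered := (covered s)(layer s := covered s (layer s) \<union> {u. (a, u) \<in> E})\<rparr>"

definition fresh :: "(nat \<Rightarrow> nat) \<Rightarrow> nat \<Rightarrow> bool" where
  "fresh ctx t \<longleftrightarrow> t = 0 \<or> ctx (t - 1) \<noteq> ctx t"

text \<open>The state before round \<open>t\<close>. Rewards enter only through \<open>Z\<close>,
  and the actions are inputs rather than outputs, so that one recursion serves the policy, its
  analysis and its program.\<close>

primrec simulate :: "nat \<Rightarrow> (nat \<times> nat) set \<Rightarrow> (nat \<Rightarrow> nat set) \<Rightarrow> (nat \<Rightarrow> nat) \<Rightarrow> (nat \<Rightarrow> nat) \<Rightarrow> nat \<Rightarrow> sim" where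
  "simulate K E Z ctx act 0 = \<lparr>active = {}, pending = {}, origin = {}, layer = 0, covered = \<lambda>_. {}\<rparr>"
| "simulate K E Z ctx act (Suc t) =
     post E (act t) (prep K E t (fresh ctx t) (Z t) (simulate K E Z ctx act t))"

definition ready :: "nat \<Rightarrow> (nat \<times> nat) set \<Rightarrow> (nat \<Rightarrow> nat set) \<Rightarrow> (nat \<Rightarrow> nat) \<Rightarrow> (nat \<Rightarrow> nat) \<Rightarrow> nat \<Rightarrow> sim" where
  "ready K E Z ctx act t = prep K E t (fresh ctx t) (Z t) (simulate K E Z ctx act t)"

lemma simulate_cong:
  assumes "\<And>u. u < t \<Longrightarrow> Z u = Z' u" "\<And>u. u < t \<Longrightarrow> ctx u = ctx' u" "\<And>u. u < t \<Longrightarrow> act u = act' u"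
  shows "simulate K E Z ctx act t = simulate K E Z' ctx' act' t"
  using assms
proof (induction t)
  case (Suc t)
  moreover have "fresh ctx t = fresh ctx' t"
    using Suc.prems(2)[of t] Suc.prems(2)[of "t - 1"] by (auto simp: fresh_def)
  ultimately show ?case by simp
qed auto

lemma ready_cong:
  assumes "\<And>u. u \<le> t \<Longrightarrow> Z u = Z' u" "\<And>u. u \<le> t \<Longrightarrow> ctx u = ctx' u" "\<And>u. u < t \<Longrightarrow> act u = act' u"
  shows "ready K E Z ctx act t = ready K E Z' ctx' act' t"
proof -
  have "fresh ctx t = fresh ctx' t"
    using assms(2)[of t] assms(2)[of "t - 1"] by (auto simp: fresh_def)
  moreover have "simulate K E Z ctx act t = simulate K E Z' ctx' act' t"
    by (intro simulate_cong) (use assms in auto)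
  ultimately show ?thesis using assms(1)[of t] by (simp add: ready_def)
qed

section \<open>Elimination tests computed from the observations\<close>

definition obs_count :: "(nat \<times> nat) set \<Rightarrow> (nat \<Rightarrow> nat) \<Rightarrow> nat \<Rightarrow> nat \<Rightarrow> nat" where
  "obs_count E act t a = (\<Sum>u<t. of_bool ((act u, a) \<in> E))"

text \<open>The condition \<open>sqrt (L / n) < d\<close> for both counts, squared and freed of the
  division so that it can be tested without roots. For \<open>0 \<le> L\<close> an action without
  observations neither beats nor is beaten, whatever the division by \<open>0\<close>
  returns.\<close>

definition beaten :: "real \<Rightarrow> nat \<Rightarrow> (nat \<Rightarrow> nat) \<Rightarrow> (nat \<Rightarrow> real) \<Rightarrow> nat \<Rightarrow> nat \<Rightarrow> bool" where
  "beaten L K n S a b \<longleftrightarrow> (let d = S b / n b - S a / n a in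
     0 < d \<and> L < d * d * n a \<and> L < d * d * n b)"

definition survivors :: "real \<Rightarrow> nat \<Rightarrow> (nat \<Rightarrow> nat) \<Rightarrow> (nat \<Rightarrow> real) \<Rightarrow> nat set" where
  "survivors L K n S = {a. a < K \<and> (\<forall>b<K. \<not> beaten L K n S a b)}"

text \<open>A harmonic number stands in for a logarithm, since a loop of divisions and additions
  computes it. The factor \<open>3\<close> makes \<open>exp (- 2 * L)\<close> at most
  \<open>1 / (K + M + T) ^ 6\<close>, which pays for the union bound.\<close>

definition conf :: "nat \<Rightarrow> nat \<Rightarrow> nat \<Rightarrow> real" where
  "conf K M T = 3 * harm (K + M + T)"

text \<open>Each mean deviates by at most \<open>sqrt (L / n)\<close>; a difference of two means
  doubles this, hence \<open>4 * L\<close> under the square.\<close>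

definition passes :: "real \<Rightarrow> nat \<Rightarrow> (nat \<times> nat) set \<Rightarrow> history \<Rightarrow> (nat \<Rightarrow> nat) \<Rightarrow> nat \<Rightarrow> nat set" where
  "passes L K E h ctx t = survivors (4 * L) K (obs_count E (\<lambda>u. fst (snd (h ! u))) t)
     (\<lambda>a. \<Sum>u<t. snd (snd (h ! u)) (ctx t, a))"

definition ctx_of :: "history \<Rightarrow> nat \<Rightarrow> nat \<Rightarrow> nat" where
  "ctx_of h c t = (if t < length h then fst (h ! t) else c)"

definition decide :: "nat \<Rightarrow> nat \<Rightarrow> nat \<Rightarrow> (nat \<times> nat) set \<Rightarrow> history \<Rightarrow> nat \<Rightarrow> nat" where
  "decide K M T E h c = next_action K E
     (ready K E (passes (conf K M T) K E h (ctx_of h c)) (ctx_of h c) (\<lambda>u. fst (snd (h ! u))) (length h))"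

definition elim_policy :: "nat \<Rightarrow> nat \<Rightarrow> nat \<Rightarrow> (nat \<times> nat) set \<Rightarrow> policy" where
  "elim_policy K M T E h c = return_pmf (decide K M T E h c)"

lemma next_action_less: "0 < K \<Longrightarrow> next_action K E s < K"
  by (auto simp: next_action_def bare_def last_such_less)

section \<open>Counting plays per layer\<close>

lemma layer_of_le: "layer_of t A C \<le> t"
  by (simp add: layer_of_def)

lemma layer_of_below:
  assumes "l < layer_of t A C" shows "A \<subseteq> C l"
proof (rule ccontr)
  assume "\<not> A \<subseteq> C l"
  moreover have "t - (t - l) = l" "t - l < Suc t" using assms layer_of_le[of t A C] by auto
  ultimately show False
    using assms last_such_holds[of "t - l" "Suc t" "\<lambda>j. \<not> A \<subseteq> C (t - j)"]
    unfolding layer_of_def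
    by (metis (no_types, lifting) diff_le_mono2 linorder_not_le)
qed

lemma layer_of_exposed:
  assumes "\<not> A \<subseteq> C l" "l \<le> t" shows "\<not> A \<subseteq> C (layer_of t A C)"
  using assms last_such_holds[of "t - l" "Suc t" "\<lambda>j. \<not> A \<subseteq> C (t - j)"]
  unfolding layer_of_def by simp

text \<open>Indegrees and outdegrees within \<open>W\<close> have the same sum, so the indegree
  cannot exceed the outdegree at every vertex.\<close>

lemma ex_balanced:
  assumes "finite W" "W \<noteq> {}"
  shows "\<exists>v. balanced E W v"
proof (rule ccontr)
  assume *: "\<nexists>v. balanced E W v"
  have "(\<Sum>v\<in>W. card {u\<in>W. (v, u) \<in> E}) < (\<Sum>v\<in>W. card {u\<in>W. (u, v) \<in> E})"
    by (rule sum_strict_mono) (use assms * in \<open>auto simp: balanced_def not_le\<close>)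
  moreover have "(\<Sum>v\<in>W. card {u\<in>W. (v, u) \<in> E}) = (\<Sum>v\<in>W. \<Sum>u\<in>W. of_bool ((v, u) \<in> E))"
    using assms by (simp add: Int_def)
  moreover have "(\<Sum>v\<in>W. card {u\<in>W. (u, v) \<in> E}) = (\<Sum>v\<in>W. \<Sum>u\<in>W. of_bool ((u, v) \<in> E))"
    using assms by (simp add: Int_def)
  moreover have "(\<Sum>v\<in>W. \<Sum>u\<in>W. of_bool ((v, u) \<in> E) :: nat) = (\<Sum>v\<in>W. \<Sum>u\<in>W. of_bool ((u, v) \<in> E))"
    by (rule sum.swap)
  ultimately show False by simp
qed

section \<open>Sets of plays bounded by \<open>beta\<close>\<close>

lemma finite_beta_candidates:
  "finite {\<Sum>c<M. card (I c) | I :: nat \<Rightarrow> nat set. disjoint_family_on I {..<M} \<and>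
     (\<forall>c<M. independent_in K E (I c)) \<and>
     (\<forall>i j. i < j \<and> j < M \<longrightarrow> (\<forall>u\<in>I i. \<forall>v\<in>I j. (u, v) \<notin> E))}"
proof (rule finite_subset)
  show "{\<Sum>c<M. card (I c) | I :: nat \<Rightarrow> nat set. disjoint_family_on I {..<M} \<and>
     (\<forall>c<M. independent_in K E (I c)) \<and>
     (\<forall>i j. i < j \<and> j < M \<longrightarrow> (\<forall>u\<in>I i. \<forall>v\<in>I j. (u, v) \<notin> E))} \<subseteq> {..M * K}"
  proof safe
    fix I :: "nat \<Rightarrow> nat set" assume I: "\<forall>c<M. independent_in K E (I c)"
    have "(\<Sum>c<M. card (I c)) \<le> (\<Sum>c<M. K)"
    proof (rule sum_mono)
      fix c assume "c \<in> {..<M}"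
      with I have "I c \<subseteq> {..<K}" by (auto simp: independent_in_def)
      from card_mono[OF _ this] show "card (I c) \<le> K" by simp
    qed
    then show "(\<Sum>c<M. card (I c)) \<le> M * K" by simp
  qed
qed simp

lemma beta_ge:
  assumes "disjoint_family_on I {..<M}" "\<And>c. c < M \<Longrightarrow> independent_in K E (I c)"
    "\<And>i j u v. i < j \<Longrightarrow> j < M \<Longrightarrow> u \<in> I i \<Longrightarrow> v \<in> I j \<Longrightarrow> (u, v) \<notin> E"
  shows "(\<Sum>c<M. card (I c)) \<le> beta K E M"
  unfolding beta_def by (rule Max_ge[OF finite_beta_candidates]) (use assms in auto)

lemma beta_pos:
  assumes "1 \<le> K" "1 \<le> M" shows "1 \<le> beta K E M"
proof -
  define I where "I c = (if c = 0 then {0::nat} else {})" for c :: nat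
  have "(\<Sum>c<M. card (I c)) \<le> beta K E M"
    by (rule beta_ge) (use assms in \<open>auto simp: I_def disjoint_family_on_def independent_in_def\<close>)
  moreover have "card (I 0) \<le> (\<Sum>c<M. card (I c))"
    by (rule member_le_sum) (use assms in auto)
  ultimately show ?thesis by (simp add: I_def)
qed

text \<open>
  Contexts are numbered by their first appearance; along this numbering, arrows from earlier to later
  rounds are arrows from earlier to later sets.
\<close>

lemma card_le_beta:
  fixes ctx act :: "nat \<Rightarrow> nat"
  assumes Q: "Q \<subseteq> {..<T}"
    and ctx: "\<And>t. t < T \<Longrightarrow> ctx t < M"
    and sa: "\<And>s u t. s \<le> u \<Longrightarrow> u \<le> t \<Longrightarrow> t < T \<Longrightarrow> ctx s = ctx t \<Longrightarrow> ctx u = ctx s"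
    and act: "\<And>t. t \<in> Q \<Longrightarrow> act t < K" "\<And>t. t \<in> Q \<Longrightarrow> (act t, act t) \<in> E"
    and fwd: "\<And>t t'. t \<in> Q \<Longrightarrow> t' \<in> Q \<Longrightarrow> t < t' \<Longrightarrow> (act t, act t') \<notin> E"
    and bwd: "\<And>t t'. t \<in> Q \<Longrightarrow> t' \<in> Q \<Longrightarrow> t < t' \<Longrightarrow> ctx t = ctx t' \<Longrightarrow> (act t', act t) \<notin> E"
  shows "card Q \<le> beta K E M"
proof -
  define F where "F = {t. t < T \<and> (\<forall>s<t. ctx s \<noteq> ctx t)}"
  define ts where "ts = sorted_list_of_set F"
  have finF: "finite F" by (simp add: F_def)
  have injF: "inj_on ctx F"
    by (rule inj_onI) (metis (mono_tags, lifting) F_def linorder_neqE_nat mem_Collect_eq)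
  have len: "length ts \<le> M"
  proof -
    have "card F = card (ctx ` F)" using injF by (simp add: card_image)
    also have "\<dots> \<le> card {..<M}" by (rule card_mono) (use ctx in \<open>auto simp: F_def\<close>)
    finally show ?thesis by (simp add: ts_def)
  qed
  have set_ts: "set ts = F" using finF by (simp add: ts_def)
  have mono_ts: "ts ! i < ts ! j" if "i < j" "j < length ts" for i j
    using strict_sorted_list_of_set[of F] that by (simp add: ts_def sorted_wrt_iff_nth_less)
  \<comment> \<open>Fewer than \<open>M\<close> contexts may occur; the sets from index
    \<open>length ts\<close> on are then empty.\<close>
  define P where "P i = (if i < length ts then {t\<in>Q. ctx t = ctx (ts ! i)} else {})" for i
  define I where "I i = act ` P i" for i
  have PQ: "P i \<subseteq> Q" for i by (auto simp: P_def)
  have finQ: "finite Q" using Q finite_subset by blast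
  \<comment> \<open>A repeated action would be an arrow from its earlier to its later play, by its
    self-loop.\<close>
  have inj: "inj_on act Q"
    by (rule inj_onI) (metis act(2) fwd linorder_neqE_nat)
  have before: "t < t'" if "i < j" "t \<in> P i" "t' \<in> P j" for i j t t'
  proof -
    from that have ij: "i < length ts" "j < length ts" by (auto simp: P_def split: if_splits)
    from that ij have tt: "t < T" "t' < T" "ctx t = ctx (ts ! i)" "ctx t' = ctx (ts ! j)"
      using Q by (auto simp: P_def)
    from ij set_ts have F: "ts ! i \<in> F" "ts ! j \<in> F" by (metis nth_mem)+
    from mono_ts[OF that(1) ij(2)] have lt: "ts ! i < ts ! j" .
    then have ne: "ctx (ts ! i) \<noteq> ctx (ts ! j)" using F by (auto simp: F_def)
    have "ts ! j \<le> t'" using F(2) tt by (metis (mono_tags, lifting) F_def linorder_not_le mem_Collect_eq)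
    show ?thesis
    proof (rule ccontr)
      assume "\<not> t < t'"
      \<comment> \<open>The first round of the later context would lie between two rounds of the
        earlier one, inside its block.\<close>
      then have "ctx (ts ! j) = ctx (ts ! i)"
        using sa[of "ts ! i" "ts ! j" t] lt \<open>ts ! j \<le> t'\<close> tt by auto
      with ne show False by simp
    qed
  qed
  have cov: "Q \<subseteq> (\<Union>i<M. P i)"
  proof
    fix t assume t: "t \<in> Q"
    then have tT: "t < T" using Q by auto
    define s where "s = (LEAST s. ctx s = ctx t)"
    have s: "ctx s = ctx t" unfolding s_def by (rule LeastI) simp
    have st: "s \<le> t" unfolding s_def by (rule Least_le) simp
    have "ctx s' \<noteq> ctx s" if "s' < s" for s'
      using not_less_Least[of s' "\<lambda>s. ctx s = ctx t"] that s by (auto simp: s_def)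
    with st tT have "s \<in> F" by (auto simp: F_def)
    then obtain i where "i < length ts" "ts ! i = s" using set_ts by (metis in_set_conv_nth)
    with t s have "t \<in> P i" by (auto simp: P_def)
    moreover have "i < M" using \<open>i < length ts\<close> len by simp
    ultimately show "t \<in> (\<Union>i<M. P i)" by blast
  qed
  have "card Q \<le> card (\<Union>i<M. P i)"
    by (rule card_mono[OF _ cov]) (use PQ finQ in \<open>auto intro: finite_subset\<close>)
  also have "\<dots> \<le> (\<Sum>i<M. card (P i))" by (rule card_UN_le) simp
  also have "\<dots> = (\<Sum>i<M. card (I i))"
    by (rule sum.cong) (use inj PQ in \<open>auto simp: I_def card_image inj_on_subset\<close>)
  also have "\<dots> \<le> beta K E M"
  proof (rule beta_ge)
    show "disjoint_family_on I {..<M}"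
      unfolding disjoint_family_on_def
    proof (intro ballI impI)
      fix m n assume "m \<in> {..<M}" "n \<in> {..<M}" "m \<noteq> (n::nat)"
      then have "P m \<inter> P n = {}"
        by (metis before disjoint_iff less_irrefl linorder_neqE_nat)
      then show "I m \<inter> I n = {}"
        using inj PQ[of m] PQ[of n] by (simp add: I_def flip: inj_on_image_Int)
    qed
    show "independent_in K E (I c)" if "c < M" for c
      unfolding independent_in_def
    proof (intro conjI ballI impI)
      show "I c \<subseteq> {..<K}" using act(1) PQ[of c] by (auto simp: I_def)
      fix u v assume "u \<in> I c" "v \<in> I c" and ne: "u \<noteq> v"
      then obtain t t' where t: "t \<in> P c" "t' \<in> P c" "u = act t" "v = act t'" by (auto simp: I_def)
      then have "t \<noteq> t'" "ctx t = ctx t'" using ne by (auto simp: P_def split: if_splits)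
      then show "(u, v) \<notin> E" using fwd bwd t PQ[of c] by (metis linorder_neqE_nat subsetD)
    qed
    show "(u, v) \<notin> E" if "i < j" "j < M" "u \<in> I i" "v \<in> I j" for i j u v
      using that before[of i j] fwd PQ[of i] PQ[of j] by (auto simp: I_def) blast
  qed
  finally show ?thesis .
qed

text \<open>The rewards have disappeared: \<open>Z\<close> is any sequence of sets that contains, in
  each round, a distinguished action \<open>opt\<close> of the current context. Everything in this
  locale is deterministic.\<close>

locale elimination_run =
  fixes K M T :: nat and E :: "(nat \<times> nat) set" and Z :: "nat \<Rightarrow> nat set"
    and ctx act :: "nat \<Rightarrow> nat" and opt :: "nat \<Rightarrow> nat"
  assumes E: "digraph_on K E" and so: "strongly_observable K E"
    and K: "1 \<le> K" and M: "1 \<le> M"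
    and ctx: "t < T \<Longrightarrow> ctx t < M"
    and sa: "s \<le> u \<Longrightarrow> u \<le> t \<Longrightarrow> t < T \<Longrightarrow> ctx s = ctx t \<Longrightarrow> ctx u = ctx s"
    and act: "t < T \<Longrightarrow> act t = next_action K E (ready K E Z ctx act t)"
    and opt: "t < T \<Longrightarrow> opt (ctx t) \<in> Z t" "t < T \<Longrightarrow> opt (ctx t) < K"
begin

section \<open>The invariant of an epoch\<close>

abbreviation "R t \<equiv> ready K E Z ctx act t"
abbreviation "S t \<equiv> simulate K E Z ctx act t"
abbreviation "lay t \<equiv> layer (R t)"

text \<open>By the inequality, the vertices removed from the origin number at most twice the covered
  ones; once \<open>pending\<close> is empty, half of the origin is covered. As the origin contains
  every exposed active vertex with self-loop, the next epoch of the same context and layer is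
  confined to the other half.\<close>

definition wf_sim :: "sim \<Rightarrow> bool" where
  "wf_sim s \<longleftrightarrow> active s \<subseteq> {..<K} \<and> pending s \<subseteq> origin s - covered s (layer s) \<and>
     origin s \<subseteq> active s \<and> (\<forall>a\<in>origin s. (a, a) \<in> E) \<and>
     card (origin s) \<le> card (pending s) + 2 * card (origin s \<inter> covered s (layer s)) \<and>
     {a\<in>active s. a \<notin> covered s (layer s) \<and> (a, a) \<in> E} \<subseteq> origin s \<and>
     (\<forall>l<layer s. active s \<subseteq> covered s l)"

lemma wf_sim_prep:
  assumes "wf_sim s" shows "wf_sim (prep K E t new Y s)"
proof (cases "\<not> new \<and> pending s \<noteq> {}")
  case False
  show ?thesis
    using False assms layer_of_below
    by (auto simp: prep_def Let_def wf_sim_def)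
qed (use assms in \<open>auto simp: prep_def\<close>)

lemma next_action_pending:
  assumes "wf_sim s" "pending s \<noteq> {}"
  shows "balanced E (pending s) (next_action K E s)"
proof -
  have sub: "pending s \<subseteq> {..<K}" using assms by (auto simp: wf_sim_def)
  obtain v where v: "balanced E (pending s) v"
    using ex_balanced[of "pending s" E] sub assms(2) finite_subset[OF sub] by blast
  then have "v < K" using sub by (auto simp: balanced_def)
  from last_such_holds[OF this, of "balanced E (pending s)"] v assms(2) show ?thesis
    by (simp add: next_action_def)
qed

text \<open>
  Playing a balanced vertex covers at least half of the vertices that it removes from \<open>pending\<close>.
\<close>

lemma wf_sim_post:
  assumes wf: "wf_sim s" and a: "a = next_action K E s"
  shows "wf_sim (post E a s)"
proof -
  let ?W = "pending s" and ?C = "covered s (layer s)" and ?O = "origin s"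
  let ?W' = "{u\<in>?W. u \<noteq> a \<and> (u, a) \<notin> E \<and> (a, u) \<notin> E}"
  let ?C' = "?C \<union> {u. (a, u) \<in> E}"
  have fin: "finite ?O" "finite ?W"
    using wf finite_subset[of "active s" "{..<K}"] by (auto simp: wf_sim_def intro: finite_subset)
  have "card ?O \<le> card ?W' + 2 * card (?O \<inter> ?C')"
  proof (cases "?W = {}")
    case True
    have "card (?O \<inter> ?C) \<le> card (?O \<inter> ?C')" by (rule card_mono) (use fin in auto)
    then show ?thesis using wf True by (auto simp: wf_sim_def)
  next
    case False
    let ?in = "{u\<in>?W. (u, a) \<in> E}" and ?out = "{u\<in>?W. (a, u) \<in> E}"
    from next_action_pending[OF wf False] a have b: "a \<in> ?W" "card ?in \<le> card ?out"
      by (auto simp: balanced_def)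
    \<comment> \<open>The self-loop puts \<open>a\<close> among its own neighbours, so its removal
      needs no extra term.\<close>
    have loop: "(a, a) \<in> E" using b wf by (auto simp: wf_sim_def)
    have "?W = ?W' \<union> (?in \<union> ?out)" using loop by auto
    then have "card ?W = card (?W' \<union> (?in \<union> ?out))" by (rule arg_cong)
    also have "\<dots> \<le> card ?W' + card (?in \<union> ?out)" by (rule card_Un_le)
    also have "card (?in \<union> ?out) \<le> card ?in + card ?out" by (rule card_Un_le)
    finally have 1: "card ?W \<le> card ?W' + 2 * card ?out" using b by simp
    \<comment> \<open>\<open>pending\<close> avoids the covered set, so all out-neighbours in it are
      newly covered.\<close>
    have "card (?O \<inter> ?C) + card ?out = card ((?O \<inter> ?C) \<union> ?out)"
      by (rule card_Un_disjoint[symmetric]) (use fin wf in \<open>auto simp: wf_sim_def\<close>)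
    also have "\<dots> \<le> card (?O \<inter> ?C')"
      by (rule card_mono) (use fin wf in \<open>auto simp: wf_sim_def\<close>)
    finally have "card (?O \<inter> ?C) + card ?out \<le> card (?O \<inter> ?C')" .
    moreover have "card ?O \<le> card ?W + 2 * card (?O \<inter> ?C)" using wf by (auto simp: wf_sim_def)
    ultimately show ?thesis using 1 by simp
  qed
  then show ?thesis using wf by (auto simp: wf_sim_def post_def)
qed

lemma wf_S: "t \<le> T \<Longrightarrow> wf_sim (S t)"
proof (induction t)
  case (Suc t)
  then have "wf_sim (R t)" unfolding ready_def by (intro wf_sim_prep) simp
  from wf_sim_post[OF this, of "act t"] act[of t] Suc.prems show ?case
    by (simp add: ready_def)
qed (simp add: wf_sim_def)

lemma wf_R: "t \<le> T \<Longrightarrow> wf_sim (R t)"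
  unfolding ready_def by (intro wf_sim_prep wf_S)

lemma S_Suc: "S (Suc t) = post E (act t) (R t)"
  by (simp add: ready_def)

lemma covered_R: "covered (R t) = covered (S t)"
  by (simp add: ready_def prep_def Let_def)

lemma layer_post [simp]: "layer (post E a s) = layer s"
  and active_post [simp]: "active (post E a s) = active s"
  and origin_post [simp]: "origin (post E a s) = origin s"
  by (simp_all add: post_def)

text \<open>Layers grow no faster than time, so before round \<open>t\<close> no play has been made
  in layer \<open>t\<close>, and there is always an exposed layer to choose.\<close>

lemma lay_le: "lay t \<le> t"
proof (induction t)
  case 0
  show ?case by (simp add: ready_def prep_def fresh_def Let_def layer_of_def)
next
  case (Suc t)
  then show ?case
    using layer_of_le[of "Suc t"] by (simp add: ready_def[of K E Z ctx act "Suc t"] prep_def Let_def S_Suc del: simulate.simps)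
qed

lemma covered_S: "covered (S t) l = {a. \<exists>u<t. lay u = l \<and> (act u, a) \<in> E}"
proof (induction t)
  case (Suc t)
  show ?case
    unfolding S_Suc using Suc by (auto simp: post_def covered_R less_Suc_eq)
qed simp

lemma not_fresh_ctx: "\<not> fresh ctx t \<Longrightarrow> 0 < t \<and> ctx t = ctx (t - 1)"
  by (auto simp: fresh_def)

lemma opt_active: "t < T \<Longrightarrow> opt (ctx t) \<in> active (R t)"
proof (induction t)
  case 0
  then show ?case using opt[of 0] by (auto simp: ready_def prep_def fresh_def Let_def)
next
  case (Suc t)
  show ?case
  proof (cases "fresh ctx (Suc t)")
    case True
    then show ?thesis using opt[OF Suc.prems] by (auto simp: ready_def prep_def Let_def)
  next
    case False
    with not_fresh_ctx[OF this] Suc have "opt (ctx (Suc t)) \<in> active (S (Suc t))"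
      by (simp add: S_Suc del: simulate.simps)
    with False show ?thesis using opt[OF Suc.prems]
      by (auto simp: ready_def[of K E Z ctx act "Suc t"] prep_def Let_def simp del: simulate.simps)
  qed
qed

lemma exposed: "t < T \<Longrightarrow> \<not> active (R t) \<subseteq> covered (S t) (layer_of t (active (R t)) (covered (S t)))"
proof (rule layer_of_exposed)
  assume "t < T"
  have "covered (S t) t = {}"
    using lay_le by (auto simp: covered_S) (metis linorder_not_le)
  with opt_active[OF \<open>t < T\<close>] show "\<not> active (R t) \<subseteq> covered (S t) t" by auto
qed simp

lemma ready_cases:
  assumes "t < T"
  obtains (cont) "\<not> fresh ctx t" "pending (S t) \<noteq> {}" "R t = S t"
  | (start) "fresh ctx t \<or> pending (S t) = {}" "active (R t) \<subseteq> Z t"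
      "\<not> fresh ctx t \<Longrightarrow> active (R t) \<subseteq> active (S t)"
      "pending (R t) = {a\<in>active (R t). a \<notin> covered (S t) (lay t) \<and> (a, a) \<in> E}"
      "origin (R t) = pending (R t)" "\<not> active (R t) \<subseteq> covered (S t) (lay t)"
proof (cases "\<not> fresh ctx t \<and> pending (S t) \<noteq> {}")
  case True
  then show ?thesis by (intro cont) (auto simp: ready_def prep_def)
next
  case False
  have "lay t = layer_of t (active (R t)) (covered (S t))"
    using False by (auto simp: ready_def prep_def Let_def)
  with False exposed[OF assms] show ?thesis
    by (intro start) (auto simp: ready_def prep_def Let_def)
qed

section \<open>Rounds without pending vertices\<close>

lemma bare_R:
  assumes t: "t < T" and p: "pending (R t) = {}"
  shows "bare K (R t) \<in> active (R t)" "bare K (R t) \<notin> covered (S t) (lay t)"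
    "(bare K (R t), bare K (R t)) \<notin> E" "bare K (R t) < K"
proof -
  have *: "\<not> active (R t) \<subseteq> covered (S t) (lay t)"
    "pending (R t) = {a\<in>active (R t). a \<notin> covered (S t) (lay t) \<and> (a, a) \<in> E}"
    using ready_cases[OF t] p by metis+
  then obtain v where v: "v \<in> active (R t)" "v \<notin> covered (S t) (lay t)" by auto
  then have "v < K" using wf_R[of t] t by (auto simp: wf_sim_def)
  from last_such_holds[OF this, of "\<lambda>v. v \<in> active (R t) \<and> v \<notin> covered (R t) (lay t)"] v
  have "bare K (R t) \<in> active (R t) - covered (S t) (lay t)" by (simp add: bare_def covered_R)
  with * p wf_R[of t] t show "bare K (R t) \<in> active (R t)" "bare K (R t) \<notin> covered (S t) (lay t)"
    "(bare K (R t), bare K (R t)) \<notin> E" "bare K (R t) < K" by (auto simp: wf_sim_def)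
qed

lemma act_active: "t < T \<Longrightarrow> act t \<in> active (R t)"
proof (cases "pending (R t) = {}")
  case False
  assume "t < T"
  with next_action_pending[OF wf_R False] have "act t \<in> pending (R t)"
    by (simp add: act balanced_def)
  then show ?thesis using wf_R[of t] \<open>t < T\<close> by (auto simp: wf_sim_def)
next
  case True
  assume t: "t < T"
  show ?thesis
  proof (cases "\<exists>b<K. b \<in> active (R t) \<and> b \<noteq> bare K (R t)")
    case ex: True
    then obtain b where "b < K" "b \<in> active (R t) \<and> b \<noteq> bare K (R t)" by blast
    from last_such_holds[OF this(1), of "\<lambda>b. b \<in> active (R t) \<and> b \<noteq> bare K (R t)"] this(2) ex True
    show ?thesis by (simp add: act[OF t] next_action_def)
  next
    case False
    then show ?thesis using bare_R(1)[OF t True] True by (auto simp: act[OF t] next_action_def)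
  qed
qed

lemma act_less: "t < T \<Longrightarrow> act t < K"
  using act_active[of t] wf_R[of t] by (auto simp: wf_sim_def)

text \<open>\<open>bare\<close> is played only for want of another active action, and the optimum is
  active.\<close>

lemma act_opt:
  assumes t: "t < T" and "pending (R t) = {}" "act t = bare K (R t)"
  shows "act t = opt (ctx t)"
proof (rule ccontr)
  assume ne: "act t \<noteq> opt (ctx t)"
  let ?P = "\<lambda>b. b \<in> active (R t) \<and> b \<noteq> bare K (R t)"
  have o: "opt (ctx t) < K" "?P (opt (ctx t))"
    using opt(2)[OF t] opt_active[OF t] ne assms by auto
  then have "\<exists>b<K. ?P b" by blast
  then have "act t = last_such ?P K"
    using assms(2) act[OF t] unfolding next_action_def by (simp only: if_True if_False simp_thms)
  with last_such_holds[of _ K ?P, OF o] assms show False by simp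
qed

text \<open>
  Any play other than of a vertex \<open>v\<close> without self-loop reveals \<open>v\<close>; hence a third such round in the
  same layer is impossible.
\<close>

lemma card_bare:
  "card {t. t < T \<and> pending (R t) = {} \<and> act t \<noteq> bare K (R t) \<and> lay t = l} \<le> 2"
proof (rule ccontr)
  let ?Q = "{t. t < T \<and> pending (R t) = {} \<and> act t \<noteq> bare K (R t) \<and> lay t = l}"
  assume "\<not> card ?Q \<le> 2"
  have key: "act t = bare K (R t')" if "t \<in> ?Q" "t' \<in> ?Q" "t < t'" for t t'
  proof (rule ccontr)
    let ?v = "bare K (R t')"
    assume "act t \<noteq> ?v"
    moreover from that have "?v < K" "(?v, ?v) \<notin> E" "?v \<notin> covered (S t') (lay t')"
      using bare_R[of t'] by auto
    ultimately have "(act t, ?v) \<in> E"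
      using so act_less[of t] that by (auto simp: strongly_observable_def)
    with \<open>?v \<notin> covered (S t') (lay t')\<close> that show False by (auto simp: covered_S)
  qed
  have fin: "finite ?Q" by simp
  define a where "a = Min ?Q"
  define c where "c = Max ?Q"
  have ne: "?Q \<noteq> {}" using \<open>\<not> card ?Q \<le> 2\<close> by (metis card.empty zero_le)
  have "\<not> ?Q \<subseteq> {a, c}"
    using card_mono[of "{a, c}" ?Q] \<open>\<not> card ?Q \<le> 2\<close> by (auto simp: card_insert_if split: if_splits)
  then obtain b where b: "b \<in> ?Q" "b \<noteq> a" "b \<noteq> c" by auto
  have ac: "a \<in> ?Q" "c \<in> ?Q" unfolding a_def c_def using Min_in[OF fin ne] Max_in[OF fin ne] by auto
  have "a < b" "b < c"
    using Min_le[OF fin b(1)] Max_ge[OF fin b(1)] b(2,3) by (auto simp: a_def c_def)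
  \<comment> \<open>All three values coincide, so the middle round would play its own
    \<open>bare\<close> vertex.\<close>
  then have "act a = bare K (R b)" "act a = bare K (R c)" "act b = bare K (R c)"
    using key[of a b] key[of a c] key[of b c] ac b(1) by auto
  then show False using b(1) by auto
qed

section \<open>Missing arrows between the plays of one layer\<close>

lemma act_pending: "t < T \<Longrightarrow> pending (R t) \<noteq> {} \<Longrightarrow> act t \<in> pending (R t)"
  using next_action_pending[OF wf_R] by (simp add: act balanced_def)

text \<open>Pending vertices are uncovered in their layer, whatever the contexts in which its
  earlier plays were made.\<close>

lemma forward:
  assumes "t < t'" "t' < T" "pending (R t') \<noteq> {}" "lay t = lay t'"
  shows "(act t, act t') \<notin> E"
  using act_pending[of t'] assms wf_R[of t'] by (auto simp: wf_sim_def covered_R covered_S)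

text \<open>If an epoch ends and the layer stays, its successor starts from the exposed part of its
  origin, which is at most half of it. If the epoch goes on, \<open>post\<close> has just deleted
  the in-neighbours of the last play.\<close>

lemma one_step:
  assumes t: "Suc t < T" and nf: "\<not> fresh ctx (Suc t)"
  shows "lay t \<le> lay (Suc t)" and
    "lay (Suc t) = lay t \<Longrightarrow> 2 * card (origin (R (Suc t))) \<le> card (origin (R t)) \<or>
      origin (R (Suc t)) = origin (R t) \<and> pending (R (Suc t)) \<subseteq> {u\<in>pending (R t). (u, act t) \<notin> E}"
proof -
  let ?s = "S (Suc t)" and ?r = "R (Suc t)"
  have s: "layer ?s = lay t" "origin ?s = origin (R t)" "active ?s = active (R t)"
    by (simp_all add: S_Suc del: simulate.simps)
  have wf: "wf_sim ?s" using wf_S[of "Suc t"] t by simp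
  have "lay t \<le> lay (Suc t) \<and> (lay (Suc t) = lay t \<longrightarrow> 2 * card (origin ?r) \<le> card (origin (R t)) \<or>
      origin ?r = origin (R t) \<and> pending ?r \<subseteq> {u\<in>pending (R t). (u, act t) \<notin> E})"
  proof (cases rule: ready_cases[OF t])
    case 1
    then show ?thesis using s by (simp add: S_Suc del: simulate.simps) (auto simp: post_def)
  next
    case 2
    from 2(3)[OF nf] have sub: "active ?r \<subseteq> active ?s" .
    have "lay t \<le> lay (Suc t)"
    proof (rule ccontr)
      assume "\<not> lay t \<le> lay (Suc t)"
      \<comment> \<open>Below the current layer the active set is covered, and within a context it
        only shrinks.\<close>
      then have "active ?s \<subseteq> covered ?s (lay (Suc t))" using wf s by (auto simp: wf_sim_def)
      with sub 2(6) show False by blast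
    qed
    moreover have "2 * card (origin ?r) \<le> card (origin (R t))" if eq: "lay (Suc t) = lay t"
    proof -
      let ?O = "origin ?s" and ?C = "covered ?s (lay t)"
      have finO: "finite ?O"
        using wf by (metis finite_lessThan finite_subset wf_sim_def)
      have "origin ?r \<subseteq> ?O - ?C"
        using 2 sub wf eq s by (auto simp: wf_sim_def)
      then have "card (origin ?r) \<le> card (?O - ?C)" by (rule card_mono[rotated]) (use finO in auto)
      also have "card (?O - ?C) = card ?O - card (?O \<inter> ?C)" using finO by (simp add: card_Diff_subset_Int)
      finally have "card (origin ?r) + card (?O \<inter> ?C) \<le> card ?O"
        using card_mono[of ?O "?O \<inter> ?C"] finO by auto
      \<comment> \<open>A new epoch without a new context means that \<open>pending ?s\<close> is
        empty.\<close>
      moreover have "card ?O \<le> 2 * card (?O \<inter> ?C)"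
        using wf 2(1) nf s by (auto simp: wf_sim_def)
      ultimately show ?thesis using s by simp
    qed
    ultimately show ?thesis by blast
  qed
  then show "lay t \<le> lay (Suc t)" 
    "lay (Suc t) = lay t \<Longrightarrow> 2 * card (origin (R (Suc t))) \<le> card (origin (R t)) \<or>
      origin (R (Suc t)) = origin (R t) \<and> pending (R (Suc t)) \<subseteq> {u\<in>pending (R t). (u, act t) \<notin> E}"
    by blast+
qed

text \<open>Both alternatives of \<open>one_step\<close> compose: within a context and layer origins
  never grow, and deletions from \<open>pending\<close> last as long as the epoch.\<close>

lemma many_steps:
  assumes "t < t'" "t' < T" "ctx t = ctx t'"
  shows "lay t \<le> lay t' \<and> (lay t' = lay t \<longrightarrow> 2 * card (origin (R t')) \<le> card (origin (R t)) \<or>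
      origin (R t') = origin (R t) \<and> pending (R t') \<subseteq> {u\<in>pending (R t). (u, act t) \<notin> E})"
  using assms
proof (induction t')
  case (Suc t')
  have c: "ctx t' = ctx t" using sa[of t t' "Suc t'"] Suc.prems by simp
  then have nf: "\<not> fresh ctx (Suc t')" using Suc.prems by (simp add: fresh_def)
  note one = one_step[OF Suc.prems(2) nf]
  show ?case
  proof (cases "t = t'")
    case True
    with one show ?thesis by auto
  next
    case False
    with Suc c have IH: "lay t \<le> lay t'" "lay t' = lay t \<Longrightarrow> 2 * card (origin (R t')) \<le> card (origin (R t)) \<or>
      origin (R t') = origin (R t) \<and> pending (R t') \<subseteq> {u\<in>pending (R t). (u, act t) \<notin> E}" by auto
    show ?thesis
    proof (intro conjI impI)
      show "lay t \<le> lay (Suc t')" using IH one by linarith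
      assume "lay (Suc t') = lay t"
      then have "lay t' = lay t" "lay (Suc t') = lay t'" using IH one by linarith+
      then consider "2 * card (origin (R (Suc t'))) \<le> card (origin (R t'))" 
        | "origin (R (Suc t')) = origin (R t')" "pending (R (Suc t')) \<subseteq> pending (R t')"
        using one by blast
      then show "2 * card (origin (R (Suc t'))) \<le> card (origin (R t)) \<or>
        origin (R (Suc t')) = origin (R t) \<and> pending (R (Suc t')) \<subseteq> {u\<in>pending (R t). (u, act t) \<notin> E}"
        using IH(2)[OF \<open>lay t' = lay t\<close>]
        apply cases
        apply fastforce
        by (elim disjE; simp; blast)
    qed
  qed
qed simp

text \<open>Plays of one context and layer whose origins lie in the same dyadic class belong to the
  same epoch, because from one epoch to the next the origin halves. Within an epoch the
  in-neighbours of a play are deleted and never played later.\<close>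

lemma backward:
  assumes "t < t'" "t' < T" "ctx t = ctx t'" "pending (R t') \<noteq> {}" "lay t = lay t'"
    "floor_log (card (origin (R t))) = floor_log (card (origin (R t')))"
  shows "(act t', act t) \<notin> E"
proof -
  let ?a = "card (origin (R t'))" and ?b = "card (origin (R t))"
  have wf: "wf_sim (R t')" using assms by (intro wf_R) simp
  have "origin (R t') \<noteq> {}" "finite (origin (R t'))"
    using wf assms(4) finite_subset[of "active (R t')" "{..<K}"]
    by (auto simp: wf_sim_def intro: finite_subset)
  then have "?a \<noteq> 0" by simp
  then have "\<not> 2 * ?a \<le> ?b"
    using assms(6) floor_log_le_iff[of "2 * ?a" ?b] by auto
  with many_steps[OF assms(1-3)] assms(5) have "pending (R t') \<subseteq> {u\<in>pending (R t). (u, act t) \<notin> E}"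
    by simp
  then show ?thesis using act_pending[of t'] assms by auto
qed

lemma card_pending:
  "card {t. t < T \<and> pending (R t) \<noteq> {} \<and> lay t = l} \<le> (floor_log K + 1) * beta K E M"
proof -
  let ?Q = "\<lambda>k. {t. t < T \<and> pending (R t) \<noteq> {} \<and> lay t = l \<and> floor_log (card (origin (R t))) = k}"
  have "card (origin (R t)) \<le> K" if "t < T" for t
    using card_mono[of "{..<K}" "origin (R t)"] wf_R[of t] that by (auto simp: wf_sim_def)
  then have "{t. t < T \<and> pending (R t) \<noteq> {} \<and> lay t = l} \<subseteq> (\<Union>k\<in>{..floor_log K}. ?Q k)"
    using floor_log_le_iff by auto
  then have "card {t. t < T \<and> pending (R t) \<noteq> {} \<and> lay t = l} \<le> card (\<Union>k\<in>{..floor_log K}. ?Q k)"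
    by (rule card_mono[rotated]) auto
  also have "\<dots> \<le> (\<Sum>k\<le>floor_log K. card (?Q k))" by (rule card_UN_le) simp
  also have "\<dots> \<le> (\<Sum>k\<le>floor_log K. beta K E M)"
  proof (rule sum_mono, rule card_le_beta[where T = T and ctx = ctx and act = act])
    fix k
    show "(act t, act t) \<in> E" if "t \<in> ?Q k" for t
      using act_pending[of t] wf_R[of t] that by (auto simp: wf_sim_def)
    show "(act t, act t') \<notin> E" if "t \<in> ?Q k" "t' \<in> ?Q k" "t < t'" for t t'
      using that forward[of t t'] by auto
    show "(act t', act t) \<notin> E" if "t \<in> ?Q k" "t' \<in> ?Q k" "t < t'" "ctx t = ctx t'" for t t'
      using that backward[of t t'] by auto
  qed (use ctx sa act_less in auto)
  also have "\<dots> = (floor_log K + 1) * beta K E M" by simp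
  finally show ?thesis .
qed

text \<open>The rounds that can cost regret: in all others the only active action is played.\<close>

definition exploring :: "nat set" where
  "exploring = {t. t < T \<and> (pending (R t) \<noteq> {} \<or> act t \<noteq> bare K (R t))}"

lemma card_exploring: "card {t\<in>exploring. lay t = l} \<le> (floor_log K + 3) * beta K E M"
proof -
  let ?A = "{t. t < T \<and> pending (R t) \<noteq> {} \<and> lay t = l}"
  let ?B = "{t. t < T \<and> pending (R t) = {} \<and> act t \<noteq> bare K (R t) \<and> lay t = l}"
  have "{t\<in>exploring. lay t = l} = ?A \<union> ?B" unfolding exploring_def by blast
  then have "card {t\<in>exploring. lay t = l} = card (?A \<union> ?B)" by (rule arg_cong)
  also have "\<dots> \<le> card ?A + card ?B" by (rule card_Un_le)
  also have "\<dots> \<le> (floor_log K + 1) * beta K E M + 2 * beta K E M"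
    \<comment> \<open>The two rounds for vertices without self-loop are absorbed by
      \<open>1 \<le> beta K E M\<close>.\<close>
    using card_pending[of l] card_bare[of l] beta_pos[OF K M, of E] by linarith
  finally show ?thesis by (simp add: algebra_simps)
qed

lemma not_exploring: "t < T \<Longrightarrow> t \<notin> exploring \<Longrightarrow> act t = opt (ctx t)"
  using act_opt by (auto simp: exploring_def)

text \<open>One observation is chosen from each lower layer; the rounds are distinct because their
  layers are.\<close>

lemma obs_count_ge:
  assumes "\<And>l'. l' < l \<Longrightarrow> a \<in> covered (S t) l'"
  shows "l \<le> obs_count E act t a"
proof -
  have "\<forall>l'<l. \<exists>u<t. lay u = l' \<and> (act u, a) \<in> E" using assms by (auto simp: covered_S)
  then obtain f where f: "\<And>l'. l' < l \<Longrightarrow> f l' < t \<and> lay (f l') = l' \<and> (act (f l'), a) \<in> E" by metis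
  then have "inj_on f {..<l}" by (metis inj_onI lessThan_iff)
  then have "l = card (f ` {..<l})" by (simp add: card_image)
  also have "\<dots> \<le> card {u. u < t \<and> (act u, a) \<in> E}" by (rule card_mono) (use f in auto)
  also have "\<dots> = obs_count E act t a"
    by (simp add: obs_count_def Int_def)
  finally show ?thesis .
qed

text \<open>Only the start of an epoch has to be examined, where every active action has been
  observed once in each lower layer; during an epoch context, active set and layer do not change.
  The statistics enter through the assumption \<open>gap\<close> alone.\<close>

lemma gap_active:
  assumes gap: "\<And>t a l. t < T \<Longrightarrow> a \<in> Z t \<Longrightarrow> a < K \<Longrightarrow> l \<le> obs_count E act t a \<Longrightarrow>
      l \<le> obs_count E act t (opt (ctx t)) \<Longrightarrow> gap (ctx t) a \<le> g l"
    and "t < T" "a \<in> active (R t)"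
  shows "gap (ctx t) a \<le> (g (lay t) :: real)"
  using assms(2,3)
proof (induction t)
  case 0
  then show ?case using gap[of 0 a 0] wf_R[of 0] lay_le[of 0]
    by (cases rule: ready_cases[OF 0(1)]) (auto simp: wf_sim_def)
next
  case (Suc t)
  show ?case
  proof (cases rule: ready_cases[OF Suc.prems(1)])
    case 1
    then show ?thesis using Suc not_fresh_ctx[OF 1(1)] by (simp add: S_Suc del: simulate.simps)
  next
    case 2
    have "\<forall>l<lay (Suc t). active (R (Suc t)) \<subseteq> covered (S (Suc t)) l"
      using wf_R[of "Suc t"] Suc.prems by (simp add: wf_sim_def covered_R del: simulate.simps)
    then have "lay (Suc t) \<le> obs_count E act (Suc t) b" if "b \<in> active (R (Suc t))" for b
      using that by (intro obs_count_ge) blast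
    moreover have "a \<in> Z (Suc t)" "a < K" "opt (ctx (Suc t)) \<in> active (R (Suc t))"
      using 2(2) Suc.prems opt_active[of "Suc t"] wf_R[of "Suc t"] by (auto simp: wf_sim_def)
    ultimately show ?thesis
      using Suc.prems by (intro gap) auto
  qed
qed

end

section \<open>Concentration under adaptive sampling\<close>

text \<open>Integrate over the last coordinate first: whether round \<open>n\<close> is counted
  depends only on earlier coordinates, so the inner integral contributes a factor of at most
  \<open>1\<close> in either case. The predicates \<open>xi s\<close>, determined by the coordinates
  below \<open>s\<close>, take the place of a filtration.\<close>

lemma adaptive_exp_le_1:
  fixes D :: "nat \<Rightarrow> 'b measure" and X :: "nat \<Rightarrow> 'b \<Rightarrow> real" and xi :: "nat \<Rightarrow> (nat \<Rightarrow> 'b) \<Rightarrow> bool"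
  assumes prob: "\<And>t. prob_space (D t)"
    and X [measurable]: "\<And>t. X t \<in> borel_measurable (D t)"
    and mgf: "\<And>t. (\<integral>\<^sup>+y. ennreal (exp (l * X t y - l\<^sup>2 / 8)) \<partial>D t) \<le> 1"
    and pred: "\<And>s x y. (\<And>u. u < s \<Longrightarrow> x u = y u) \<Longrightarrow> xi s x = xi s y"
    and meas: "\<And>s n. s \<le> n \<Longrightarrow> Measurable.pred (PiM {..<n} D) (xi s)"
  shows "(\<integral>\<^sup>+x. ennreal (exp (\<Sum>s<n. if xi s x then l * X s (x s) - l\<^sup>2 / 8 else 0)) \<partial>PiM {..<n} D) \<le> 1"
proof (induction n)
  case 0
  interpret P: prob_space "PiM {} D" by (rule prob_space_PiM) (use prob in auto)
  show ?case using P.emeasure_space_1 by simp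
next
  case (Suc n)
  interpret product_sigma_finite D
    by (rule product_sigma_finite.intro) (rule prob_space_imp_sigma_finite[OF prob])
  let ?w = "\<lambda>s x. if xi s x then l * X s (x s) - l\<^sup>2 / 8 else 0"
  have xi_m [measurable]: "Measurable.pred (PiM {..<n'} D) (xi s)" if "s < n'" for s n'
    using meas[of s n'] that by simp
  have m: "(\<lambda>x. ennreal (exp (\<Sum>s<n'. ?w s x))) \<in> borel_measurable (PiM {..<n'} D)" for n'
    by measurable
  have cut: "xi s (x(n := y)) = xi s x" if "s \<le> n" for s x y
    by (rule pred) (use that in auto)
  have "(\<integral>\<^sup>+x. ennreal (exp (\<Sum>s<Suc n. ?w s x)) \<partial>PiM {..<Suc n} D) =
    (\<integral>\<^sup>+x. (\<integral>\<^sup>+y. ennreal (exp (\<Sum>s<Suc n. ?w s (x(n := y)))) \<partial>D n) \<partial>PiM {..<n} D)"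
    unfolding lessThan_Suc
    by (rule product_nn_integral_insert) (use m[of "Suc n"] in \<open>auto simp: lessThan_Suc\<close>)
  also have "\<dots> \<le> (\<integral>\<^sup>+x. ennreal (exp (\<Sum>s<n. ?w s x)) \<partial>PiM {..<n} D)"
  proof (rule nn_integral_mono)
    fix x
    have eq: "(\<Sum>s<Suc n. ?w s (x(n := y))) =
        (\<Sum>s<n. ?w s x) + (if xi n x then l * X n y - l\<^sup>2 / 8 else 0)" for y
      by (auto simp: cut intro!: sum.cong)
    have "(\<integral>\<^sup>+y. ennreal (exp (\<Sum>s<Suc n. ?w s (x(n := y)))) \<partial>D n) =
        (\<integral>\<^sup>+y. ennreal (exp (\<Sum>s<n. ?w s x)) *
           ennreal (exp (if xi n x then l * X n y - l\<^sup>2 / 8 else 0)) \<partial>D n)"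
      unfolding eq exp_add by (simp add: ennreal_mult)
    also have "\<dots> = ennreal (exp (\<Sum>s<n. ?w s x)) *
        (\<integral>\<^sup>+y. ennreal (exp (if xi n x then l * X n y - l\<^sup>2 / 8 else 0)) \<partial>D n)"
      by (rule nn_integral_cmult) measurable
    also have "\<dots> \<le> ennreal (exp (\<Sum>s<n. ?w s x)) * 1"
    proof (rule mult_left_mono)
      show "(\<integral>\<^sup>+y. ennreal (exp (if xi n x then l * X n y - l\<^sup>2 / 8 else 0)) \<partial>D n) \<le> 1"
        using mgf[of n] prob_space.emeasure_space_1[OF prob[of n]] by (cases "xi n x") simp_all
    qed simp
    finally show "(\<integral>\<^sup>+y. ennreal (exp (\<Sum>s<Suc n. ?w s (x(n := y)))) \<partial>D n) \<le>
        ennreal (exp (\<Sum>s<n. ?w s x))"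
      by simp
  qed
  also have "\<dots> \<le> 1" by (rule Suc.IH)
  finally show ?case .
qed

lemma adaptive_tail_sets:
  fixes D :: "nat \<Rightarrow> 'b measure" and X :: "nat \<Rightarrow> 'b \<Rightarrow> real" and xi :: "nat \<Rightarrow> (nat \<Rightarrow> 'b) \<Rightarrow> bool"
  assumes X [measurable]: "\<And>t. X t \<in> borel_measurable (D t)"
    and meas: "\<And>s n. s \<le> n \<Longrightarrow> Measurable.pred (PiM {..<n} D) (xi s)"
  shows "{x\<in>space (PiM {..<N} D).
      sqrt (real (\<Sum>s<N. of_bool (xi s x)) * L) < (\<Sum>s<N. if xi s x then X s (x s) else 0)}
    \<in> sets (PiM {..<N} D)"
proof -
  have [measurable]: "Measurable.pred (PiM {..<N} D) (xi s)" if "s < N" for s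
    using meas[of s N] that by simp
  have [measurable]: "(\<lambda>x. \<Sum>s<N. of_bool (xi s x) :: nat) \<in> measurable (PiM {..<N} D) (count_space UNIV)"
    by measurable
  show ?thesis by measurable
qed

text \<open>The best exponent depends on the number of observations, which is random. On the event
  that this number is \<open>m\<close> the exponent can be tuned to \<open>m\<close>, and the union
  over \<open>m\<close> costs the factor \<open>N\<close>.\<close>

lemma adaptive_tail:
  fixes D :: "nat \<Rightarrow> 'b measure" and X :: "nat \<Rightarrow> 'b \<Rightarrow> real" and xi :: "nat \<Rightarrow> (nat \<Rightarrow> 'b) \<Rightarrow> bool"
  assumes prob: "\<And>t. prob_space (D t)"
    and X [measurable]: "\<And>t. X t \<in> borel_measurable (D t)"
    and mgf: "\<And>t l. 0 < l \<Longrightarrow> (\<integral>\<^sup>+y. ennreal (exp (l * X t y)) \<partial>D t) \<le> ennreal (exp (l\<^sup>2 / 8))"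
    and pred: "\<And>s x y. (\<And>u. u < s \<Longrightarrow> x u = y u) \<Longrightarrow> xi s x = xi s y"
    and meas: "\<And>s n. s \<le> n \<Longrightarrow> Measurable.pred (PiM {..<n} D) (xi s)"
    and L: "0 < L"
  shows "measure (PiM {..<N} D) {x\<in>space (PiM {..<N} D).
      sqrt (real (\<Sum>s<N. of_bool (xi s x)) * L) < (\<Sum>s<N. if xi s x then X s (x s) else 0)}
    \<le> N * exp (- 2 * L)"
proof -
  let ?P = "PiM {..<N} D"
  interpret P: prob_space ?P by (rule prob_space_PiM) (use prob in auto)
  let ?c = "\<lambda>x. \<Sum>s<N. of_bool (xi s x) :: nat"
  let ?S = "\<lambda>x. \<Sum>s<N. if xi s x then X s (x s) else 0"
  have xi_m [measurable]: "Measurable.pred ?P (xi s)" if "s < N" for s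
    using meas[of s N] that by simp
  have Sm [measurable]: "?S \<in> borel_measurable ?P" by measurable
  let ?A = "\<lambda>m. {x\<in>space ?P. ?c x = m \<and> sqrt (real m * L) < ?S x}"
  have cm [measurable]: "?c \<in> measurable ?P (count_space UNIV)" by measurable
  have Am: "?A m \<in> sets ?P" for m by measurable
  have one: "measure ?P (?A m) \<le> exp (- 2 * L)" if "0 < m" for m
  proof -
    \<comment> \<open>Maximises \<open>l * sqrt (m * L) - l\<^sup>2 * m / 8\<close>; the maximum is
      \<open>2 * L\<close>.\<close>
    define l where "l = 4 * sqrt (L / m)"
    have l: "0 < l" using L that by (simp add: l_def)
    let ?u = "\<lambda>x. ennreal (exp (\<Sum>s<N. if xi s x then l * X s (x s) - l\<^sup>2 / 8 else 0))"
    have um [measurable]: "?u \<in> borel_measurable ?P" by measurable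
    have int: "(\<integral>\<^sup>+x. ?u x \<partial>?P) \<le> 1"
    proof (rule adaptive_exp_le_1[OF prob X _ pred meas])
      fix t
      have "(\<integral>\<^sup>+y. ennreal (exp (l * X t y - l\<^sup>2 / 8)) \<partial>D t) =
          (\<integral>\<^sup>+y. ennreal (exp (- l\<^sup>2 / 8)) * ennreal (exp (l * X t y)) \<partial>D t)"
        by (simp flip: ennreal_mult exp_add)
      also have "\<dots> = ennreal (exp (- l\<^sup>2 / 8)) * (\<integral>\<^sup>+y. ennreal (exp (l * X t y)) \<partial>D t)"
        by (rule nn_integral_cmult) measurable
      also have "\<dots> \<le> ennreal (exp (- l\<^sup>2 / 8)) * ennreal (exp (l\<^sup>2 / 8))"
        by (rule mult_left_mono[OF mgf[OF l]]) simp
      also have "\<dots> = 1" by (simp flip: ennreal_mult exp_add)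
      finally show "(\<integral>\<^sup>+y. ennreal (exp (l * X t y - l\<^sup>2 / 8)) \<partial>D t) \<le> 1" .
    qed auto
    have "?A m \<subseteq> {x\<in>space ?P. 1 \<le> ennreal (exp (- 2 * L)) * ?u x}"
    proof
      fix x assume "x \<in> ?A m"
      then have x: "x \<in> space ?P" "?c x = m" "sqrt (real m * L) < ?S x" by blast+
      have e: "(\<Sum>s<N. if xi s x then l * X s (x s) - l\<^sup>2 / 8 else 0) = l * ?S x - l\<^sup>2 / 8 * real (?c x)"
      proof -
        have "(\<Sum>s<N. if xi s x then l * X s (x s) - l\<^sup>2 / 8 else 0) =
            (\<Sum>s<N. l * (if xi s x then X s (x s) else 0) - l\<^sup>2 / 8 * real (of_bool (xi s x)))"
          by (intro sum.cong) auto
        also have "\<dots> = l * ?S x - l\<^sup>2 / 8 * real (?c x)"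
          unfolding of_nat_sum sum_distrib_left sum_subtractf ..
        finally show ?thesis .
      qed
      have "l\<^sup>2 / 8 * real m = 2 * L" using that L by (simp add: l_def power_mult_distrib)
      moreover have "l * sqrt (real m * L) = 4 * L"
        using that L by (simp add: l_def flip: real_sqrt_mult)
      moreover have "l * sqrt (real m * L) \<le> l * ?S x"
        by (rule mult_left_mono) (use x l in auto)
      ultimately have "0 \<le> - 2 * L + (l * ?S x - l\<^sup>2 / 8 * real m)" by linarith
      then have "1 \<le> exp (- 2 * L + (l * ?S x - l\<^sup>2 / 8 * real m))"
        by (simp only: one_le_exp_iff)
      then have "1 \<le> ennreal (exp (- 2 * L)) * ?u x"
        unfolding e x(2) by (simp flip: ennreal_mult exp_add)
      with x(1) show "x \<in> {x\<in>space ?P. 1 \<le> ennreal (exp (- 2 * L)) * ?u x}" by blast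
    qed
    then have "emeasure ?P (?A m) \<le> emeasure ?P {x\<in>space ?P. 1 \<le> ennreal (exp (- 2 * L)) * ?u x}"
      by (rule emeasure_mono) measurable
    also have "\<dots> \<le> ennreal (exp (- 2 * L)) * (\<integral>\<^sup>+x. ?u x * indicator (space ?P) x \<partial>?P)"
      using nn_integral_Markov_inequality[of ?u "space ?P" ?P "ennreal (exp (- 2 * L))"]
      by (simp add: Int_def conj_commute)
    also have "\<dots> = ennreal (exp (- 2 * L)) * (\<integral>\<^sup>+x. ?u x \<partial>?P)"
      by (simp add: nn_integral_set_ennreal[symmetric] cong: nn_integral_cong)
    also have "\<dots> \<le> ennreal (exp (- 2 * L)) * 1" by (rule mult_left_mono[OF int]) simp
    finally show ?thesis by (simp add: P.emeasure_eq_measure)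
  qed
  have cN: "?c x \<le> N" for x
    using sum_mono[of "{..<N}" "\<lambda>s. of_bool (xi s x)" "\<lambda>_. 1::nat"] by simp
  have "{x\<in>space ?P. sqrt (real (?c x) * L) < ?S x} \<subseteq> (\<Union>m\<in>{1..N}. ?A m)"
  proof safe
    fix x assume x: "x \<in> space ?P" "sqrt (real (?c x) * L) < ?S x"
    \<comment> \<open>Without observations both sides vanish, so the strict inequality excludes
      \<open>m = 0\<close>, to which no exponent can be tuned.\<close>
    have "?c x \<noteq> 0"
    proof
      assume "?c x = 0"
      then have "\<And>s. s < N \<Longrightarrow> \<not> xi s x" by auto
      then have "?S x = 0" by (intro sum.neutral) auto
      with x \<open>?c x = 0\<close> show False by simp
    qed
    then have "1 \<le> ?c x" by (simp only: One_nat_def Suc_le_eq neq0_conv)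
    with cN[of x] have "?c x \<in> {1..N}" by (simp only: atLeastAtMost_iff)
    with x show "x \<in> (\<Union>m\<in>{1..N}. ?A m)" by (intro UN_I[of "?c x"]) blast+
  qed
  then have "measure ?P {x\<in>space ?P. sqrt (real (?c x) * L) < ?S x} \<le> measure ?P (\<Union>m\<in>{1..N}. ?A m)"
    by (rule P.finite_measure_mono) (use Am in auto)
  also have "\<dots> \<le> (\<Sum>m\<in>{1..N}. measure ?P (?A m))"
    by (rule P.finite_measure_subadditive_finite) (use Am in auto)
  also have "\<dots> \<le> (\<Sum>m\<in>{1..N}. exp (- 2 * L))"
    by (rule sum_mono) (use one in auto)
  finally show ?thesis by simp
qed

section \<open>Deviations of the means, elimination and true gaps\<close>

lemma bounded_mgf:
  fixes f :: "'a \<Rightarrow> real"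
  assumes "prob_space M" "f \<in> borel_measurable M" "AE x in M. f x \<in> {a..a + 1}"
    "prob_space.expectation M f = 0" "0 < l"
  shows "(\<integral>\<^sup>+x. ennreal (exp (l * f x)) \<partial>M) \<le> ennreal (exp (l\<^sup>2 / 8))"
proof -
  interpret prob_space M by fact
  interpret interval_bounded_random_variable M f a "a + 1"
    by standard (use assms in auto)
  show ?thesis using Hoeffdings_lemma_nn_integral_0[of l] assms by simp
qed

lemma mean_deviation:
  fixes m :: real
  assumes "0 < m" "\<bar>s - \<mu> * m\<bar> \<le> sqrt (m * L)"
  shows "\<bar>s / m - \<mu>\<bar> \<le> sqrt (L / m)"
proof -
  have "s / m - \<mu> = (s - \<mu> * m) / m" using assms by (simp add: diff_divide_distrib)
  then have "\<bar>s / m - \<mu>\<bar> = \<bar>s - \<mu> * m\<bar> / m" using assms by (simp add: abs_divide)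
  also have "\<dots> \<le> sqrt (m * L) / m" using assms by (simp add: divide_right_mono)
  also have "\<dots> = sqrt (m * L / m\<^sup>2)" using assms by (simp add: real_sqrt_divide)
  also have "m * L / m\<^sup>2 = L / m" using assms by (simp add: power2_eq_square)
  finally show ?thesis .
qed

text \<open>A margin that beats \<open>z\<close> exceeds twice each of the two deviations, so part
  of it would persist in the true means.\<close>

lemma survivors_opt:
  assumes L: "0 \<le> L" and K: "z < K" "\<And>a. a < K \<Longrightarrow> \<mu> a \<le> \<mu> z"
    and S: "\<And>a. a < K \<Longrightarrow> \<bar>S a - \<mu> a * real (n a)\<bar> \<le> sqrt (real (n a) * L)"
  shows "z \<in> survivors (4 * L) K n S"
proof -
  have dev: "\<bar>S a / n a - \<mu> a\<bar> \<le> sqrt (L / n a)" if "a < K" "0 < n a" for a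
    using mean_deviation[OF _ S[OF that(1)]] that by simp
  have "\<not> beaten (4 * L) K n S z b" if b: "b < K" for b
  proof
    assume bt: "beaten (4 * L) K n S z b"
    define d where "d = S b / n b - S z / n z"
    from bt have d: "0 < d" "4 * L < d * d * n z" "4 * L < d * d * n b"
      by (simp_all add: beaten_def d_def Let_def)
    have half: "sqrt (L / m) < d / 2" if "4 * L < d * d * m" "0 < m" for m :: real
    proof -
      have "L / m < (d / 2)\<^sup>2" using that by (simp add: field_simps power2_eq_square)
      then show ?thesis using d(1) by (metis abs_of_pos half_gt_zero real_sqrt_abs real_sqrt_less_mono)
    qed
    \<comment> \<open>With a count of \<open>0\<close> the strict inequalities would contradict
      \<open>0 \<le> L\<close>.\<close>
    have n: "0 < n z" "0 < n b" using d L by (auto intro: gr0I)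
    have "d \<le> (\<mu> b + sqrt (L / n b)) - (\<mu> z - sqrt (L / n z))"
      unfolding d_def using dev[OF b n(2)] dev[OF K(1) n(1)] by linarith
    also have "\<dots> < \<mu> b - \<mu> z + d" using half[OF d(2)] half[OF d(3)] n by simp
    finally show False using K(2)[OF b] by simp
  qed
  with K show ?thesis by (simp add: survivors_def)
qed

text \<open>A true gap above \<open>4 * sqrt (L / l)\<close> loses at most
  \<open>2 * sqrt (L / l)\<close> to the two deviations. More than \<open>2 * sqrt (L / l)\<close>
  remains empirically, enough for \<open>z\<close> to beat \<open>a\<close>.\<close>

lemma survivors_gap:
  assumes L: "0 \<le> L" and K: "z < K"
    and S: "\<And>a. a < K \<Longrightarrow> \<bar>S a - \<mu> a * real (n a)\<bar> \<le> sqrt (real (n a) * L)"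
    and a: "a \<in> survivors (4 * L) K n S" and l: "0 < l" "l \<le> n a" "l \<le> n z"
  shows "\<mu> z - \<mu> a \<le> 4 * sqrt (L / l)"
proof (rule ccontr)
  assume "\<not> ?thesis"
  then have gap: "4 * sqrt (L / l) < \<mu> z - \<mu> a" by simp
  have aK: "a < K" using a by (simp add: survivors_def)
  have dev: "\<bar>S a / n a - \<mu> a\<bar> \<le> sqrt (L / l)" if "a < K" "l \<le> n a" for a
  proof -
    have "\<bar>S a / n a - \<mu> a\<bar> \<le> sqrt (L / n a)"
      using mean_deviation[OF _ S[OF that(1)]] that l by simp
    also have "\<dots> \<le> sqrt (L / l)" using that l L by (simp add: frac_le)
    finally show ?thesis .
  qed
  define d where "d = S z / n z - S a / n a"
  have d: "2 * sqrt (L / l) < d"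
    unfolding d_def using dev[OF aK l(2)] dev[OF K l(3)] gap by linarith
  have "0 \<le> sqrt (L / l)" using L by simp
  with d have "0 < d" by linarith
  have "(2 * sqrt (L / l))\<^sup>2 < d\<^sup>2" by (rule power_strict_mono) (use d L in auto)
  then have "4 * L < d * d * l" using L l by (simp add: power_mult_distrib power2_eq_square field_simps)
  then have big: "4 * L < d * d * real m" if "l \<le> m" for m
    using mult_left_mono[of "real l" "real m" "d * d"] that by simp
  have "beaten (4 * L) K n S a z"
    using \<open>0 < d\<close> big[OF l(2)] big[OF l(3)] by (simp add: beaten_def Let_def d_def)
  with a K show False by (simp add: survivors_def)
qed

section \<open>Summation over the layers\<close>

lemma sum_inverse_sqrt_le: "(\<Sum>l<n. 1 / sqrt (real l + 1)) \<le> 2 * sqrt (real n)"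
proof (induction n)
  case (Suc n)
  let ?x = "sqrt (real n)" and ?y = "sqrt (real n + 1)"
  have y: "0 < ?y" "?x \<le> ?y" "?y * ?y = ?x * ?x + 1" "0 \<le> ?x" by auto
  have "1 = (?y - ?x) * (?y + ?x)" using y by (simp add: algebra_simps)
  also have "\<dots> \<le> (?y - ?x) * (2 * ?y)" by (rule mult_left_mono) (use y in auto)
  finally have "1 / ?y \<le> 2 * (?y - ?x)" using y by (simp add: field_simps)
  with Suc show ?case by (simp add: add.commute)
qed simp

text \<open>
  The threshold \<open>T / B\<close> balances the layers below it, of which each contains at most \<open>B\<close> rounds,
  against the rounds in the layers above it.
\<close>

lemma sum_layers_le:
  fixes lay :: "nat \<Rightarrow> nat"
  assumes Q: "Q \<subseteq> {..<T}" and B: "\<And>l. card {t\<in>Q. lay t = l} \<le> B" "0 < B" and T: "0 < T"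
  shows "(\<Sum>t\<in>Q. 1 / sqrt (real (lay t) + 1)) \<le> 3 * sqrt (real B * real T)"
proof -
  define y where "y = real T / real B"
  have y: "0 < y" using B T by (simp add: y_def)
  define m where "m = nat \<lfloor>y\<rfloor>"
  have m: "real m \<le> y" "y < real m + 1" using y by (auto simp: m_def)
  have fin: "finite Q" using Q finite_subset by blast
  let ?f = "\<lambda>t. 1 / sqrt (real (lay t) + 1)"
  let ?Q1 = "{t\<in>Q. lay t < m}" and ?Q2 = "{t\<in>Q. \<not> lay t < m}"
  have "(\<Sum>t\<in>?Q1. ?f t) = (\<Sum>l<m. \<Sum>t\<in>{t\<in>?Q1. lay t = l}. ?f t)"
    by (rule sum.group[symmetric]) (use fin in auto)
  also have "\<dots> \<le> (\<Sum>l<m. real B * (1 / sqrt (real l + 1)))"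
  proof (rule sum_mono)
    fix l
    have "card {t\<in>?Q1. lay t = l} \<le> card {t\<in>Q. lay t = l}" by (rule card_mono) (use fin in auto)
    also have "\<dots> \<le> B" by (rule B)
    finally have "real (card {t\<in>?Q1. lay t = l}) * (1 / sqrt (real l + 1)) \<le> real B * (1 / sqrt (real l + 1))"
      by (intro mult_right_mono) auto
    then show "(\<Sum>t\<in>{t\<in>?Q1. lay t = l}. ?f t) \<le> real B * (1 / sqrt (real l + 1))" by simp
  qed
  also have "\<dots> \<le> real B * (2 * sqrt (real m))"
    unfolding sum_distrib_left[symmetric] by (intro mult_left_mono sum_inverse_sqrt_le) simp
  also have "\<dots> \<le> real B * (2 * sqrt y)" using m by (intro mult_left_mono) auto
  also have "real B * (2 * sqrt y) = 2 * sqrt (real B * real T)"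
    using B by (simp add: y_def real_sqrt_divide real_sqrt_mult field_simps)
  finally have 1: "(\<Sum>t\<in>?Q1. ?f t) \<le> 2 * sqrt (real B * real T)" .
  have "(\<Sum>t\<in>?Q2. ?f t) \<le> (\<Sum>t\<in>?Q2. 1 / sqrt y)"
  proof (rule sum_mono)
    fix t assume "t \<in> ?Q2"
    then have "y \<le> real (lay t) + 1" using m by auto
    then show "?f t \<le> 1 / sqrt y" using y by (intro divide_left_mono) auto
  qed
  also have "\<dots> = real (card ?Q2) * (1 / sqrt y)" by simp
  also have "\<dots> \<le> real T * (1 / sqrt y)"
  proof (rule mult_right_mono)
    show "real (card ?Q2) \<le> real T" using card_mono[of "{..<T}" ?Q2] Q by auto
  qed (use y in auto)
  also have "\<dots> = sqrt (real B * real T)"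
    using B T by (simp add: y_def real_sqrt_divide real_sqrt_mult field_simps)
  finally have 2: "(\<Sum>t\<in>?Q2. ?f t) \<le> sqrt (real B * real T)" .
  have "(\<Sum>t\<in>Q. ?f t) = (\<Sum>t\<in>?Q1. ?f t) + (\<Sum>t\<in>?Q2. ?f t)"
    by (subst sum.union_disjoint[symmetric]) (use fin in \<open>auto intro!: sum.cong\<close>)
  with 1 2 show ?thesis by simp
qed

section \<open>The regret bound\<close>

lemma history_nth:
  "u < length as \<Longrightarrow> history_of M E cs r as ! u = (cs ! u, as ! u, observe M E (as ! u) (r u))"
  by (simp add: history_of_def)

lemma length_history [simp]: "length (history_of M E cs r as) = length as"
  by (simp add: history_of_def)

lemma obs_count_cong: "(\<And>u. u < t \<Longrightarrow> act u = act' u) \<Longrightarrow> obs_count E act t = obs_count E act' t"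
  by (rule ext) (simp add: obs_count_def)

text \<open>\<open>passes\<close> in terms of actions and rewards. Masked entries are
  \<open>0\<close>, so the sum over all rounds equals the sum over the observations that
  \<open>obs_count\<close> counts.\<close>

definition kept :: "real \<Rightarrow> nat \<Rightarrow> nat \<Rightarrow> (nat \<times> nat) set \<Rightarrow> (nat \<Rightarrow> nat) \<Rightarrow> (nat \<Rightarrow> rewards) \<Rightarrow> (nat \<Rightarrow> nat) \<Rightarrow> nat \<Rightarrow> nat set" where
  "kept L K M E ctx r act t = survivors (4 * L) K (obs_count E act t)
     (\<lambda>a. \<Sum>u<t. observe M E (act u) (r u) (ctx t, a))"

lemma decide_history:
  "decide K M T E (history_of M E cs r as) c =
     (let ctx = (\<lambda>t. if t < length as then cs ! t else c)
      in next_action K E (ready K E (kept (conf K M T) K M E ctx r (\<lambda>u. as ! u)) ctx (\<lambda>u. as ! u) (length as)))"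
proof -
  let ?h = "history_of M E cs r as" and ?ctx = "\<lambda>t. if t < length as then cs ! t else c"
  have ctx: "ctx_of ?h c = ?ctx" by (auto simp: ctx_of_def history_nth)
  have "passes (conf K M T) K E ?h ?ctx u = kept (conf K M T) K M E ?ctx r (\<lambda>u. as ! u) u"
    if "u \<le> length as" for u
  proof -
    have "obs_count E (\<lambda>u. fst (snd (?h ! u))) u = obs_count E (\<lambda>u. as ! u) u"
      by (rule obs_count_cong) (use that in \<open>simp add: history_nth\<close>)
    moreover have "(\<Sum>v<u. snd (snd (?h ! v)) (d, a)) = (\<Sum>v<u. observe M E (as ! v) (r v) (d, a))" for a d
      by (rule sum.cong) (use that in \<open>auto simp: history_nth\<close>)
    ultimately show ?thesis by (simp only: passes_def kept_def)
  qed
  then have "ready K E (passes (conf K M T) K E ?h ?ctx) ?ctx (\<lambda>u. fst (snd (?h ! u))) (length as) =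
      ready K E (kept (conf K M T) K M E ?ctx r (\<lambda>u. as ! u)) ?ctx (\<lambda>u. as ! u) (length as)"
    by (intro ready_cong) (auto simp: history_nth)
  then show ?thesis by (simp add: decide_def ctx Let_def)
qed

section \<open>Measurability of the decisions\<close>

declare [[simproc del: measurable]]

lemma pred_finite_all:
  assumes "finite I" "\<And>i. i \<in> I \<Longrightarrow> Measurable.pred N (Q i)"
  shows "Measurable.pred N (\<lambda>r. \<forall>i\<in>I. Q i r)"
  using assms by (intro pred_intros_finite(3))

lemma measurable_kept:
  assumes meas: "\<And>u c b. u < t \<Longrightarrow> c < M \<Longrightarrow> b < K \<Longrightarrow> (\<lambda>r. r u (c, b)) \<in> borel_measurable N"
    and a: "a < K"
  shows "Measurable.pred N (\<lambda>r. a \<in> kept L K M E ctx r act t)"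
proof -
  define f where "f b r = (\<Sum>u<t. observe M E (act u) (r u) (ctx t, b))" for b and r :: "nat \<Rightarrow> rewards"
  have obs: "(\<lambda>r. observe M E (act u) (r u) (c, b)) \<in> borel_measurable N" if "u < t" "b < K" for u c b
    by (cases "c < M \<and> (act u, b) \<in> E") (use meas[OF that(1) _ that(2)] in \<open>auto simp: observe_def borel_measurable_const\<close>)
  have f: "f b \<in> borel_measurable N" if "b < K" for b
    unfolding f_def by (rule borel_measurable_sum) (use obs that in auto)
  have nb: "Measurable.pred N (\<lambda>r. \<not> beaten (4 * L) K (obs_count E act t) (\<lambda>a. f a r) a b)" if "b < K" for b
  proof -
    note [measurable] = f[OF a] f[OF that]
    show ?thesis unfolding beaten_def Let_def by measurable
  qed
  have "Measurable.pred N (\<lambda>r. \<forall>b\<in>{..<K}. \<not> beaten (4 * L) K (obs_count E act t) (\<lambda>a. f a r) a b)"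
    by (rule pred_finite_all[where Q = "\<lambda>b r. \<not> beaten (4 * L) K (obs_count E act t) (\<lambda>a. f a r) a b"])
       (simp_all add: nb)
  moreover have "(\<lambda>r. a \<in> kept L K M E ctx r act t) =
      (\<lambda>r. \<forall>b\<in>{..<K}. \<not> beaten (4 * L) K (obs_count E act t) (\<lambda>a. f a r) a b)"
    using a by (simp add: kept_def survivors_def f_def Ball_def)
  ultimately show ?thesis by simp
qed

text \<open>
  The decision depends on the rewards only through the finitely many elimination tests.
\<close>

lemma measurable_decide:
  assumes meas: "\<And>u c b. u < length as \<Longrightarrow> c < M \<Longrightarrow> b < K \<Longrightarrow> (\<lambda>r. r u (c, b)) \<in> borel_measurable N"
  shows "(\<lambda>r. decide K M T E (history_of M E cs r as) c) \<in> measurable N (count_space UNIV)"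
proof -
  define ctx where "ctx t = (if t < length as then cs ! t else c)" for t
  let ?Y = "\<lambda>r. kept (conf K M T) K M E ctx r (\<lambda>u. as ! u)"
  \<comment> \<open>The tests that can be consulted: rounds up to the current one, times actions.
    Their outcomes form the finite set \<open>z r\<close>, and \<open>ready\<close> looks at no
    later round, so the decision is a function \<open>F\<close> of it.\<close>
  define Gr where "Gr = {..length as} \<times> {..<K}"
  define z where "z r = {p\<in>Gr. snd p \<in> ?Y r (fst p)}" for r
  define F where "F z = next_action K E (ready K E (\<lambda>t. {a. (t, a) \<in> z}) ctx (\<lambda>u. as ! u) (length as))" for z
  have fin: "finite (Pow Gr)" by (simp add: Gr_def)
  have "?Y r t = {a. (t, a) \<in> z r}" if "t \<le> length as" for r t
    using that by (auto simp: z_def Gr_def kept_def survivors_def)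
  then have eq: "decide K M T E (history_of M E cs r as) c = F (z r)" for r
    unfolding decide_history Let_def F_def ctx_def[symmetric]
    by (intro arg_cong[of _ _ "next_action K E"] ready_cong) auto
  have "finite Gr" by (simp add: Gr_def)
  have test: "Measurable.pred N (\<lambda>r. snd p \<in> ?Y r (fst p))" if "p \<in> Gr" for p
  proof (rule measurable_kept)
    show "(\<lambda>r. r u (c, b)) \<in> borel_measurable N" if "u < fst p" "c < M" "b < K" for u c b
      by (rule meas) (use that \<open>p \<in> Gr\<close> in \<open>auto simp: Gr_def\<close>)
    show "snd p < K" using that by (auto simp: Gr_def)
  qed
  have "Measurable.pred N (\<lambda>r. (snd p \<in> ?Y r (fst p)) = (p \<in> X))" if "p \<in> Gr" for p X
  proof (cases "p \<in> X")
    case True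
    then show ?thesis using test[OF that] by simp
  next
    case False
    then show ?thesis using pred_intros_logic(2)[OF test[OF that]] by simp
  qed
  then have all: "Measurable.pred N (\<lambda>r. \<forall>p\<in>Gr. (snd p \<in> ?Y r (fst p)) = (p \<in> X))" for X
    by (intro pred_finite_all[OF \<open>finite Gr\<close>, where Q = "\<lambda>p r. (snd p \<in> ?Y r (fst p)) = (p \<in> X)"])
  have sets: "z -` {X} \<inter> space N \<in> sets N" if "X \<subseteq> Gr" for X
  proof -
    have "(\<forall>p\<in>Gr. (snd p \<in> ?Y r (fst p)) = (p \<in> X)) \<longleftrightarrow> z r = X" for r
      using that unfolding z_def by blast
    then have "{r\<in>space N. z r = X} \<in> sets N" using all[of X] by (simp only: pred_def)
    moreover have "z -` {X} \<inter> space N = {r\<in>space N. z r = X}" by blast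
    ultimately show ?thesis by (simp only:)
  qed
  have "z \<in> space N \<rightarrow> Pow Gr" by (auto simp: z_def)
  with sets have "z \<in> measurable N (count_space (Pow Gr))"
    unfolding measurable_count_space_eq2[OF fin] by blast
  then have "(\<lambda>r. F (z r)) \<in> measurable N (count_space UNIV)"
    by (rule measurable_compose) simp
  then show ?thesis by (simp add: eq)
qed

declare [[simproc add: measurable]]

lemma measurable_reward:
  assumes "u < n" "c < M" "b < K" "\<And>t. t < n \<Longrightarrow> sets (D t) = sets (reward_space K M)"
  shows "(\<lambda>r. r u (c, b)) \<in> borel_measurable (PiM {..<n} D)"
proof (rule measurable_compose[of "\<lambda>r. r u" _ "D u"])
  show "(\<lambda>r. r u) \<in> measurable (PiM {..<n} D) (D u)"
    by (rule measurable_component_singleton) (use assms in simp)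
  have "(\<lambda>x. x (c, b)) \<in> borel_measurable (reward_space K M)"
    unfolding reward_space_def by (rule measurable_component_singleton) (use assms in simp)
  moreover have "(borel_measurable (D u) :: (rewards \<Rightarrow> real) set) = borel_measurable (reward_space K M)"
    by (rule measurable_cong_sets) (use assms in simp_all)
  ultimately show "(\<lambda>x. x (c, b)) \<in> borel_measurable (D u)" by (simp only:)
qed

lemma is_policy_elim_policy:
  assumes "1 \<le> K"
  shows "is_policy K M T E (elim_policy K M T E)"
  unfolding is_policy_def
proof (intro ballI allI impI conjI)
  fix cs as r
  show "set_pmf (elim_policy K M T E (history_of M E cs r as) (cs ! length as)) \<subseteq> {..<K}"
    using assms by (simp add: elim_policy_def decide_def next_action_less)
next
  fix cs as a
  have "(\<lambda>r. decide K M T E (history_of M E cs r as) (cs ! length as))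
      \<in> measurable (PiM {..<length as} (\<lambda>_. reward_space K M)) (count_space UNIV)"
    by (rule measurable_decide) (auto intro: measurable_reward)
  then have "(\<lambda>r. indicator {a} (decide K M T E (history_of M E cs r as) (cs ! length as)) :: real)
      \<in> borel_measurable (PiM {..<length as} (\<lambda>_. reward_space K M))"
    by (rule measurable_compose) simp
  moreover have "pmf (elim_policy K M T E (history_of M E cs r as) (cs ! length as)) a =
      indicator {a} (decide K M T E (history_of M E cs r as) (cs ! length as))" for r
    by (simp add: elim_policy_def indicator_def)
  ultimately show "(\<lambda>r. pmf (elim_policy K M T E (history_of M E cs r as) (cs ! length as)) a)
      \<in> borel_measurable (PiM {..<length as} (\<lambda>_. reward_space K M))" by simp
qed

section \<open>The game in a fixed environment\<close>

locale elimination_game =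
  fixes K M T :: nat and E :: "(nat \<times> nat) set" and cs :: "nat list"
    and \<mu> :: "nat \<Rightarrow> nat \<Rightarrow> real" and D :: "nat \<Rightarrow> rewards measure"
  assumes K: "1 \<le> K" and M: "1 \<le> M" and T: "1 \<le> T"
    and E: "digraph_on K E" and so: "strongly_observable K E"
    and cs: "cs \<in> self_avoiding M T"
    and mu: "c < M \<Longrightarrow> a < K \<Longrightarrow> \<mu> c a \<in> {0..1}"
    and D: "prob_space (D t)" "sets (D t) = sets (reward_space K M)"
    and rew: "c < M \<Longrightarrow> a < K \<Longrightarrow> AE x in D t. x (c, a) \<in> {0..1}"
      "c < M \<Longrightarrow> a < K \<Longrightarrow> prob_space.expectation (D t) (\<lambda>x. x (c, a)) = \<mu> c a"
begin

definition "L = conf K M T"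

text \<open>The policy is deterministic, so given the rewards \<open>play\<close> is a point mass
  and the actions are a function of \<open>r\<close>.\<close>

primrec acts :: "(nat \<Rightarrow> rewards) \<Rightarrow> nat \<Rightarrow> nat list" where
  "acts r 0 = []"
| "acts r (Suc t) = acts r t @ [decide K M T E (history_of M E cs r (acts r t)) (cs ! t)]"

definition "act r t = decide K M T E (history_of M E cs r (acts r t)) (cs ! t)"

abbreviation "ctx t \<equiv> cs ! t"

lemma length_acts [simp]: "length (acts r t) = t"
  by (induction t) auto

lemma nth_acts: "u < t \<Longrightarrow> acts r t ! u = act r u"
  by (induction t) (auto simp: nth_append less_Suc_eq act_def)

lemma play_acts: "play M E (elim_policy K M T E) cs r t = return_pmf (acts r t)"
  by (induction t) (simp_all add: bind_return_pmf elim_policy_def)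

lemma acts_Suc: "acts r (Suc t) = acts r t @ [act r t]"
  by (simp add: act_def)

lemma acts_cong: "(\<And>u. u < t \<Longrightarrow> r u = r' u) \<Longrightarrow> acts r t = acts r' t \<and> act r t = act r' t"
proof (induction t)
  case (Suc t)
  then have "acts r t = acts r' t" "act r t = act r' t" by simp_all
  then have "acts r (Suc t) = acts r' (Suc t)" unfolding acts_Suc by simp
  moreover have "history_of M E cs r (acts r' (Suc t)) = history_of M E cs r' (acts r' (Suc t))"
    unfolding history_of_def by (intro map_cong refl) (use Suc.prems in auto)
  ultimately show ?case by (simp add: act_def del: acts.simps)
qed (simp add: act_def history_of_def)

text \<open>Connects the policy, which sees only a history, with the closed recursion over all
  rounds that \<open>elimination_run\<close> assumes.\<close>

lemma act_eq: "act r t = next_action K E (ready K E (kept L K M E ctx r (act r)) ctx (act r) t)"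
proof -
  let ?ctx = "\<lambda>u. if u < t then cs ! u else cs ! t"
  have "kept (conf K M T) K M E ?ctx r (\<lambda>u. acts r t ! u) u = kept L K M E ctx r (act r) u" if "u \<le> t" for u
  proof -
    have "obs_count E (\<lambda>u. acts r t ! u) u = obs_count E (act r) u"
      by (rule obs_count_cong) (use that in \<open>simp add: nth_acts\<close>)
    moreover have "(\<Sum>v<u. observe M E (acts r t ! v) (r v) (?ctx u, a)) =
        (\<Sum>v<u. observe M E (act r v) (r v) (ctx u, a))" for a
      by (rule sum.cong) (use that in \<open>auto simp: nth_acts\<close>)
    ultimately show ?thesis by (simp only: kept_def L_def)
  qed
  then have "ready K E (kept (conf K M T) K M E ?ctx r (\<lambda>u. acts r t ! u)) ?ctx (\<lambda>u. acts r t ! u) t =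
      ready K E (kept L K M E ctx r (act r)) ctx (act r) t"
    by (intro ready_cong) (auto simp: nth_acts)
  then show ?thesis unfolding act_def decide_history by (simp add: Let_def)
qed

lemma ctx_less: "t < T \<Longrightarrow> ctx t < M"
proof -
  assume "t < T"
  have "cs \<in> context_seqs M T"
    using cs unfolding self_avoiding_def mem_Collect_eq by (rule conjunct1)
  then have "t < length cs" "set cs \<subseteq> {..<M}" using \<open>t < T\<close> by (simp_all add: context_seqs_def)
  then have "ctx t \<in> {..<M}" using nth_mem by blast
  then show ?thesis by simp
qed

lemma ctx_self_avoiding: "s \<le> u \<Longrightarrow> u \<le> t \<Longrightarrow> t < T \<Longrightarrow> ctx s = ctx t \<Longrightarrow> ctx u = ctx s"
proof (cases "s = t")
  case False
  assume "s \<le> u" "u \<le> t" "t < T" "ctx s = ctx t"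
  moreover from this False have "s < t" by simp
  moreover have "\<forall>s t. s < t \<and> t < T \<and> ctx s = ctx t \<longrightarrow> (\<forall>u\<in>{s..t}. ctx u = ctx s)"
    using cs unfolding self_avoiding_def mem_Collect_eq by (rule conjunct2)
  ultimately have "\<forall>u\<in>{s..t}. ctx u = ctx s" by blast
  moreover have "u \<in> {s..t}" using \<open>s \<le> u\<close> \<open>u \<le> t\<close> by simp
  ultimately show ?thesis by (rule bspec)
qed simp

definition opt :: "nat \<Rightarrow> nat" where
  "opt c = (SOME a. a < K \<and> (\<forall>b<K. \<mu> c b \<le> \<mu> c a))"

lemma opt: "opt c < K" "b < K \<Longrightarrow> \<mu> c b \<le> \<mu> c (opt c)"
proof -
  have "finite (\<mu> c ` {..<K})" "\<mu> c ` {..<K} \<noteq> {}" using K by (auto simp: lessThan_empty_iff)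
  then have "Max (\<mu> c ` {..<K}) \<in> \<mu> c ` {..<K}" by (rule Max_in)
  then obtain a where "a < K" "\<mu> c a = Max (\<mu> c ` {..<K})" by auto
  then have "\<exists>a. a < K \<and> (\<forall>b<K. \<mu> c b \<le> \<mu> c a)" by (intro exI[of _ a]) simp
  from someI_ex[OF this] show "opt c < K" "b < K \<Longrightarrow> \<mu> c b \<le> \<mu> c (opt c)" by (auto simp: opt_def)
qed

lemma Max_mu: "Max (\<mu> c ` {..<K}) = \<mu> c (opt c)"
  by (rule Max_eqI) (use opt in auto)

text \<open>Deviations are controlled in every context, also in those not yet current, since
  cross-learning collects observations for all of them.\<close>

definition good :: "(nat \<Rightarrow> rewards) \<Rightarrow> bool" where
  "good r \<longleftrightarrow> (\<forall>t<T. \<forall>c<M. \<forall>a<K.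
     \<bar>(\<Sum>u<t. observe M E (act r u) (r u) (c, a)) - \<mu> c a * real (obs_count E (act r) t a)\<bar>
       \<le> sqrt (real (obs_count E (act r) t a) * L))"

definition "rounds_per_layer = (floor_log K + 3) * beta K E M"

lemma L_ge_1: "1 \<le> L"
proof -
  have "harm 1 \<le> (harm (K + M + T) :: real)" by (rule harm_mono) (use K in simp)
  then show ?thesis by (simp add: L_def conf_def harm_def)
qed

lemma good_regret:
  assumes "good r"
  shows "(\<Sum>t<T. Max (\<mu> (ctx t) ` {..<K}) - \<mu> (ctx t) (acts r T ! t))
    \<le> 18 * sqrt L * sqrt (real rounds_per_layer * real T)"
proof -
  let ?Z = "kept L K M E ctx r (act r)"
  have L: "0 \<le> L" using L_ge_1 by simp
  have dev: "\<bar>(\<Sum>u<t. observe M E (act r u) (r u) (ctx t, a)) - \<mu> (ctx t) a * real (obs_count E (act r) t a)\<bar>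
       \<le> sqrt (real (obs_count E (act r) t a) * L)" if "t < T" "a < K" for t a
    using assms that ctx_less[OF that(1)] by (simp add: good_def)
  interpret R: elimination_run K M T E ?Z ctx "act r" opt
  proof
    show "opt (ctx t) \<in> ?Z t" if "t < T" for t
      unfolding kept_def
      by (rule survivors_opt[where \<mu> = "\<mu> (ctx t)"]) (use L opt dev[OF that] in auto)
  qed (use K M E so ctx_less ctx_self_avoiding act_eq opt in auto)
  let ?gap = "\<lambda>c a. \<mu> c (opt c) - \<mu> c a"
  \<comment> \<open>\<open>6\<close> instead of the \<open>4\<close> of \<open>survivors_gap\<close>
    pays for the shift from \<open>l\<close> to \<open>l + 1\<close>, as
    \<open>16 * (l + 1) \<le> 36 * l\<close> for \<open>1 \<le> l\<close>. The shift gives layer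
    \<open>0\<close> a finite bound, which holds since gaps are at most \<open>1\<close>.\<close>
  let ?g = "\<lambda>l. 6 * sqrt L * (1 / sqrt (real l + 1))"
  have gap: "?gap (ctx t) a \<le> ?g l"
    if t: "t < T" and a: "a \<in> ?Z t" "a < K" and l: "l \<le> obs_count E (act r) t a"
      "l \<le> obs_count E (act r) t (opt (ctx t))" for t a l
  proof (cases "l = 0")
    case True
    have "\<mu> (ctx t) (opt (ctx t)) \<le> 1" "0 \<le> \<mu> (ctx t) a"
      using mu[OF ctx_less[OF t] opt(1)] mu[OF ctx_less[OF t] a(2)] by auto
    then have "?gap (ctx t) a \<le> 1" by linarith
    also have "\<dots> \<le> 6 * sqrt L"
      using real_sqrt_ge_one[OF L_ge_1] by linarith
    finally show ?thesis using True by simp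
  next
    case False
    then have l0: "0 < l" by simp
    have "?gap (ctx t) a \<le> 4 * sqrt (L / l)"
      by (rule survivors_gap[OF L opt(1) dev[OF t] a(1)[unfolded kept_def] l0 l])
    also have "4 * sqrt (L / l) = sqrt (16 * (L / l))"
    proof -
      have "sqrt 16 = (4::real)" by (rule real_sqrt_unique) auto
      then show ?thesis by (simp only: real_sqrt_mult[of 16])
    qed
    also have "\<dots> \<le> sqrt (36 * L / (real l + 1))"
    proof (rule real_sqrt_le_mono)
      have "16 * L * (real l + 1) \<le> 36 * L * real l"
        using mult_left_mono[of "16 * (real l + 1)" "36 * real l" L] l0 L by (simp add: algebra_simps)
      then show "16 * (L / l) \<le> 36 * L / (real l + 1)" using l0 by (simp add: field_simps)
    qed
    also have "\<dots> = ?g l" by (simp add: real_sqrt_mult real_sqrt_divide)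
    finally show ?thesis .
  qed
  have "(\<Sum>t<T. Max (\<mu> (ctx t) ` {..<K}) - \<mu> (ctx t) (acts r T ! t)) = (\<Sum>t<T. ?gap (ctx t) (act r t))"
    by (rule sum.cong) (auto simp: Max_mu nth_acts)
  also have "\<dots> = (\<Sum>t\<in>R.exploring. ?gap (ctx t) (act r t))"
    by (rule sum.mono_neutral_right) (use R.not_exploring in \<open>auto simp: R.exploring_def\<close>)
  also have "\<dots> \<le> (\<Sum>t\<in>R.exploring. ?g (R.lay t))"
  proof (rule sum_mono)
    fix t assume "t \<in> R.exploring"
    then have "t < T" by (simp add: R.exploring_def)
    with R.gap_active[of ?gap ?g t "act r t"] gap R.act_active show "?gap (ctx t) (act r t) \<le> ?g (R.lay t)"
      by blast
  qed
  also have "\<dots> = 6 * sqrt L * (\<Sum>t\<in>R.exploring. 1 / sqrt (real (R.lay t) + 1))"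
    by (simp add: sum_distrib_left)
  also have "\<dots> \<le> 6 * sqrt L * (3 * sqrt (real rounds_per_layer * real T))"
  proof (rule mult_left_mono, rule sum_layers_le)
    show "card {t \<in> R.exploring. R.lay t = l} \<le> rounds_per_layer" for l
      unfolding rounds_per_layer_def by (rule R.card_exploring)
    show "0 < rounds_per_layer" using beta_pos[OF K M, of E] by (simp add: rounds_per_layer_def)
  qed (use T L in \<open>auto simp: R.exploring_def\<close>)
  finally show ?thesis by simp
qed

section \<open>Probability of a large deviation\<close>

abbreviation "P n \<equiv> PiM {..<n} D"

lemma prob_P: "prob_space (P n)"
  by (rule prob_space_PiM) (rule D)

lemma measurable_act_if:
  assumes "t \<le> n" and acts: "(\<lambda>r. acts r t) \<in> measurable (P n) (count_space UNIV)"
  shows "(\<lambda>r. act r t) \<in> measurable (P n) (count_space UNIV)"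
proof -
  \<comment> \<open>The guard on the length matters: for a fixed list \<open>as\<close> the decision
    is measurable only if it reads no reward beyond the coordinates of \<open>P n\<close>.\<close>
  let ?f = "\<lambda>as r. if length as = t then decide K M T E (history_of M E cs r as) (cs ! t) else 0"
  have "(\<lambda>r. ?f (acts r t) r) \<in> measurable (P n) (count_space UNIV)"
  proof (rule measurable_compose_countable[where f = ?f])
    fix as
    show "?f as \<in> measurable (P n) (count_space UNIV)"
    proof (cases "length as = t")
      case True
      have "(\<lambda>r. decide K M T E (history_of M E cs r as) (cs ! t)) \<in> measurable (P n) (count_space UNIV)"
        by (rule measurable_decide) (use assms True D in \<open>auto intro: measurable_reward\<close>)
      with True show ?thesis by simp
    qed simp
  qed (rule acts)
  then show ?thesis by (simp add: act_def)
qed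

lemma measurable_acts: "t \<le> n \<Longrightarrow> (\<lambda>r. acts r t) \<in> measurable (P n) (count_space UNIV)"
proof (induction t)
  case (Suc t)
  have "t \<le> n" using Suc.prems by (rule Suc_leD)
  note acts = Suc.IH[OF this]
  have "(\<lambda>r. as @ [act r t]) \<in> measurable (P n) (count_space UNIV)" for as
    by (rule measurable_compose[OF measurable_act_if[OF \<open>t \<le> n\<close> acts]]) (rule measurable_count_space)
  then show ?case
    unfolding acts_Suc by (rule measurable_compose_countable[OF _ acts])
qed simp

lemma measurable_act: "t \<le> n \<Longrightarrow> (\<lambda>r. act r t) \<in> measurable (P n) (count_space UNIV)"
  by (rule measurable_act_if[OF _ measurable_acts])

text \<open>The source of the factor \<open>3\<close> in \<open>conf\<close>: the union bound over
  rounds, contexts and actions, the union over observation counts and the trivial regret bound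
  contribute five factors of at most \<open>K + M + T\<close>, against an inverse sixth power from
  \<open>exp (- 2 * L)\<close>.\<close>

lemma L_tail: "real T * (real T * real M * real K * (2 * (real T * exp (- 2 * L)))) \<le> 2"
proof -
  define S where "S = real (K + M + T)"
  have S: "1 \<le> S" "real K \<le> S" "real M \<le> S" "real T \<le> S" using K by (auto simp: S_def)
  have "ln S \<le> ln (S + 1)" using S by (intro ln_mono) auto
  also have "\<dots> \<le> harm (K + M + T)" unfolding S_def by (rule ln_le_harm)
  finally have "3 * ln S \<le> L" by (simp add: L_def conf_def)
  then have "- 2 * L \<le> - (6 * ln S)" by simp
  then have "exp (- 2 * L) \<le> exp (- (6 * ln S))" by (simp only: exp_le_cancel_iff)
  also have "\<dots> = 1 / S ^ 6"
    using S exp_of_nat_mult[of 6 "ln S"] by (simp add: exp_minus field_simps)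
  finally have e: "exp (- 2 * L) \<le> 1 / S ^ 6" .
  have "real T * (real T * real M * real K * (2 * (real T * exp (- 2 * L)))) \<le>
      S * (S * S * S * (2 * (S * (1 / S ^ 6))))"
    by (intro mult_mono e) (use S in auto)
  also have "\<dots> = 2 * (S ^ 5 / S ^ 6)" by (simp add: power_numeral_reduce)
  also have "S ^ 5 / S ^ 6 \<le> 1" using S power_increasing[of 5 6 S] by (simp add: divide_le_eq_1)
  finally show ?thesis by simp
qed

text \<open>The bad event is enclosed in a finite union of measurable tail events, one for each
  round, context, action and sign of the deviation.\<close>

lemma prob_bad: "\<exists>B\<in>sets (P T). {r\<in>space (P T). \<not> good r} \<subseteq> B \<and>
    measure (P T) B \<le> real T * real M * real K * (2 * (real T * exp (- 2 * L)))"
proof -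
  interpret P: prob_space "P T" by (rule prob_P)
  \<comment> \<open>The cut \<open>s < t\<close> writes a prefix of length \<open>t\<close> as a sum
    over all \<open>T\<close> rounds, so that every tail event lives on the same product
    space.\<close>
  let ?xi = "\<lambda>t a s r. s < t \<and> (act r s, a) \<in> E"
  let ?X = "\<lambda>c a e s x. e * (x (c, a) - \<mu> c a) :: real"
  let ?A = "\<lambda>(t, c, a, e). {r\<in>space (P T). sqrt (real (\<Sum>s<T. of_bool (?xi t a s r)) * L) <
      (\<Sum>s<T. if ?xi t a s r then ?X c a e s (r s) else 0)}"
  define I where "I = {..<T} \<times> {..<M} \<times> {..<K} \<times> {1, - 1 :: real}"
  have finI: "finite I" by (simp add: I_def)
  have A: "?A i \<in> sets (P T) \<and> measure (P T) (?A i) \<le> real T * exp (- 2 * L)" if "i \<in> I" for i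
  proof -
    from that obtain t c a e where i: "i = (t, c, a, e)" "t < T" "c < M" "a < K" "e \<in> {1, -1}"
      by (auto simp: I_def)
    have X: "?X c a e s \<in> borel_measurable (D s)" for s
    proof -
      have "(\<lambda>x. x (c, a)) \<in> borel_measurable (reward_space K M)"
        unfolding reward_space_def by (rule measurable_component_singleton) (use i in simp)
      then have [measurable]: "(\<lambda>x. x (c, a)) \<in> borel_measurable (D s)"
        using measurable_cong_sets[OF D(2) refl] by blast
      show ?thesis by measurable
    qed
    have xi: "Measurable.pred (P n) (?xi t a s)" if "s \<le> n" for s n
    proof (rule measurable_compose[OF measurable_act[OF that]])
      show "(\<lambda>b. s < t \<and> (b, a) \<in> E) \<in> measurable (count_space UNIV) (count_space UNIV)"
        by (rule measurable_count_space)
    qed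
    have sets: "?A i \<in> sets (P T)"
      unfolding i(1) prod.case by (rule adaptive_tail_sets[OF X xi])
    have mgf: "(\<integral>\<^sup>+y. ennreal (exp (l * ?X c a e s y)) \<partial>D s) \<le> ennreal (exp (l\<^sup>2 / 8))" if "0 < l" for s l
    proof (rule bounded_mgf[OF D(1) X _ _ that])
      \<comment> \<open>For either sign the centred reward stays in an interval of length
        one.\<close>
      let ?lo = "if e = 1 then - \<mu> c a else \<mu> c a - 1"
      show "AE x in D s. ?X c a e s x \<in> {?lo..?lo + 1}"
        using rew(1)[OF i(3,4), of s] by eventually_elim (use i(5) in auto)
      interpret Ds: prob_space "D s" by (rule D)
      have "integrable (D s) (\<lambda>x. x (c, a))"
      proof (rule Ds.integrable_const_bound[where B = 1])
        show "AE x in D s. norm (x (c, a)) \<le> 1" using rew(1)[OF i(3,4), of s] by eventually_elim auto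
        show "(\<lambda>x. x (c, a)) \<in> borel_measurable (D s)"
        proof -
          have "(\<lambda>x. x (c, a)) \<in> borel_measurable (reward_space K M)"
            unfolding reward_space_def by (rule measurable_component_singleton) (use i in simp)
          then show ?thesis using measurable_cong_sets[OF D(2) refl] by blast
        qed
      qed
      then show "Ds.expectation (?X c a e s) = 0" using rew(2)[OF i(3,4), of s] by (simp add: Ds.prob_space)
    qed
    have "measure (P T) (?A i) \<le> T * exp (- 2 * L)"
      unfolding i(1) prod.case
    proof (rule adaptive_tail[OF D(1) X mgf _ xi])
      fix s :: nat and x y :: "nat \<Rightarrow> rewards"
      assume "\<And>u. u < s \<Longrightarrow> x u = y u"
      from acts_cong[OF this] show "?xi t a s x = ?xi t a s y" by simp
    qed (use L_ge_1 in auto)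
    with sets show ?thesis by simp
  qed
  have sub: "{r\<in>space (P T). \<not> good r} \<subseteq> (\<Union>i\<in>I. ?A i)"
  proof
    fix r assume "r \<in> {r\<in>space (P T). \<not> good r}"
    then obtain t c a where r: "r \<in> space (P T)" and tca: "t < T" "c < M" "a < K"
      and dev: "sqrt (real (obs_count E (act r) t a) * L) <
       \<bar>(\<Sum>u<t. observe M E (act r u) (r u) (c, a)) - \<mu> c a * real (obs_count E (act r) t a)\<bar>"
      by (auto simp: good_def not_le)
    let ?d = "(\<Sum>u<t. observe M E (act r u) (r u) (c, a)) - \<mu> c a * real (obs_count E (act r) t a)"
    define e :: real where "e = (if 0 \<le> ?d then 1 else - 1)"
    have restrict: "(\<Sum>s<T. if s < t then f s else 0) = (\<Sum>s<t. f s)" for f :: "nat \<Rightarrow> 'z::comm_monoid_add"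
    proof -
      have "(\<Sum>s<T. if s < t then f s else 0) = (\<Sum>s\<in>{s\<in>{..<T}. s < t}. f s)"
        by (rule sum.inter_filter[symmetric]) simp
      also have "{s\<in>{..<T}. s < t} = {..<t}" using tca by auto
      finally show ?thesis .
    qed
    have n: "(\<Sum>s<T. of_bool (?xi t a s r)) = obs_count E (act r) t a"
    proof -
      have "(\<Sum>s<T. of_bool (?xi t a s r) :: nat) = (\<Sum>s<T. if s < t then of_bool ((act r s, a) \<in> E) else 0)"
        by (rule sum.cong) auto
      then show ?thesis unfolding obs_count_def restrict .
    qed
    have "(\<Sum>s<T. if ?xi t a s r then ?X c a e s (r s) else 0) =
        (\<Sum>s<T. if s < t then e * (observe M E (act r s) (r s) (c, a) - \<mu> c a * real (of_bool ((act r s, a) \<in> E))) else 0)"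
      by (rule sum.cong) (use tca in \<open>auto simp: observe_def\<close>)
    also have "\<dots> = e * ?d"
      unfolding restrict obs_count_def of_nat_sum sum_distrib_left sum_subtractf right_diff_distrib ..
    also have "\<dots> = \<bar>?d\<bar>" by (simp add: e_def)
    finally have "r \<in> ?A (t, c, a, e)" using r dev unfolding prod.case mem_Collect_eq n by simp
    moreover have "(t, c, a, e) \<in> I" using tca by (simp add: I_def e_def)
    ultimately show "r \<in> (\<Union>i\<in>I. ?A i)" by blast
  qed
  have "measure (P T) (\<Union>i\<in>I. ?A i) \<le> (\<Sum>i\<in>I. measure (P T) (?A i))"
    by (rule P.finite_measure_subadditive_finite[OF finI]) (use A in blast)
  also have "\<dots> \<le> (\<Sum>i\<in>I. real T * exp (- 2 * L))" by (rule sum_mono) (use A in blast)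
  also have "\<dots> = real (card I) * (real T * exp (- 2 * L))" by simp
  also have "card I = T * (M * (K * 2))" by (simp add: I_def card_cartesian_product)
  finally have "measure (P T) (\<Union>i\<in>I. ?A i) \<le> real T * real M * real K * (2 * (real T * exp (- 2 * L)))"
    by (simp add: algebra_simps)
  moreover have "(\<Union>i\<in>I. ?A i) \<in> sets (P T)" by (rule sets.finite_UN[OF finI]) (use A in blast)
  ultimately show ?thesis using sub by blast
qed

section \<open>Expected regret and its constants\<close>

lemma expected_regret_le:
  "expected_regret K M T E (elim_policy K M T E) cs \<mu> D \<le>
    18 * sqrt L * sqrt (real rounds_per_layer * real T) + 2"
proof -
  interpret P: prob_space "P T" by (rule prob_P)
  let ?f = "\<lambda>r. \<Sum>t<T. Max (\<mu> (ctx t) ` {..<K}) - \<mu> (ctx t) (acts r T ! t)"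
  let ?b = "18 * sqrt L * sqrt (real rounds_per_layer * real T)"
  have L: "0 \<le> L" using L_ge_1 by simp
  have b: "0 \<le> ?b" using L by simp
  obtain B where B: "B \<in> sets (P T)" "{r\<in>space (P T). \<not> good r} \<subseteq> B"
    "measure (P T) B \<le> real T * real M * real K * (2 * (real T * exp (- 2 * L)))"
    using prob_bad by blast
  have fT: "?f r \<le> real T" for r
  proof -
    have "?f r \<le> (\<Sum>t<T. 1)"
    proof (rule sum_mono)
      fix t assume "t \<in> {..<T}"
      then have t: "t < T" by simp
      have "act r t < K" unfolding act_def decide_def by (rule next_action_less) (use K in simp)
      then show "Max (\<mu> (ctx t) ` {..<K}) - \<mu> (ctx t) (acts r T ! t) \<le> 1"
        using mu[OF ctx_less[OF t] opt(1)] mu[OF ctx_less[OF t], of "act r t"] t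
        by (simp add: Max_mu nth_acts) (smt (verit))
    qed
    then show ?thesis by simp
  qed
  \<comment> \<open>Off \<open>B\<close> the deviations are small; on \<open>B\<close> each round
    costs at most \<open>1\<close>.\<close>
  have le: "?f r \<le> ?b + real T * indicator B r" if "r \<in> space (P T)" for r
  proof (cases "good r")
    case True
    then show ?thesis using good_regret[OF True] by (simp add: indicator_def)
  next
    case False
    with that B have "r \<in> B" by auto
    then show ?thesis using fT[of r] b by simp
  qed
  have "expected_regret K M T E (elim_policy K M T E) cs \<mu> D = (\<integral>r. ?f r \<partial>P T)"
    unfolding expected_regret_def play_acts by simp
  also have "\<dots> \<le> ?b + real T * measure (P T) B"
  proof (cases "integrable (P T) ?f")
    case True
    have "(\<integral>r. ?f r \<partial>P T) \<le> (\<integral>r. ?b + real T * indicator B r \<partial>P T)"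
      by (rule integral_mono[OF True]) (use le B(1) P.emeasure_finite in \<open>auto simp: less_top[symmetric]\<close>)
    also have "\<dots> = ?b + real T * measure (P T) B"
      using B(1) P.emeasure_finite by (simp add: P.prob_space less_top[symmetric])
    finally show ?thesis .
  next
    case False
    \<comment> \<open>The integral of a non-integrable function is \<open>0\<close> by convention,
      and the bound is nonnegative.\<close>
    then have "(\<integral>r. ?f r \<partial>P T) = 0" by (rule not_integrable_integral_eq)
    then show ?thesis using b by simp
  qed
  also have "real T * measure (P T) B \<le> 2"
    using mult_left_mono[OF B(3), of "real T"] L_tail by simp
  finally show ?thesis by simp
qed

text \<open>The confidence level and the number of dyadic classes are each at most a multiple of
  \<open>X\<close>, and each enters under a root; hence the exponent \<open>1\<close>.\<close>

lemma rate_le: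
  defines "X \<equiv> 1 + ln (real K) + ln (real M) + ln (real T)"
  shows "18 * sqrt L * sqrt (real rounds_per_layer * real T) + 2 \<le>
    200 * X ^ 1 * sqrt (real (beta K E M) * real T)"
proof -
  let ?\<beta> = "real (beta K E M)"
  have \<beta>: "1 \<le> ?\<beta>" using beta_pos[OF K M, of E] by simp
  have lns: "0 \<le> ln (real K)" "0 \<le> ln (real M)" "0 \<le> ln (real T)" using K M T by auto
  then have X: "1 \<le> X" by (simp add: X_def)
  \<comment> \<open>\<open>harm n - ln n\<close> decreases from its value \<open>1\<close> at
    \<open>n = 1\<close>.\<close>
  have "harm (K + M + T) - ln (real (K + M + T)) \<le> harm 1 - ln (real 1)"
    by (rule euler_mascheroni_sequence_decreasing) (use K in auto)
  then have "harm (K + M + T) \<le> 1 + ln (real (K + M + T))" by (simp add: harm_def)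
  also have "ln (real (K + M + T)) \<le> ln (3 * (real K * (real M * real T)))"
  proof (rule ln_mono)
    have "real K \<le> real K * (real M * real T)" "real M \<le> real K * (real M * real T)"
      "real T \<le> real K * (real M * real T)"
      using K M T by (simp_all flip: of_nat_mult)
    then show "real (K + M + T) \<le> 3 * (real K * (real M * real T))" by simp
  qed (use K in auto)
  also have "\<dots> = ln 3 + (ln (real K) + (ln (real M) + ln (real T)))"
    using K M T by (simp add: ln_mult)
  also have "ln 3 \<le> (2::real)" using ln_le_minus_one[of 3] by simp
  finally have "L \<le> 9 * X" using X by (simp add: L_def conf_def X_def)
  then have L: "sqrt L \<le> sqrt (9 * X)" by simp
  have "real (floor_log K) * ln 2 = ln (2 ^ floor_log K)" by (simp add: ln_realpow)
  also have "\<dots> \<le> ln (real K)"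
  proof (rule ln_mono)
    show "(2::real) ^ floor_log K \<le> real K"
      using floor_log_exp2_le[of K] K by (metis of_nat_le_iff of_nat_numeral of_nat_power less_le_trans zero_less_one)
  qed simp_all
  finally have "real (floor_log K) * ln 2 \<le> ln (real K)" .
  moreover have "real (floor_log K) * (1 / 2) \<le> real (floor_log K) * ln 2"
    using ln2_ge_two_thirds by (intro mult_left_mono) auto
  ultimately have "real (floor_log K) + 3 \<le> 3 * X" using lns by (simp add: X_def)
  then have "real rounds_per_layer \<le> 3 * X * ?\<beta>"
    unfolding rounds_per_layer_def of_nat_mult by (intro mult_right_mono) auto
  then have "real rounds_per_layer * real T \<le> 3 * X * ?\<beta> * real T" by (rule mult_right_mono) simp
  then have "sqrt (real rounds_per_layer * real T) \<le> sqrt (3 * X * (?\<beta> * real T))" by (simp add: mult.assoc)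
  with L have "18 * sqrt L * sqrt (real rounds_per_layer * real T) \<le>
      18 * sqrt (9 * X) * sqrt (3 * X * (?\<beta> * real T))"
    by (intro mult_mono) (use X L_ge_1 in auto)
  also have "\<dots> = 18 * (sqrt 27 * (X * sqrt (?\<beta> * real T)))"
  proof -
    have "sqrt (9 * X) * sqrt (3 * X * (?\<beta> * real T)) = sqrt (27 * (X\<^sup>2 * (?\<beta> * real T)))"
      by (simp add: power2_eq_square ac_simps flip: real_sqrt_mult)
    also have "\<dots> = sqrt 27 * (X * sqrt (?\<beta> * real T))"
      using X by (simp add: real_sqrt_mult)
    finally show ?thesis by simp
  qed
  also have "sqrt 27 \<le> (6::real)" by (rule real_le_lsqrt) auto
  then have "18 * (sqrt 27 * (X * sqrt (?\<beta> * real T))) \<le> 18 * (6 * (X * sqrt (?\<beta> * real T)))"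
    using X \<beta> by (intro mult_left_mono mult_right_mono) auto
  finally have 1: "18 * sqrt L * sqrt (real rounds_per_layer * real T) \<le> 108 * (X * sqrt (?\<beta> * real T))"
    by simp
  have "1 \<le> sqrt (?\<beta> * real T)" using \<beta> T mult_mono[of 1 ?\<beta> 1 "real T"] by simp
  with X have "1 \<le> X * sqrt (?\<beta> * real T)" using mult_mono[of 1 X 1 "sqrt (?\<beta> * real T)"] by simp
  with 1 have "18 * sqrt L * sqrt (real rounds_per_layer * real T) + 2 \<le> 110 * (X * sqrt (?\<beta> * real T))"
    by linarith
  also have "\<dots> \<le> 200 * X ^ 1 * sqrt (?\<beta> * real T)" using X by (simp add: mult.assoc)
  finally show ?thesis .
qed

end

lemma regret_elim_policy:
  assumes "1 \<le> K" "1 \<le> M" "1 \<le> T" "digraph_on K E" "strongly_observable K E"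
  shows "regret K M T E (elim_policy K M T E) (self_avoiding M T) \<le>
    ereal (200 * (1 + ln (real K) + ln (real M) + ln (real T)) ^ 1 * sqrt (real (beta K E M) * real T))"
  unfolding regret_def
proof (rule SUP_least, rule SUP_least, clarify)
  fix cs \<mu> D assume cs: "cs \<in> self_avoiding M T" and env: "(\<mu>, D) \<in> environments K M T"
  \<comment> \<open>The locale asks for a law in every round. Repeating \<open>D 0\<close> beyond
    the horizon leaves the product over the rounds below \<open>T\<close> unchanged.\<close>
  define D' where "D' t = (if t < T then D t else D 0)" for t
  have D': "D' t = D (if t < T then t else 0)" "(if t < T then t else 0) < T" for t
    using assms(3) by (auto simp: D'_def)
  interpret elimination_game K M T E cs \<mu> D'
  proof (rule elimination_game.intro)
    have 1: "prob_space (D s)" "sets (D s) = sets (reward_space K M)" if "s < T" for s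
      using env that by (auto simp: environments_def)
    have 2: "AE x in D s. x (c, a) \<in> {0..1}" "prob_space.expectation (D s) (\<lambda>x. x (c, a)) = \<mu> c a"
      if "s < T" "c < M" "a < K" for s c a
      using env that by (auto simp: environments_def)
    show "prob_space (D' t)" "sets (D' t) = sets (reward_space K M)" for t
      unfolding D'(1)[of t] by (rule 1[OF D'(2)])+
    show "AE x in D' t. x (c, a) \<in> {0..1}" "prob_space.expectation (D' t) (\<lambda>x. x (c, a)) = \<mu> c a"
      if "c < M" "a < K" for t c a
      unfolding D'(1)[of t] by (rule 2[OF D'(2) that])+
    show "\<mu> c a \<in> {0..1}" if "c < M" "a < K" for c a
      using env that by (auto simp: environments_def)
  qed (use assms cs in auto)
  have "PiM {..<T} D = PiM {..<T} D'" by (rule PiM_cong) (auto simp: D'_def)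
  then have "expected_regret K M T E (elim_policy K M T E) cs \<mu> D =
      expected_regret K M T E (elim_policy K M T E) cs \<mu> D'" by (simp add: expected_regret_def)
  also have "\<dots> \<le> 200 * (1 + ln (real K) + ln (real M) + ln (real T)) ^ 1 * sqrt (real (beta K E M) * real T)"
    using expected_regret_le rate_le by (rule order_trans)
  finally show "ereal (expected_regret K M T E (elim_policy K M T E) cs \<mu> D) \<le>
    ereal (200 * (1 + ln (real K) + ln (real M) + ln (real T)) ^ 1 * sqrt (real (beta K E M) * real T))"
    by simp
qed

section \<open>A program for the policy\<close>

text \<open>Execution in an exact number of steps, each with a point mass as its law. Excluding
  \<open>Skip\<close> as a source is what allows an execution to be lifted into \<open>Seq\<close>,
  since \<open>Seq Skip q\<close> steps differently.\<close>

primrec reach :: "input \<Rightarrow> nat \<Rightarrow> com \<times> store \<Rightarrow> com \<times> store \<Rightarrow> bool" where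
  "reach x 0 c c' \<longleftrightarrow> c = c'"
| "reach x (Suc n) c c' \<longleftrightarrow>
     fst c \<noteq> Skip \<and> (\<exists>c1. step x (fst c) (snd c) = return_pmf c1 \<and> reach x n c1 c')"

lemma reach_trans: "reach x m c c1 \<Longrightarrow> reach x n c1 c2 \<Longrightarrow> reach x (m + n) c c2"
  by (induction m arbitrary: c) auto

text \<open>\<open>reach\<close> unfolds at its first step, \<open>run\<close> at its last; this
  lemma passes from one to the other.\<close>

lemma reach_SucD: "reach x (Suc n) c c' \<Longrightarrow>
    \<exists>c1. reach x n c c1 \<and> step x (fst c1) (snd c1) = return_pmf c'"
proof (induction n arbitrary: c)
  case (Suc n)
  from Suc.prems obtain c1 where c1: "fst c \<noteq> Skip" "step x (fst c) (snd c) = return_pmf c1"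
    "reach x (Suc n) c1 c'" by (subst (asm) reach.simps(2)) blast
  from Suc.IH[OF c1(3)] obtain c2
    where "reach x n c1 c2" "step x (fst c2) (snd c2) = return_pmf c'" by blast
  with c1 show ?case by (metis reach.simps(2))
qed auto

lemma run_reach: "reach x n (p, (\<lambda>_. 0, \<lambda>_. 0)) c \<Longrightarrow> run x p n = return_pmf c"
proof (induction n arbitrary: c)
  case (Suc n)
  from reach_SucD[OF Suc.prems] obtain c1
    where "reach x n (p, (\<lambda>_. 0, \<lambda>_. 0)) c1" "step x (fst c1) (snd c1) = return_pmf c" by blast
  with Suc.IH show ?case by (simp add: bind_return_pmf case_prod_beta)
qed simp

lemma run_halted:
  assumes "reach x n (p, (\<lambda>_. 0, \<lambda>_. 0)) (Skip, s)" "n \<le> m"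
  shows "run x p m = return_pmf (Skip, s)"
  using assms(2)
  by (induction m rule: dec_induct) (simp_all add: run_reach[OF assms(1)] bind_return_pmf)

lemma reach_Seq: "reach x n (p, s) (Skip, s') \<Longrightarrow> reach x (Suc n) (Seq p q, s) (q, s')"
proof (induction n arbitrary: p s)
  case (Suc n)
  then obtain p1 s1 where 1: "p \<noteq> Skip" "step x p s = return_pmf (p1, s1)" "reach x n (p1, s1) (Skip, s')"
    by auto
  from Suc.IH[OF 1(3)] 1(1,2) show ?case by simp
qed simp

text \<open>A total-correctness triple from a single initial store, with a bound on the number of
  steps.\<close>

definition exec :: "input \<Rightarrow> nat \<Rightarrow> store \<Rightarrow> com \<Rightarrow> (store \<Rightarrow> bool) \<Rightarrow> bool" where
  "exec x B s p Q \<longleftrightarrow> (\<exists>n s'. n \<le> B \<and> reach x n (p, s) (Skip, s') \<and> Q s')"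

lemma exec_mono: "exec x B s p Q \<Longrightarrow> B \<le> B' \<Longrightarrow> (\<And>s. Q s \<Longrightarrow> Q' s) \<Longrightarrow> exec x B' s p Q'"
  unfolding exec_def by (meson order_trans)

lemma exec_Seq:
  assumes "exec x B1 s p R" "\<And>s1. R s1 \<Longrightarrow> exec x B2 s1 q Q"
  shows "exec x (B1 + B2 + 1) s (Seq p q) Q"
proof -
  from assms(1) obtain n s1 where 1: "n \<le> B1" "reach x n (p, s) (Skip, s1)" "R s1"
    by (auto simp: exec_def)
  from assms(2)[OF 1(3)] obtain m s2 where 2: "m \<le> B2" "reach x m (q, s1) (Skip, s2)" "Q s2"
    by (auto simp: exec_def)
  have "reach x (Suc n + m) (Seq p q, s) (Skip, s2)"
    by (rule reach_trans[OF reach_Seq[OF 1(2)] 2(2)])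
  with 1 2 show ?thesis unfolding exec_def by (intro exI[of _ "Suc n + m"] exI[of _ s2]) auto
qed

lemma exec_Cond:
  assumes "beval x s b \<Longrightarrow> exec x B s p Q" "\<not> beval x s b \<Longrightarrow> exec x B s q Q"
  shows "exec x (B + 1) s (Cond b p q) Q"
proof -
  let ?r = "if beval x s b then p else q"
  from assms have "exec x B s ?r Q" by auto
  then obtain n s' where "n \<le> B" "reach x n (?r, s) (Skip, s')" "Q s'" unfolding exec_def by blast
  then show ?thesis unfolding exec_def by (intro exI[of _ "Suc n"] exI[of _ s']) simp
qed

text \<open>Reduces loop-free code to computation by the simplifier. The values at
  \<open>Toss\<close> and \<open>While\<close> are dummies, which \<open>straight\<close>
  excludes.\<close>

primrec effect :: "input \<Rightarrow> com \<Rightarrow> store \<Rightarrow> store" where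
  "effect x Skip s = s"
| "effect x (NAssign n i j e) s = nstore x s n i j (neval x s e)"
| "effect x (RAssign n i j e) s = rstore x s n i j (reval x s e)"
| "effect x (Toss n i j e) s = s"
| "effect x (Seq p q) s = effect x q (effect x p s)"
| "effect x (Cond b p q) s = (if beval x s b then effect x p s else effect x q s)"
| "effect x (While b p) s = s"

primrec straight :: "com \<Rightarrow> bool" where
  "straight Skip \<longleftrightarrow> True"
| "straight (NAssign n i j e) \<longleftrightarrow> True"
| "straight (RAssign n i j e) \<longleftrightarrow> True"
| "straight (Toss n i j e) \<longleftrightarrow> False"
| "straight (Seq p q) \<longleftrightarrow> straight p \<and> straight q"
| "straight (Cond b p q) \<longleftrightarrow> straight p \<and> straight q"
| "straight (While b p) \<longleftrightarrow> False"

text \<open>An upper bound only: \<open>Cond\<close> is charged for both branches.\<close>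

primrec steps :: "com \<Rightarrow> nat" where
  "steps Skip = 0"
| "steps (NAssign n i j e) = 1"
| "steps (RAssign n i j e) = 1"
| "steps (Toss n i j e) = 1"
| "steps (Seq p q) = steps p + steps q + 1"
| "steps (Cond b p q) = steps p + steps q + 1"
| "steps (While b p) = 0"

lemma exec_straight: "straight p \<Longrightarrow> exec x (steps p) s p (\<lambda>s'. s' = effect x p s)"
proof (induction p arbitrary: s)
  case (Seq p q)
  have "exec x (steps p + steps q + 1) s (Seq p q) (\<lambda>s'. s' = effect x (Seq p q) s)"
  proof (rule exec_Seq)
    show "exec x (steps p) s p (\<lambda>s'. s' = effect x p s)" using Seq by simp
    show "exec x (steps q) s1 q (\<lambda>s'. s' = effect x (Seq p q) s)" if "s1 = effect x p s" for s1
      using Seq that by simp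
  qed
  then show ?case by simp
next
  case (Cond b p q)
  have "exec x (steps p + steps q + 1) s (Cond b p q) (\<lambda>s'. s' = effect x (Cond b p q) s)"
  proof (rule exec_Cond)
    show "exec x (steps p + steps q) s p (\<lambda>s'. s' = effect x (Cond b p q) s)" if "beval x s b"
      by (rule exec_mono[of _ "steps p" _ _ "\<lambda>s'. s' = effect x p s"]) (use Cond that in auto)
    show "exec x (steps p + steps q) s q (\<lambda>s'. s' = effect x (Cond b p q) s)" if "\<not> beval x s b"
      by (rule exec_mono[of _ "steps q" _ _ "\<lambda>s'. s' = effect x q s"]) (use Cond that in auto)
  qed
  then show ?case by simp
next
  case (NAssign n i j e)
  show ?case unfolding exec_def by (intro exI[of _ 1] exI[of _ "effect x (NAssign n i j e) s"]) simp
next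
  case (RAssign n i j e)
  show ?case unfolding exec_def by (intro exI[of _ 1] exI[of _ "effect x (RAssign n i j e) s"]) simp
qed (auto simp: exec_def intro: exI[of _ 0])

section \<open>Counting loops and frame conditions\<close>

definition For :: "nat \<Rightarrow> nexp \<Rightarrow> com \<Rightarrow> com" where
  "For i e p = Seq (NAssign i (NConst 0) (NConst 0) (NConst 0))
     (While (NLess (NMem i (NConst 0) (NConst 0)) e)
        (Seq p (NAssign i (NConst 0) (NConst 0) (NAdd (NMem i (NConst 0) (NConst 0)) (NConst 1)))))"

text \<open>An iteration costs \<open>B + 4\<close> steps with test and increment; the three
  remaining steps are absorbed by \<open>1 \<le> S\<close>. Charging \<open>S\<close> iterations
  instead of \<open>N\<close> gives nested loops a uniform cost. The invariant has to tolerate any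
  value of the counter, since initialisation and increment write it outside the body.\<close>

lemma exec_For:
  assumes "I 0 s" and N: "N \<le> S" "1 \<le> S"
    and body: "\<And>k s. k < N \<Longrightarrow> I k s \<Longrightarrow> fst s (i, 0, 0) = k \<Longrightarrow>
       exec x B s p (\<lambda>s'. I (Suc k) s' \<and> fst s' (i, 0, 0) = k)"
    and stable: "\<And>k s v. I k s \<Longrightarrow> I k ((fst s)((i, 0, 0) := v), snd s)"
    and bound: "\<And>k s. I k s \<Longrightarrow> neval x s e = N"
  shows "exec x ((B + 7) * S) s (For i e p) (\<lambda>s'. I N s' \<and> fst s' (i, 0, 0) = N)"
proof -
  let ?inc = "NAssign i (NConst 0) (NConst 0) (NAdd (NMem i (NConst 0) (NConst 0)) (NConst 1))"
  let ?b = "NLess (NMem i (NConst 0) (NConst 0)) e"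
  let ?w = "While ?b (Seq p ?inc)"
  have loop: "exec x ((N - k) * (B + 4) + 1) s ?w (\<lambda>s'. I N s' \<and> fst s' (i, 0, 0) = N)"
    if "k \<le> N" "I k s" "fst s (i, 0, 0) = k" for k s
    using that
  proof (induction k arbitrary: s rule: inc_induct)
    case base
    then have "reach x 1 (?w, s) (Skip, s)" using bound[of N s] by simp
    with base show ?case unfolding exec_def by (intro exI[of _ 1] exI[of _ s]) auto
  next
    case (step k)
    have "exec x (B + 1 + 1) s (Seq p ?inc) (\<lambda>s'. I (Suc k) s' \<and> fst s' (i, 0, 0) = Suc k)"
    proof (rule exec_Seq[OF body])
      fix s1 assume s1: "I (Suc k) s1 \<and> fst s1 (i, 0, 0) = k"
      have "reach x 1 (?inc, s1) (Skip, ((fst s1)((i, 0, 0) := Suc k), snd s1))"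
        using s1 by (simp add: nstore_def)
      with s1 stable show "exec x 1 s1 ?inc (\<lambda>s'. I (Suc k) s' \<and> fst s' (i, 0, 0) = Suc k)"
        unfolding exec_def by (intro exI[of _ 1] exI) auto
    qed (use step in auto)
    then have "exec x (B + 1 + 1 + ((N - Suc k) * (B + 4) + 1) + 1) s (Seq (Seq p ?inc) ?w)
        (\<lambda>s'. I N s' \<and> fst s' (i, 0, 0) = N)"
      by (rule exec_Seq) (use step.IH in blast)
    then obtain n s' where n: "n \<le> B + 1 + 1 + ((N - Suc k) * (B + 4) + 1) + 1"
      "reach x n (Seq (Seq p ?inc) ?w, s) (Skip, s')" "I N s' \<and> fst s' (i, 0, 0) = N"
      by (auto simp: exec_def)
    have "reach x (Suc n) (?w, s) (Skip, s')" using n(2) bound[of k s] step by simp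
    moreover have "Suc n \<le> (N - k) * (B + 4) + 1"
    proof -
      have "N - k = Suc (N - Suc k)" using step by simp
      with n(1) show ?thesis by simp
    qed
    ultimately show ?case using n(3) unfolding exec_def by blast
  qed
  let ?s = "((fst s)((i, 0, 0) := 0), snd s)"
  have "exec x (1 + (N * (B + 4) + 1) + 1) s (For i e p) (\<lambda>s'. I N s' \<and> fst s' (i, 0, 0) = N)"
    unfolding For_def
  proof (rule exec_Seq)
    show "exec x 1 s (NAssign i (NConst 0) (NConst 0) (NConst 0)) (\<lambda>s'. s' = ?s)"
      unfolding exec_def by (intro exI[of _ 1] exI[of _ ?s]) (simp add: nstore_def)
    show "exec x (N * (B + 4) + 1) s1 ?w (\<lambda>s'. I N s' \<and> fst s' (i, 0, 0) = N)" if "s1 = ?s" for s1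
      using loop[of 0 ?s] stable[OF assms(1)] that by simp
  qed
  moreover have "1 + (N * (B + 4) + 1) + 1 \<le> (B + 7) * S"
  proof -
    have "N * (B + 4) \<le> S * (B + 4)" using N by (intro mult_right_mono) auto
    then show ?thesis using N by (simp add: algebra_simps)
  qed
  ultimately show ?thesis by (rule exec_mono)
qed

lemma exec_For_straight:
  assumes "straight p" "I 0 s" "N \<le> S" "1 \<le> S"
    and body: "\<And>k s. k < N \<Longrightarrow> I k s \<Longrightarrow> fst s (i, 0, 0) = k \<Longrightarrow>
       I (Suc k) (effect x p s) \<and> fst (effect x p s) (i, 0, 0) = k"
    and stable: "\<And>k s v. I k s \<Longrightarrow> I k ((fst s)((i, 0, 0) := v), snd s)"
    and bound: "\<And>k s. I k s \<Longrightarrow> neval x s e = N"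
  shows "exec x ((steps p + 7) * S) s (For i e p) (\<lambda>s'. I N s' \<and> fst s' (i, 0, 0) = N)"
proof (rule exec_For[where I = I and N = N])
  fix k s assume *: "k < N" "I k s" "fst s (i, 0, 0) = k"
  show "exec x (steps p) s p (\<lambda>s'. I (Suc k) s' \<and> fst s' (i, 0, 0) = k)"
    by (rule exec_mono[OF exec_straight[OF assms(1)] order_refl]) (use body[OF *] in simp)
qed (use assms in auto)

text \<open>A frame condition: \<open>X\<close> and \<open>Y\<close> list the natural and the real
  arrays that may have been written.\<close>

definition same :: "nat set \<Rightarrow> nat set \<Rightarrow> store \<Rightarrow> store \<Rightarrow> bool" where
  "same X Y s0 s \<longleftrightarrow> (\<forall>n i j. n \<notin> X \<longrightarrow> fst s (n, i, j) = fst s0 (n, i, j)) \<and>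
     (\<forall>n i j. n \<notin> Y \<longrightarrow> snd s (n, i, j) = snd s0 (n, i, j))"

lemma same_refl [simp]: "same X Y s s"
  by (simp add: same_def)

lemma same_trans:
  assumes "same X Y s0 s1" "same X' Y' s1 s2" "X \<union> X' \<subseteq> X''" "Y \<union> Y' \<subseteq> Y''"
  shows "same X'' Y'' s0 s2"
proof -
  have "n \<notin> X \<and> n \<notin> X'" if "n \<notin> X''" for n using assms(3) that by blast
  moreover have "n \<notin> Y \<and> n \<notin> Y'" if "n \<notin> Y''" for n using assms(4) that by blast
  ultimately show ?thesis using assms(1,2) by (simp add: same_def)
qed

lemma same_upd:
  assumes "i \<in> X" shows "same X Y s0 (f((i, a, b) := v), g) \<longleftrightarrow> same X Y s0 (f, g)"
proof -
  have "(f((i, a, b) := v)) (n, a', b') = f (n, a', b')" if "n \<notin> X" for n a' b'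
    using assms that by auto
  then show ?thesis by (simp add: same_def del: fun_upd_apply)
qed

lemma same_upd_real:
  assumes "i \<in> Y" shows "same X Y s0 (f, g((i, a, b) := v)) \<longleftrightarrow> same X Y s0 (f, g)"
proof -
  have "(g((i, a, b) := v)) (n, a', b') = g (n, a', b')" if "n \<notin> Y" for n a' b'
    using assms that by auto
  then show ?thesis by (simp add: same_def del: fun_upd_apply)
qed

lemma same_fst: "same X Y s0 s \<Longrightarrow> n \<notin> X \<Longrightarrow> fst s (n, i, j) = fst s0 (n, i, j)"
  and same_snd: "same X Y s0 s \<Longrightarrow> n \<notin> Y \<Longrightarrow> snd s (n, i, j) = snd s0 (n, i, j)"
  by (auto simp: same_def)

section \<open>The program and its subprograms\<close>

abbreviation (input) "V n \<equiv> NMem n (NConst 0) (NConst 0)"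
abbreviation (input) "Arr n e \<equiv> NMem n e (NConst 0)"
abbreviation (input) "Pos e \<equiv> NLess (NConst 0) e"
abbreviation (input) "SetV n e \<equiv> NAssign n (NConst 0) (NConst 0) e"
abbreviation (input) "SetArr n i e \<equiv> NAssign n i (NConst 0) e"

text \<open>
  Natural memory: 0 output, 1 active, 2 pending, 3 covered, 4 layer, 5 successor of the previous
  context, 6 context, 7 round, 8 and 9 loop counters, 10 flag, 11 observation counts, 12 and 13
  degrees, 14 the vertex \<open>bare\<close>. Real memory: 0 threshold, 1 reward sums, 2 difference of means.
\<close>

definition com_threshold :: com where
  "com_threshold = For 8 (NAdd (NAdd NumActions NumContexts) Horizon)
     (RAssign 0 (NConst 0) (NConst 0) (RAdd (RMem 0 (NConst 0) (NConst 0))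
        (RDiv (OfNat (NConst 12)) (OfNat (NAdd (V 8) (NConst 1))))))"

definition com_reset :: com where
  "com_reset = For 8 NumActions (Seq (SetArr 1 (V 8) (NConst 1)) (SetArr 2 (V 8) (NConst 0)))"

definition com_flag :: com where
  "com_flag = Seq (SetV 10 (NConst 0))
     (For 8 NumActions (Cond (Pos (Arr 2 (V 8))) (SetV 10 (NConst 1)) Skip))"

definition com_stats :: com where
  "com_stats = For 8 NumActions
     (Seq (Seq (SetArr 11 (V 8) (NConst 0)) (RAssign 1 (V 8) (NConst 0) (OfNat (NConst 0))))
       (For 9 (V 7)
         (Seq (SetArr 11 (V 8) (NAdd (Arr 11 (V 8)) (Edge (PastAction (V 9)) (V 8))))
              (RAssign 1 (V 8) (NConst 0)
                 (RAdd (RMem 1 (V 8) (NConst 0)) (Observed (V 9) (V 6) (V 8)))))))"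

abbreviation (input) "Diff \<equiv> RMem 2 (NConst 0) (NConst 0)"
abbreviation (input) "Mean e \<equiv> RDiv (RMem 1 e (NConst 0)) (OfNat (Arr 11 e))"
abbreviation (input) "Far e \<equiv>
  RLess (RMem 0 (NConst 0) (NConst 0)) (RMul (RMul Diff Diff) (OfNat (Arr 11 e)))"

definition com_eliminate :: com where
  "com_eliminate = For 8 NumActions (For 9 NumActions
     (Seq (RAssign 2 (NConst 0) (NConst 0) (RSub (Mean (V 9)) (Mean (V 8))))
       (Cond (Conj (RLess (OfNat (NConst 0)) Diff) (Conj (Far (V 8)) (Far (V 9))))
          (SetArr 1 (V 8) (NConst 0)) Skip)))"

abbreviation (input) "Open l e \<equiv> Conj (Pos (Arr 1 e)) (Neg (Pos (NMem 3 l e)))"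

text \<open>The outer loop counts \<open>j\<close> upwards and overwrites the result with
  \<open>t - j\<close>, so the least exposed layer remains, as in \<open>layer_of\<close>; the
  initial value is the default there.\<close>

definition com_layer :: com where
  "com_layer = Seq (SetV 4 (V 7))
     (For 8 (NAdd (V 7) (NConst 1)) (For 9 NumActions
       (Cond (Open (NSub (V 7) (V 8)) (V 9)) (SetV 4 (NSub (V 7) (V 8))) Skip)))"

definition com_pending :: com where
  "com_pending = For 8 NumActions
     (Cond (Conj (Open (V 4) (V 8)) (Pos (Edge (V 8) (V 8))))
        (SetArr 2 (V 8) (NConst 1)) (SetArr 2 (V 8) (NConst 0)))"

text \<open>Cell 5 holds the successor of the last context, so that its initial \<open>0\<close>
  means that there was none. Equality takes two negated comparisons, as \<open><\<close> is the only
  test on naturals.\<close>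

definition com_prep :: com where
  "com_prep = Seq (Cond (Conj (Neg (NLess (V 5) (NAdd (V 6) (NConst 1)))) (Neg (NLess (NAdd (V 6) (NConst 1)) (V 5))))
       Skip com_reset)
     (Seq (SetV 5 (NAdd (V 6) (NConst 1)))
     (Seq com_flag
       (Cond (Pos (V 10)) Skip (Seq com_stats (Seq com_eliminate (Seq com_layer com_pending))))))"

definition com_post :: com where
  "com_post = For 8 NumActions
     (Seq (Cond (Conj (Neg (Pos (Edge (V 8) (PastAction (V 7))))) (Conj (Neg (Pos (Edge (PastAction (V 7)) (V 8))))
                  (Neg (Conj (Neg (NLess (V 8) (PastAction (V 7)))) (Neg (NLess (PastAction (V 7)) (V 8)))))))
             Skip (SetArr 2 (V 8) (NConst 0)))
          (Cond (Pos (Edge (PastAction (V 7)) (V 8))) (NAssign 3 (V 4) (V 8) (NConst 1)) Skip))"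

definition com_balanced :: com where
  "com_balanced = For 8 NumActions
     (Seq (Seq (SetV 12 (NConst 0)) (SetV 13 (NConst 0)))
     (Seq (For 9 NumActions (Cond (Pos (Arr 2 (V 9)))
            (Seq (SetV 12 (NAdd (V 12) (Edge (V 9) (V 8)))) (SetV 13 (NAdd (V 13) (Edge (V 8) (V 9))))) Skip))
          (Cond (Conj (Pos (Arr 2 (V 8))) (Neg (NLess (V 13) (V 12)))) (SetV 0 (V 8)) Skip)))"

definition com_bare :: com where
  "com_bare = Seq (SetV 14 (NConst 0))
     (Seq (For 8 NumActions (Cond (Open (V 4) (V 8)) (SetV 14 (V 8)) Skip))
     (Seq (SetV 0 (V 14))
       (For 8 NumActions (Cond (Conj (Pos (Arr 1 (V 8))) (Neg (Conj (Neg (NLess (V 8) (V 14))) (Neg (NLess (V 14) (V 8))))))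
          (SetV 0 (V 8)) Skip))))"

definition com_next :: com where
  "com_next = Seq (SetV 0 (NConst 0)) (Seq com_flag (Cond (Pos (V 10)) com_balanced com_bare))"

text \<open>Memory is empty at the start of each call, so all past rounds are replayed before the
  current one; their actions are read from the input instead of being recomputed.\<close>

definition com_main :: com where
  "com_main = Seq com_threshold
     (Seq (For 7 Round (Seq (SetV 6 (PastContext (V 7))) (Seq com_prep com_post)))
     (Seq (SetV 6 CurrentContext) (Seq com_prep com_next)))"

section \<open>Correctness and running time\<close>

locale program_run =
  fixes x :: input and S :: nat
  assumes K_le: "num_actions x \<le> S" and R_le: "Suc (length (past x)) \<le> S"
    and S_ge: "num_actions x + num_contexts x + total_rounds x \<le> S"
begin

abbreviation "K \<equiv> num_actions x"
abbreviation "G \<equiv> graph x"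
abbreviation "pact u \<equiv> fst (snd (past x ! u))"
abbreviation "prew u \<equiv> snd (snd (past x ! u))"

lemma S1: "1 \<le> S" using R_le by simp

lemma S_le_S2: "S \<le> S\<^sup>2" "1 \<le> S\<^sup>2"
  using S1 by (auto simp: power2_eq_square)

lemma exec_threshold:
  assumes "snd s0 (0, 0, 0) = 0"
  shows "exec x (8 * S) s0 com_threshold (\<lambda>s. same {8} {0} s0 s \<and>
    snd s (0, 0, 0) = 12 * harm (K + num_contexts x + total_rounds x))"
  unfolding com_threshold_def
proof (rule exec_mono, rule exec_For_straight[where N = "K + num_contexts x + total_rounds x" and S = S and
      I = "\<lambda>k s. same {8} {0} s0 s \<and> snd s (0, 0, 0) = 12 * harm k"])
  fix k s assume s: "same {8} {0} s0 s \<and> snd s (0, 0, 0) = 12 * harm k" "fst s (8, 0, 0) = k"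
  then show "(same {8} {0} s0 (effect x (RAssign 0 (NConst 0) (NConst 0) (RAdd (RMem 0 (NConst 0) (NConst 0))
        (RDiv (OfNat (NConst 12)) (OfNat (NAdd (V 8) (NConst 1)))))) s) \<and>
      snd (effect x (RAssign 0 (NConst 0) (NConst 0) (RAdd (RMem 0 (NConst 0) (NConst 0))
        (RDiv (OfNat (NConst 12)) (OfNat (NAdd (V 8) (NConst 1)))))) s) (0, 0, 0) = 12 * harm (Suc k)) \<and>
      fst (effect x (RAssign 0 (NConst 0) (NConst 0) (RAdd (RMem 0 (NConst 0) (NConst 0))
        (RDiv (OfNat (NConst 12)) (OfNat (NAdd (V 8) (NConst 1)))))) s) (8, 0, 0) = k"
    by (simp add: rstore_def same_upd_real harm_Suc field_simps)
qed (use assms S_ge S1 in \<open>auto simp: harm_def same_upd\<close>)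

lemma exec_reset:
  "exec x (10 * S) s0 com_reset (\<lambda>s. same {1, 2, 8} {} s0 s \<and>
     (\<forall>a<K. fst s (1, a, 0) = 1 \<and> fst s (2, a, 0) = 0))"
  unfolding com_reset_def
  by (rule exec_mono, rule exec_For_straight[where N = K and S = S and
      I = "\<lambda>k s. same {1, 2, 8} {} s0 s \<and> (\<forall>a<k. fst s (1, a, 0) = 1 \<and> fst s (2, a, 0) = 0)"])
     (use K_le S1 in \<open>auto simp: same_upd nstore_def less_Suc_eq\<close>)

lemma exec_flag:
  "exec x (12 * S) s0 com_flag (\<lambda>s. same {8, 10} {} s0 s \<and>
     fst s (10, 0, 0) = of_bool (\<exists>a<K. 0 < fst s0 (2, a, 0)))"
proof -
  have "exec x (1 + (2 + 7) * S + 1) s0 com_flag (\<lambda>s. same {8, 10} {} s0 s \<and>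
     fst s (10, 0, 0) = of_bool (\<exists>a<K. 0 < fst s0 (2, a, 0)))"
    unfolding com_flag_def
  proof (rule exec_Seq[where R = "\<lambda>s. same {10} {} s0 s \<and> fst s (10, 0, 0) = 0"])
    show "exec x 1 s0 (SetV 10 (NConst 0)) (\<lambda>s. same {10} {} s0 s \<and> fst s (10, 0, 0) = 0)"
      by (rule exec_mono, rule exec_straight) (auto simp: nstore_def same_upd)
    fix s1 assume s1: "same {10} {} s0 s1 \<and> fst s1 (10, 0, 0) = 0"
    show "exec x ((2 + 7) * S) s1 (For 8 NumActions (Cond (Pos (Arr 2 (V 8))) (SetV 10 (NConst 1)) Skip))
      (\<lambda>s. same {8, 10} {} s0 s \<and> fst s (10, 0, 0) = of_bool (\<exists>a<K. 0 < fst s0 (2, a, 0)))"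
      by (rule exec_mono, rule exec_For_straight[where N = K and S = S and I = "\<lambda>k s. same {8, 10} {} s0 s \<and>
          fst s (10, 0, 0) = of_bool (\<exists>a<k. 0 < fst s0 (2, a, 0))"])
         (use s1 K_le S1 in \<open>auto simp: same_def nstore_def less_Suc_eq\<close>)
  qed
  then show ?thesis by (rule exec_mono) (use S1 in auto)
qed

lemma exec_stats:
  assumes t: "fst s0 (7, 0, 0) = t" "t \<le> length (past x)"
  shows "exec x (40 * S\<^sup>2) s0 com_stats (\<lambda>s. same {8, 9, 11} {1} s0 s \<and>
     (\<forall>a<K. fst s (11, a, 0) = obs_count G pact t a \<and>
        snd s (1, a, 0) = (\<Sum>u<t. prew u (fst s0 (6, 0, 0), a))))"
proof -
  let ?I = "\<lambda>k s. same {8, 9, 11} {1} s0 s \<and> (\<forall>a<k. fst s (11, a, 0) = obs_count G pact t a \<and>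
        snd s (1, a, 0) = (\<Sum>u<t. prew u (fst s0 (6, 0, 0), a)))"
  let ?init = "Seq (SetArr 11 (V 8) (NConst 0)) (RAssign 1 (V 8) (NConst 0) (OfNat (NConst 0)))"
  let ?body = "Seq (SetArr 11 (V 8) (NAdd (Arr 11 (V 8)) (Edge (PastAction (V 9)) (V 8))))
              (RAssign 1 (V 8) (NConst 0) (RAdd (RMem 1 (V 8) (NConst 0)) (Observed (V 9) (V 6) (V 8))))"
  have "exec x ((3 + (3 + 7) * S + 1 + 7) * S) s0 com_stats (\<lambda>s. ?I K s \<and> fst s (8, 0, 0) = K)"
    unfolding com_stats_def
  proof (rule exec_For[where I = ?I and N = "K"])
    fix k s assume k: "k < K" and s: "?I k s" "fst s (8, 0, 0) = k"
    let ?J = "\<lambda>m s. ?I k s \<and> fst s (8, 0, 0) = k \<and> fst s (11, k, 0) = obs_count G pact m k \<and>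
        snd s (1, k, 0) = (\<Sum>u<m. prew u (fst s0 (6, 0, 0), k))"
    show "exec x (3 + (3 + 7) * S + 1) s (Seq ?init (For 9 (V 7) ?body)) (\<lambda>s'. ?I (Suc k) s' \<and> fst s' (8, 0, 0) = k)"
    proof (rule exec_Seq)
      show "exec x 3 s ?init (?J 0)"
        by (rule exec_mono, rule exec_straight)
           (use s in \<open>auto simp: same_upd same_upd_real nstore_def rstore_def obs_count_def\<close>)
      fix s1 assume s1: "?J 0 s1"
      show "exec x ((3 + 7) * S) s1 (For 9 (V 7) ?body) (\<lambda>s'. ?I (Suc k) s' \<and> fst s' (8, 0, 0) = k)"
      proof (rule exec_mono, rule exec_For_straight[where N = t and S = S and I = ?J])
        show "?J (Suc m) (effect x ?body s) \<and> fst (effect x ?body s) (9, 0, 0) = m"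
          if "m < t" "?J m s" "fst s (9, 0, 0) = m" for m s
          using that t by (auto simp: same_upd same_upd_real nstore_def rstore_def obs_count_def same_fst[of _ _ s0])
      qed (use s1 t R_le S1 in \<open>auto simp: same_def less_Suc_eq\<close>)
    qed
  qed (use K_le S1 in \<open>auto simp: same_upd\<close>)
  moreover have "(3 + (3 + 7) * S + 1 + 7) * S \<le> 40 * S\<^sup>2"
    using S1 by (auto simp: power2_eq_square algebra_simps)
  ultimately show ?thesis by (rule exec_mono) auto
qed

text \<open>The test compares with all actions below \<open>K\<close>, also with those already
  struck out, and never reads array 1; hence overwriting that array during the loop does not disturb
  it.\<close>

lemma exec_eliminate:
  assumes A: "\<And>a. a < K \<Longrightarrow> fst s0 (1, a, 0) = of_bool (a \<in> A)"
    and st: "\<And>a. a < K \<Longrightarrow> fst s0 (11, a, 0) = n a" "\<And>a. a < K \<Longrightarrow> snd s0 (1, a, 0) = Sm a"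
    and L: "snd s0 (0, 0, 0) = L"
  shows "exec x (40 * S\<^sup>2) s0 com_eliminate (\<lambda>s. same {1, 8, 9} {2} s0 s \<and>
     (\<forall>a<K. fst s (1, a, 0) = of_bool (a \<in> A \<inter> survivors L K n Sm)))"
proof -
  let ?I = "\<lambda>k s. same {1, 8, 9} {2} s0 s \<and>
     (\<forall>a<K. fst s (1, a, 0) = of_bool (a \<in> A \<and> (a < k \<longrightarrow> (\<forall>b<K. \<not> beaten L K n Sm a b))))"
  let ?body = "Seq (RAssign 2 (NConst 0) (NConst 0) (RSub (Mean (V 9)) (Mean (V 8))))
       (Cond (Conj (RLess (OfNat (NConst 0)) Diff) (Conj (Far (V 8)) (Far (V 9))))
          (SetArr 1 (V 8) (NConst 0)) Skip)"
  have "exec x (((4 + 7) * S + 7) * S) s0 com_eliminate (\<lambda>s. ?I K s \<and> fst s (8, 0, 0) = K)"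
    unfolding com_eliminate_def
  proof (rule exec_For[where I = ?I and N = "K"])
    fix k s assume k: "k < K" and s: "?I k s" "fst s (8, 0, 0) = k"
    let ?J = "\<lambda>m s. same {1, 8, 9} {2} s0 s \<and> fst s (8, 0, 0) = k \<and>
      (\<forall>a<K. fst s (1, a, 0) = of_bool (a \<in> A \<and> (a < k \<longrightarrow> (\<forall>b<K. \<not> beaten L K n Sm a b)) \<and>
        (a = k \<longrightarrow> (\<forall>b<m. \<not> beaten L K n Sm a b))))"
    show "exec x ((4 + 7) * S) s (For 9 NumActions ?body) (\<lambda>s'. ?I (Suc k) s' \<and> fst s' (8, 0, 0) = k)"
    proof (rule exec_mono, rule exec_For_straight[where N = K and S = S and I = ?J])
      show "?J (Suc m) (effect x ?body s) \<and> fst (effect x ?body s) (9, 0, 0) = m"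
        if m: "m < K" "?J m s" "fst s (9, 0, 0) = m" for m s
      proof -
        let ?s1 = "effect x (RAssign 2 (NConst 0) (NConst 0) (RSub (Mean (V 9)) (Mean (V 8)))) s"
        have test: "beval x ?s1 (Conj (RLess (OfNat (NConst 0)) Diff) (Conj (Far (V 8)) (Far (V 9)))) \<longleftrightarrow>
            beaten L K n Sm k m"
          using m k st L by (auto simp: rstore_def same_fst[of _ _ s0] same_snd[of _ _ s0] beaten_def Let_def)
        define g where "g = snd ?s1"
        have s1: "?s1 = (fst s, g)" by (simp add: rstore_def g_def)
        have sm: "same {1, 8, 9} {2} s0 (fst s, g)"
          using m by (simp add: same_upd_real rstore_def g_def)
        have "effect x ?body s =
            (if beaten L K n Sm k m then effect x (SetArr 1 (V 8) (NConst 0)) ?s1 else ?s1)"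
          using test by simp
        then have eff: "effect x ?body s =
            (if beaten L K n Sm k m then ((fst s)((1, k, 0) := 0), g) else (fst s, g))"
          using m unfolding s1 by (simp add: nstore_def)
        show ?thesis
          unfolding eff using m sm k by (auto simp: same_upd less_Suc_eq)
      qed
    qed (use s k K_le S1 in \<open>auto simp: same_upd less_Suc_eq\<close>)
  qed (use K_le S1 A in \<open>auto simp: same_upd\<close>)
  moreover have "((4 + 7) * S + 7) * S \<le> 40 * S\<^sup>2"
    using S1 by (auto simp: power2_eq_square algebra_simps)
  ultimately show ?thesis by (rule exec_mono) (auto simp: survivors_def)
qed

lemma exec_layer:
  assumes t: "fst s0 (7, 0, 0) = t" "t \<le> length (past x)"
    and A: "\<And>a. a < K \<Longrightarrow> fst s0 (1, a, 0) = of_bool (a \<in> A)" "A \<subseteq> {..<K}"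
    and C: "\<And>l a. a < K \<Longrightarrow> fst s0 (3, l, a) = of_bool (a \<in> C l)"
  shows "exec x (40 * S\<^sup>2) s0 com_layer (\<lambda>s. same {4, 8, 9} {} s0 s \<and> fst s (4, 0, 0) = layer_of t A C)"
proof -
  let ?P = "\<lambda>j. \<not> A \<subseteq> C (t - j)"
  let ?I = "\<lambda>k s. same {4, 8, 9} {} s0 s \<and> fst s (4, 0, 0) = t - last_such ?P k"
  let ?body = "Cond (Open (NSub (V 7) (V 8)) (V 9)) (SetV 4 (NSub (V 7) (V 8))) Skip"
  have "exec x (1 + ((2 + 7) * S + 7) * S + 1) s0 com_layer
    (\<lambda>s. ?I (Suc t) s \<and> fst s (8, 0, 0) = Suc t)"
    unfolding com_layer_def
  proof (rule exec_Seq[where R = "?I 0"])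
    show "exec x 1 s0 (SetV 4 (V 7)) (?I 0)"
      by (rule exec_mono, rule exec_straight) (use t in \<open>auto simp: nstore_def same_upd\<close>)
    fix s1 assume s1: "?I 0 s1"
    show "exec x (((2 + 7) * S + 7) * S) s1 (For 8 (NAdd (V 7) (NConst 1)) (For 9 NumActions ?body))
      (\<lambda>s. ?I (Suc t) s \<and> fst s (8, 0, 0) = Suc t)"
    \<comment> \<open>Layers \<open>0\<close> to \<open>t\<close> are scanned, one more than the
      rounds played; this is why \<open>S\<close> has to bound
      \<open>Suc (length (past x))\<close>.\<close>
    proof (rule exec_For[where I = ?I and N = "Suc t"])
      fix k s assume k: "k < Suc t" and s: "?I k s" "fst s (8, 0, 0) = k"
      let ?J = "\<lambda>m s. same {4, 8, 9} {} s0 s \<and> fst s (8, 0, 0) = k \<and>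
        fst s (4, 0, 0) = (if \<exists>a<m. a \<in> A \<and> a \<notin> C (t - k) then t - k else t - last_such ?P k)"
      show "exec x ((2 + 7) * S) s (For 9 NumActions ?body) (\<lambda>s'. ?I (Suc k) s' \<and> fst s' (8, 0, 0) = k)"
      proof (rule exec_mono, rule exec_For_straight[where N = K and S = S and I = ?J])
        show "?J (Suc m) (effect x ?body s) \<and> fst (effect x ?body s) (9, 0, 0) = m"
          if "m < K" "?J m s" "fst s (9, 0, 0) = m" for m s
          using that t A C by (auto simp: nstore_def same_upd less_Suc_eq same_fst[of _ _ s0])
        have "(\<exists>a<K. a \<in> A \<and> a \<notin> C (t - k)) \<longleftrightarrow> \<not> A \<subseteq> C (t - k)" using A(2) by blast
        then show "?I (Suc k) s' \<and> fst s' (8, 0, 0) = k" if "?J K s' \<and> fst s' (9, 0, 0) = K" for s'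
          using that by simp
      qed (use s K_le S1 in \<open>auto simp: same_upd\<close>)
    qed (use s1 t R_le S1 in \<open>auto simp: same_def\<close>)
  qed
  moreover have "1 + ((2 + 7) * S + 7) * S + 1 \<le> 40 * S\<^sup>2"
  proof -
    have "((2 + 7) * S + 7) * S = 9 * S\<^sup>2 + 7 * S" by (simp add: power2_eq_square algebra_simps)
    then show ?thesis using S_le_S2 by linarith
  qed
  ultimately show ?thesis by (rule exec_mono) (auto simp: layer_of_def simp del: last_such.simps)
qed

lemma exec_pending:
  assumes l: "fst s0 (4, 0, 0) = l"
    and A: "\<And>a. a < K \<Longrightarrow> fst s0 (1, a, 0) = of_bool (a \<in> A)"
    and C: "\<And>l a. a < K \<Longrightarrow> fst s0 (3, l, a) = of_bool (a \<in> C l)"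
  shows "exec x (10 * S) s0 com_pending (\<lambda>s. same {2, 8} {} s0 s \<and>
    (\<forall>a<K. fst s (2, a, 0) = of_bool (a \<in> A \<and> a \<notin> C l \<and> (a, a) \<in> G)))"
  unfolding com_pending_def
  by (rule exec_mono, rule exec_For_straight[where N = K and S = S and
      I = "\<lambda>k s. same {2, 8} {} s0 s \<and> (\<forall>a<k. fst s (2, a, 0) = of_bool (a \<in> A \<and> a \<notin> C l \<and> (a, a) \<in> G))"])
     (use assms K_le S1 in \<open>auto simp: same_def nstore_def less_Suc_eq\<close>)

text \<open>The inclusions in \<open>{..<K}\<close> let a loop over the actions decide whether
  \<open>pending\<close> is empty. No bound on the layers is imposed: untouched memory is
  \<open>0\<close>, and untouched layers are empty.\<close>

definition rep :: "store \<Rightarrow> sim \<Rightarrow> bool" where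
  "rep s \<sigma> \<longleftrightarrow> active \<sigma> \<subseteq> {..<K} \<and> pending \<sigma> \<subseteq> {..<K} \<and>
     (\<forall>a<K. fst s (1, a, 0) = of_bool (a \<in> active \<sigma>)) \<and>
     (\<forall>a<K. fst s (2, a, 0) = of_bool (a \<in> pending \<sigma>)) \<and>
     (\<forall>l. \<forall>a<K. fst s (3, l, a) = of_bool (a \<in> covered \<sigma> l)) \<and> fst s (4, 0, 0) = layer \<sigma>"

lemma rep_same: "rep s \<sigma> \<Longrightarrow> same X Y s s' \<Longrightarrow> X \<inter> {1, 2, 3, 4} = {} \<Longrightarrow> rep s' \<sigma>"
  by (auto simp: rep_def same_def)

lemma exec_refresh:
  assumes rep: "rep s0 \<sigma>" and s0: "fst s0 (7, 0, 0) = t" "t \<le> length (past x)" "fst s0 (6, 0, 0) = c"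
      "snd s0 (0, 0, 0) = L"
  defines "A \<equiv> active \<sigma> \<inter> survivors L K (obs_count G pact t) (\<lambda>a. \<Sum>u<t. prew u (c, a))"
  defines "l \<equiv> layer_of t A (covered \<sigma>)"
  defines "W \<equiv> {a\<in>A. a \<notin> covered \<sigma> l \<and> (a, a) \<in> G}"
  shows "exec x (150 * S\<^sup>2) s0 (Seq com_stats (Seq com_eliminate (Seq com_layer com_pending)))
    (\<lambda>s. rep s \<lparr>active = A, pending = W, origin = W, layer = l, covered = covered \<sigma>\<rparr> \<and>
       same {1, 2, 4, 8, 9, 11} {1, 2} s0 s)"
proof -
  have K: "A \<subseteq> {..<K}" "W \<subseteq> {..<K}" using rep by (auto simp: A_def W_def rep_def)
  let ?n = "obs_count G pact t" and ?Sm = "\<lambda>a. \<Sum>u<t. prew u (c, a)"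
  have "exec x (40 * S\<^sup>2 + (40 * S\<^sup>2 + (40 * S\<^sup>2 + 10 * S + 1) + 1) + 1) s0
      (Seq com_stats (Seq com_eliminate (Seq com_layer com_pending)))
    (\<lambda>s. rep s \<lparr>active = A, pending = W, origin = W, layer = l, covered = covered \<sigma>\<rparr> \<and>
       same {1, 2, 4, 8, 9, 11} {1, 2} s0 s)"
  proof (rule exec_Seq[OF exec_stats[OF s0(1,2)]])
    fix s1 assume s1: "same {8, 9, 11} {1} s0 s1 \<and> (\<forall>a<K. fst s1 (11, a, 0) = ?n a \<and>
        snd s1 (1, a, 0) = (\<Sum>u<t. prew u (fst s0 (6, 0, 0), a)))"
    show "exec x (40 * S\<^sup>2 + (40 * S\<^sup>2 + 10 * S + 1) + 1) s1 (Seq com_eliminate (Seq com_layer com_pending))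
      (\<lambda>s. rep s \<lparr>active = A, pending = W, origin = W, layer = l, covered = covered \<sigma>\<rparr> \<and>
       same {1, 2, 4, 8, 9, 11} {1, 2} s0 s)"
    proof (rule exec_Seq[OF exec_eliminate[where A = "active \<sigma>" and n = ?n and Sm = ?Sm and L = L]])
      fix s2 assume s2: "same {1, 8, 9} {2} s1 s2 \<and>
        (\<forall>a<K. fst s2 (1, a, 0) = of_bool (a \<in> active \<sigma> \<inter> survivors L K ?n ?Sm))"
      have same02: "same {1, 8, 9, 11} {1, 2} s0 s2"
        by (rule same_trans[OF conjunct1[OF s1] conjunct1[OF s2]]) auto
      show "exec x (40 * S\<^sup>2 + 10 * S + 1) s2 (Seq com_layer com_pending)
        (\<lambda>s. rep s \<lparr>active = A, pending = W, origin = W, layer = l, covered = covered \<sigma>\<rparr> \<and>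
         same {1, 2, 4, 8, 9, 11} {1, 2} s0 s)"
      proof (rule exec_Seq[OF exec_layer[where t = t and A = A and C = "covered \<sigma>"]])
        fix s3 assume s3: "same {4, 8, 9} {} s2 s3 \<and> fst s3 (4, 0, 0) = layer_of t A (covered \<sigma>)"
        have same03: "same {1, 4, 8, 9, 11} {1, 2} s0 s3"
          by (rule same_trans[OF same02 conjunct1[OF s3]]) auto
        have A3: "fst s3 (1, a, 0) = of_bool (a \<in> A)" if "a < K" for a
          using s2 s3 that by (auto simp: same_fst[of _ _ s2] A_def)
        have C3: "fst s3 (3, l, a) = of_bool (a \<in> covered \<sigma> l)" if "a < K" for l a
          using rep that by (auto simp: same_fst[OF same03] rep_def)
        show "exec x (10 * S) s3 com_pending
          (\<lambda>s. rep s \<lparr>active = A, pending = W, origin = W, layer = l, covered = covered \<sigma>\<rparr> \<and>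
           same {1, 2, 4, 8, 9, 11} {1, 2} s0 s)"
        proof (rule exec_mono[OF exec_pending[where A = A and C = "covered \<sigma>" and l = l]])
          fix s4 assume s4: "same {2, 8} {} s3 s4 \<and>
            (\<forall>a<K. fst s4 (2, a, 0) = of_bool (a \<in> A \<and> a \<notin> covered \<sigma> l \<and> (a, a) \<in> G))"
          then have "rep s4 \<lparr>active = A, pending = W, origin = W, layer = l, covered = covered \<sigma>\<rparr>"
            using A3 C3 s3 K by (auto simp: rep_def same_fst[of _ _ s3] W_def l_def)
          moreover have "same {1, 2, 4, 8, 9, 11} {1, 2} s0 s4"
            by (rule same_trans[OF same03 conjunct1[OF s4]]) auto
          ultimately show "rep s4 \<lparr>active = A, pending = W, origin = W, layer = l, covered = covered \<sigma>\<rparr> \<and>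
            same {1, 2, 4, 8, 9, 11} {1, 2} s0 s4" by blast
        qed (use s3 A3 C3 in \<open>auto simp: l_def\<close>)
      qed (use s0 s2 K same02 rep in \<open>auto simp: same_fst[OF same02] A_def rep_def\<close>)
    qed (use s0 s1 rep in \<open>auto simp: same_fst[of _ _ s0] same_snd[of _ _ s0] rep_def\<close>)
  qed
  then show ?thesis by (rule exec_mono) (use S_le_S2 in auto)
qed

lemma exec_prep:
  assumes rep: "rep s0 \<sigma>" and s0: "fst s0 (7, 0, 0) = t" "t \<le> length (past x)" "fst s0 (6, 0, 0) = c"
      "snd s0 (0, 0, 0) = L" "fst s0 (5, 0, 0) = pv"
  defines "Y \<equiv> survivors L K (obs_count G pact t) (\<lambda>a. \<Sum>u<t. prew u (c, a))"
  shows "exec x (200 * S\<^sup>2) s0 com_prep (\<lambda>s. rep s (prep K G t (pv \<noteq> Suc c) Y \<sigma>) \<and>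
    fst s (7, 0, 0) = t \<and> fst s (5, 0, 0) = Suc c \<and> snd s (0, 0, 0) = L)" (is "exec _ _ _ _ ?Q")
proof -
  let ?b = "Conj (Neg (NLess (V 5) (NAdd (V 6) (NConst 1)))) (Neg (NLess (NAdd (V 6) (NConst 1)) (V 5)))"
  \<comment> \<open>A new context is treated as a reset that empties \<open>pending\<close>; after
    it, emptiness of \<open>pending\<close> alone decides whether an epoch starts.\<close>
  define \<sigma>1 where "\<sigma>1 = (if pv \<noteq> Suc c then \<sigma>\<lparr>active := {..<K}, pending := {}\<rparr> else \<sigma>)"
  have "exec x ((10 * S + 1) + (1 + (12 * S + (150 * S\<^sup>2 + 1) + 1) + 1) + 1) s0 com_prep ?Q"
    unfolding com_prep_def
  proof (rule exec_Seq[where R = "\<lambda>s. rep s \<sigma>1 \<and> same {1, 2, 8} {} s0 s"])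
    have b: "beval x s0 ?b \<longleftrightarrow> pv = Suc c" using s0 by auto
    show "exec x (10 * S + 1) s0 (Cond ?b Skip com_reset) (\<lambda>s. rep s \<sigma>1 \<and> same {1, 2, 8} {} s0 s)"
    proof (rule exec_Cond)
      assume "beval x s0 ?b"
      with b rep show "exec x (10 * S) s0 Skip (\<lambda>s. rep s \<sigma>1 \<and> same {1, 2, 8} {} s0 s)"
        unfolding exec_def by (intro exI[of _ 0] exI[of _ s0]) (simp add: \<sigma>1_def)
    next
      assume "\<not> beval x s0 ?b"
      with b rep show "exec x (10 * S) s0 com_reset (\<lambda>s. rep s \<sigma>1 \<and> same {1, 2, 8} {} s0 s)"
        by (intro exec_mono[OF exec_reset order_refl])
           (auto simp: \<sigma>1_def rep_def same_def)
    qed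
    fix s1 assume s1: "rep s1 \<sigma>1 \<and> same {1, 2, 8} {} s0 s1"
    show "exec x (1 + (12 * S + (150 * S\<^sup>2 + 1) + 1) + 1) s1 (Seq (SetV 5 (NAdd (V 6) (NConst 1)))
     (Seq com_flag (Cond (Pos (V 10)) Skip (Seq com_stats (Seq com_eliminate (Seq com_layer com_pending)))))) ?Q"
    proof (rule exec_Seq[where R = "\<lambda>s. rep s \<sigma>1 \<and> same {1, 2, 5, 8} {} s0 s \<and> fst s (5, 0, 0) = Suc c"])
      have "same {1, 2, 5, 8} {} s0 s1" using s1 by (auto simp: same_def)
      moreover have "fst s1 (6, 0, 0) = c" using s1 s0 by (auto simp: same_fst[of _ _ s0])
      moreover have "rep ((fst s1)((5, 0, 0) := v), snd s1) \<sigma>1" for v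
        using s1 by (auto simp: rep_def)
      ultimately show "exec x 1 s1 (SetV 5 (NAdd (V 6) (NConst 1)))
          (\<lambda>s. rep s \<sigma>1 \<and> same {1, 2, 5, 8} {} s0 s \<and> fst s (5, 0, 0) = Suc c)"
        by (intro exec_mono[OF exec_straight]) (auto simp: nstore_def same_upd)
      fix s2 assume s2: "rep s2 \<sigma>1 \<and> same {1, 2, 5, 8} {} s0 s2 \<and> fst s2 (5, 0, 0) = Suc c"
      show "exec x (12 * S + (150 * S\<^sup>2 + 1) + 1) s2
        (Seq com_flag (Cond (Pos (V 10)) Skip (Seq com_stats (Seq com_eliminate (Seq com_layer com_pending))))) ?Q"
      proof (rule exec_Seq[OF exec_flag])
        fix s3 assume s3: "same {8, 10} {} s2 s3 \<and> fst s3 (10, 0, 0) = of_bool (\<exists>a<K. 0 < fst s2 (2, a, 0))"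
        then have rep3: "rep s3 \<sigma>1" using s2 rep_same[of s2 \<sigma>1 "{8, 10}" "{}" s3] by auto
        have "(\<exists>a<K. 0 < fst s2 (2, a, 0)) \<longleftrightarrow> pending \<sigma>1 \<noteq> {}"
          using s2 unfolding rep_def by (auto simp: subset_iff)
        with s3 have flag: "0 < fst s3 (10, 0, 0) \<longleftrightarrow> pending \<sigma>1 \<noteq> {}" by simp
        have facts: "fst s3 (7, 0, 0) = t" "fst s3 (6, 0, 0) = c" "snd s3 (0, 0, 0) = L" "fst s3 (5, 0, 0) = Suc c"
          using s0 s2 s3 by (auto simp: same_fst[of _ _ s2] same_fst[of _ _ s0] same_snd[of _ _ s2] same_snd[of _ _ s0])
        show "exec x (150 * S\<^sup>2 + 1) s3
            (Cond (Pos (V 10)) Skip (Seq com_stats (Seq com_eliminate (Seq com_layer com_pending)))) ?Q"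
        proof (rule exec_Cond)
          assume "beval x s3 (Pos (V 10))"
          then have "pending \<sigma>1 \<noteq> {}" using flag by simp
          then have "prep K G t (pv \<noteq> Suc c) Y \<sigma> = \<sigma>1" by (auto simp: \<sigma>1_def prep_def split: if_splits)
          with rep3 facts show "exec x (150 * S\<^sup>2) s3 Skip ?Q"
            unfolding exec_def by (intro exI[of _ 0] exI[of _ s3]) simp
        next
          assume "\<not> beval x s3 (Pos (V 10))"
          then have p: "pending \<sigma>1 = {}" using flag by simp
          show "exec x (150 * S\<^sup>2) s3 (Seq com_stats (Seq com_eliminate (Seq com_layer com_pending))) ?Q"
          proof (rule exec_mono[OF exec_refresh[OF rep3 facts(1) s0(2) facts(2,3)] order_refl], fold Y_def, elim conjE, intro conjI)
            fix s
            let ?A = "active \<sigma>1 \<inter> Y"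
            let ?l = "layer_of t ?A (covered \<sigma>1)"
            let ?W = "{a\<in>?A. a \<notin> covered \<sigma>1 ?l \<and> (a, a) \<in> G}"
            assume r: "rep s \<lparr>active = ?A, pending = ?W, origin = ?W, layer = ?l, covered = covered \<sigma>1\<rparr>"
              and sm: "same {1, 2, 4, 8, 9, 11} {1, 2} s3 s"
            have "prep K G t (pv \<noteq> Suc c) Y \<sigma> =
                \<lparr>active = ?A, pending = ?W, origin = ?W, layer = ?l, covered = covered \<sigma>1\<rparr>"
              using p by (auto simp: \<sigma>1_def prep_def Let_def split: if_splits)
            with r show "rep s (prep K G t (pv \<noteq> Suc c) Y \<sigma>)" by simp
            show "fst s (7, 0, 0) = t" "fst s (5, 0, 0) = Suc c" "snd s (0, 0, 0) = L"
              using sm facts by (auto simp: same_fst[of _ _ s3] same_snd[of _ _ s3])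
          qed
        qed
      qed
    qed
  qed
  then show ?thesis by (rule exec_mono) (use S_le_S2 in auto)
qed

lemma exec_post:
  assumes rep: "rep s0 \<sigma>" and t: "fst s0 (7, 0, 0) = t" "t < length (past x)"
  shows "exec x (20 * S) s0 com_post (\<lambda>s. rep s (post G (pact t) \<sigma>) \<and> same {2, 3, 8} {} s0 s)"
  unfolding com_post_def
proof (rule exec_mono, rule exec_For_straight[where N = K and S = S and
      I = "\<lambda>k s. same {2, 3, 8} {} s0 s \<and>
        (\<forall>a<K. fst s (2, a, 0) = of_bool (a \<in> pending \<sigma> \<and>
           (a < k \<longrightarrow> a \<noteq> pact t \<and> (a, pact t) \<notin> G \<and> (pact t, a) \<notin> G))) \<and>
        (\<forall>l. \<forall>a<K. fst s (3, l, a) = of_bool (a \<in> covered \<sigma> l \<or> (l = layer \<sigma> \<and> a < k \<and> (pact t, a) \<in> G)))"])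
qed (use rep t K_le S1 in \<open>auto simp: same_def nstore_def less_Suc_eq rep_def post_def\<close>)

lemma card_restrict:
  assumes "W \<subseteq> {..<K}" shows "(\<Sum>u<K. of_bool (u \<in> W \<and> P u)) = card {u\<in>W. P u}"
proof -
  have "{..<K} \<inter> {u. u \<in> W \<and> P u} = {u\<in>W. P u}" using assms by auto
  then show ?thesis by simp
qed

lemma exec_balanced:
  assumes W: "\<And>a. a < K \<Longrightarrow> fst s0 (2, a, 0) = of_bool (a \<in> W)" "W \<subseteq> {..<K}" and out: "fst s0 (0, 0, 0) = 0"
  shows "exec x (60 * S\<^sup>2) s0 com_balanced (\<lambda>s. fst s (0, 0, 0) = last_such (balanced G W) K)"
proof -
  let ?X = "{0, 8, 9, 12, 13} :: nat set"
  let ?I = "\<lambda>k s. same ?X {} s0 s \<and> fst s (0, 0, 0) = last_such (balanced G W) k"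
  let ?init = "Seq (SetV 12 (NConst 0)) (SetV 13 (NConst 0))"
  let ?body = "Cond (Pos (Arr 2 (V 9))) (Seq (SetV 12 (NAdd (V 12) (Edge (V 9) (V 8))))
     (SetV 13 (NAdd (V 13) (Edge (V 8) (V 9))))) Skip"
  let ?end = "Cond (Conj (Pos (Arr 2 (V 8))) (Neg (NLess (V 13) (V 12)))) (SetV 0 (V 8)) Skip"
  have "exec x ((3 + ((4 + 7) * S + 2 + 1) + 1 + 7) * S) s0 com_balanced (\<lambda>s. ?I K s \<and> fst s (8, 0, 0) = K)"
    unfolding com_balanced_def
  proof (rule exec_For[where I = ?I and N = "K"])
    fix k s assume k: "k < K" and s: "?I k s" "fst s (8, 0, 0) = k"
    let ?J = "\<lambda>m s. ?I k s \<and> fst s (8, 0, 0) = k \<and>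
      fst s (12, 0, 0) = (\<Sum>u<m. of_bool (u \<in> W \<and> (u, k) \<in> G)) \<and>
      fst s (13, 0, 0) = (\<Sum>u<m. of_bool (u \<in> W \<and> (k, u) \<in> G))"
    show "exec x (3 + ((4 + 7) * S + 2 + 1) + 1) s (Seq ?init (Seq (For 9 NumActions ?body) ?end))
        (\<lambda>s'. ?I (Suc k) s' \<and> fst s' (8, 0, 0) = k)"
    proof (rule exec_Seq[where R = "?J 0"])
      show "exec x 3 s ?init (?J 0)"
        by (rule exec_mono, rule exec_straight) (use s in \<open>auto simp: same_upd nstore_def\<close>)
      fix s1 assume s1: "?J 0 s1"
      show "exec x ((4 + 7) * S + 2 + 1) s1 (Seq (For 9 NumActions ?body) ?end)
          (\<lambda>s'. ?I (Suc k) s' \<and> fst s' (8, 0, 0) = k)"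
      proof (rule exec_Seq[where R = "?J K"])
        show "exec x ((4 + 7) * S) s1 (For 9 NumActions ?body) (?J K)"
        proof (rule exec_mono, rule exec_For_straight[where N = K and S = S and I = ?J])
          show "?J (Suc m) (effect x ?body s) \<and> fst (effect x ?body s) (9, 0, 0) = m"
            if "m < K" "?J m s" "fst s (9, 0, 0) = m" for m s
          proof -
            have "fst s (2, m, 0) = of_bool (m \<in> W)" 
              using that W(1)[of m] same_fst[of "{0, 8, 9, 12, 13}" "{}" s0 s 2 m 0] by simp
            with that show ?thesis by (simp add: same_upd nstore_def del: sum_of_bool_eq)
          qed
        qed (use s1 K_le S1 in \<open>auto simp: same_upd simp del: sum_of_bool_eq\<close>)
        fix s2 assume s2: "?J K s2"
        then have "fst s2 (12, 0, 0) = card {u\<in>W. (u, k) \<in> G}" "fst s2 (13, 0, 0) = card {u\<in>W. (k, u) \<in> G}"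
          by (simp_all only: card_restrict[OF W(2)])
        with s2 k W show "exec x 2 s2 ?end (\<lambda>s'. ?I (Suc k) s' \<and> fst s' (8, 0, 0) = k)"
          by (intro exec_mono[OF exec_straight]) (auto simp: same_upd nstore_def same_fst[of _ _ s0] balanced_def simp del: sum_of_bool_eq)
      qed
    qed
  qed (use out K_le S1 in \<open>auto simp: same_upd\<close>)
  moreover have "(3 + ((4 + 7) * S + 2 + 1) + 1 + 7) * S \<le> 60 * S\<^sup>2"
  proof -
    have "(3 + ((4 + 7) * S + 2 + 1) + 1 + 7) * S = 11 * S\<^sup>2 + 14 * S"
      by (simp add: power2_eq_square algebra_simps)
    then show ?thesis using S_le_S2 by linarith
  qed
  ultimately show ?thesis by (rule exec_mono) auto
qed

lemma exec_bare:
  assumes rep: "rep s0 \<sigma>" and W: "pending \<sigma> = {}"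
  shows "exec x (60 * S) s0 com_bare (\<lambda>s. fst s (0, 0, 0) = next_action K G \<sigma>)"
proof -
  let ?P = "\<lambda>v. v \<in> active \<sigma> \<and> v \<notin> covered \<sigma> (layer \<sigma>)"
  define v where "v = bare K \<sigma>"
  define Q where "Q b \<longleftrightarrow> b \<in> active \<sigma> \<and> b \<noteq> v" for b
  have nxt: "next_action K G \<sigma> = (if \<exists>b<K. Q b then last_such Q K else v)"
    using W unfolding next_action_def Q_def[abs_def] v_def by simp
  let ?c1 = "Cond (Open (V 4) (V 8)) (SetV 14 (V 8)) Skip"
  let ?c2 = "Cond (Conj (Pos (Arr 1 (V 8))) (Neg (Conj (Neg (NLess (V 8) (V 14))) (Neg (NLess (V 14) (V 8))))))
          (SetV 0 (V 8)) Skip"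
  let ?R = "\<lambda>s. fst s (0, 0, 0) = next_action K G \<sigma>"
  let ?I1 = "\<lambda>k s. same {8, 14} {} s0 s \<and> fst s (14, 0, 0) = last_such ?P k"
  let ?I2 = "\<lambda>k s. same {0, 8, 14} {} s0 s \<and> fst s (14, 0, 0) = v \<and>
    fst s (0, 0, 0) = (if \<exists>b<k. Q b then last_such Q k else v)"
  have "exec x (1 + ((2 + 7) * S + (1 + (2 + 7) * S + 1) + 1) + 1) s0 com_bare ?R"
    unfolding com_bare_def
  proof (rule exec_Seq[where R = "?I1 0"])
    show "exec x 1 s0 (SetV 14 (NConst 0)) (?I1 0)"
      by (rule exec_mono, rule exec_straight) (auto simp: nstore_def same_upd)
    fix s1 assume s1: "?I1 0 s1"
    show "exec x ((2 + 7) * S + (1 + (2 + 7) * S + 1) + 1) s1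
      (Seq (For 8 NumActions ?c1) (Seq (SetV 0 (V 14)) (For 8 NumActions ?c2))) ?R"
    proof (rule exec_Seq[where R = "?I1 K"])
      show "exec x ((2 + 7) * S) s1 (For 8 NumActions ?c1) (?I1 K)"
        by (rule exec_mono, rule exec_For_straight[where N = K and S = S and I = ?I1])
           (use s1 rep K_le S1 in \<open>auto simp: rep_def same_def nstore_def\<close>)
      fix s2 assume s2: "?I1 K s2"
      show "exec x (1 + (2 + 7) * S + 1) s2 (Seq (SetV 0 (V 14)) (For 8 NumActions ?c2)) ?R"
      proof (rule exec_Seq[where R = "?I2 0"])
        have "same {0, 8, 14} {} s0 s2" using s2 by (auto simp: same_def)
        with s2 show "exec x 1 s2 (SetV 0 (V 14)) (?I2 0)"
          by (intro exec_mono[OF exec_straight]) (auto simp: nstore_def same_upd bare_def v_def)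
        fix s3 assume s3: "?I2 0 s3"
        show "exec x ((2 + 7) * S) s3 (For 8 NumActions ?c2) ?R"
        proof (rule exec_mono, rule exec_For_straight[where N = K and S = S and I = ?I2])
          show "?I2 (Suc m) (effect x ?c2 s) \<and> fst (effect x ?c2 s) (8, 0, 0) = m"
            if "m < K" "?I2 m s" "fst s (8, 0, 0) = m" for m s
          proof -
            have f: "fst s (1, m, 0) = of_bool (m \<in> active \<sigma>)" "fst s (14, 0, 0) = v"
              using that rep same_fst[of "{0, 8, 14}" "{}" s0 s 1 m 0] by (simp_all add: rep_def)
            have ex: "(\<exists>b<Suc m. Q b) \<longleftrightarrow> Q m \<or> (\<exists>b<m. Q b)"
              by (metis less_Suc_eq)
            have eff: "effect x ?c2 s = (if Q m then ((fst s)((0, 0, 0) := m), snd s) else s)"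
              using that(3) f by (auto simp: nstore_def Q_def)
            show ?thesis
              using that f(2) unfolding eff ex by (cases "Q m") (auto simp: same_upd)
          qed
        qed (use s3 K_le S1 W in \<open>auto simp: same_upd nxt\<close>)
      qed
    qed
  qed
  then show ?thesis by (rule exec_mono) (use S1 in auto)
qed

lemma exec_next:
  assumes rep: "rep s0 \<sigma>"
  shows "exec x (150 * S\<^sup>2) s0 com_next (\<lambda>s. fst s (0, 0, 0) = next_action K G \<sigma>)" (is "exec _ _ _ _ ?Q")
proof -
  have "exec x (1 + (12 * S + (60 * S\<^sup>2 + 1) + 1) + 1) s0 com_next ?Q"
    unfolding com_next_def
  proof (rule exec_Seq[where R = "\<lambda>s. rep s \<sigma> \<and> fst s (0, 0, 0) = 0"])
    show "exec x 1 s0 (SetV 0 (NConst 0)) (\<lambda>s. rep s \<sigma> \<and> fst s (0, 0, 0) = 0)"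
      by (rule exec_mono, rule exec_straight) (use rep in \<open>auto simp: nstore_def rep_def\<close>)
    fix s1 assume s1: "rep s1 \<sigma> \<and> fst s1 (0, 0, 0) = 0"
    show "exec x (12 * S + (60 * S\<^sup>2 + 1) + 1) s1 (Seq com_flag (Cond (Pos (V 10)) com_balanced com_bare)) ?Q"
    proof (rule exec_Seq[OF exec_flag])
      fix s2 assume s2: "same {8, 10} {} s1 s2 \<and> fst s2 (10, 0, 0) = of_bool (\<exists>a<K. 0 < fst s1 (2, a, 0))"
      then have rep2: "rep s2 \<sigma>" using s1 rep_same[of s1 \<sigma> "{8, 10}" "{}" s2] by auto
      have "(\<exists>a<K. 0 < fst s1 (2, a, 0)) \<longleftrightarrow> pending \<sigma> \<noteq> {}"
        using s1 unfolding rep_def by (auto simp: subset_iff)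
      with s2 have flag: "0 < fst s2 (10, 0, 0) \<longleftrightarrow> pending \<sigma> \<noteq> {}" by simp
      have out: "fst s2 (0, 0, 0) = 0" using s1 s2 by (auto simp: same_fst[of _ _ s1])
      show "exec x (60 * S\<^sup>2 + 1) s2 (Cond (Pos (V 10)) com_balanced com_bare) ?Q"
      proof (rule exec_Cond)
        assume "beval x s2 (Pos (V 10))"
        then have "pending \<sigma> \<noteq> {}" using flag by simp
        then show "exec x (60 * S\<^sup>2) s2 com_balanced ?Q"
          using rep2 out exec_balanced[of s2 "pending \<sigma>"] by (simp add: next_action_def rep_def)
      next
        assume "\<not> beval x s2 (Pos (V 10))"
        then have "pending \<sigma> = {}" using flag by simp
        from exec_bare[OF rep2 this] show "exec x (60 * S\<^sup>2) s2 com_bare ?Q"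
          by (rule exec_mono) (use S_le_S2 in auto)
      qed
    qed
  qed
  then show ?thesis by (rule exec_mono) (use S_le_S2 in auto)
qed

text \<open>Each of at most \<open>S\<close> rounds recomputes all statistics in a multiple of
  \<open>S^2\<close> steps, hence the cube.\<close>

lemma exec_main:
  defines "L \<equiv> 12 * harm (K + num_contexts x + total_rounds x)"
  defines "ctx \<equiv> ctx_of (past x) (current x)"
  defines "Z \<equiv> \<lambda>t. survivors L K (obs_count G pact t) (\<lambda>a. \<Sum>u<t. prew u (ctx t, a))"
  shows "exec x (1000 * S ^ 3) (\<lambda>_. 0, \<lambda>_. 0) com_main
    (\<lambda>s. fst s (0, 0, 0) = next_action K G (ready K G Z ctx pact (length (past x))))" (is "exec _ _ _ _ ?Q")
proof -
  let ?R = "length (past x)"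
  \<comment> \<open>The content of cell 5 before round \<open>k\<close>.\<close>
  let ?pv = "\<lambda>k. if k = 0 then 0 else Suc (ctx (k - 1))"
  let ?I = "\<lambda>k s. k \<le> ?R \<and> rep s (simulate K G Z ctx pact k) \<and> fst s (5, 0, 0) = ?pv k \<and> snd s (0, 0, 0) = L"
  have pv: "?pv k \<noteq> Suc (ctx k) \<longleftrightarrow> fresh ctx k" for k by (auto simp: fresh_def)
  have "exec x (8 * S + ((1 + (200 * S\<^sup>2 + 20 * S + 1) + 1 + 7) * S + (1 + (200 * S\<^sup>2 + 150 * S\<^sup>2 + 1) + 1) + 1) + 1)
    (\<lambda>_. 0, \<lambda>_. 0) com_main ?Q"
    unfolding com_main_def
  proof (rule exec_Seq[OF exec_threshold])
    fix s1 assume s1: "same {8} {0} (\<lambda>_. 0, \<lambda>_. 0) s1 \<and> snd s1 (0, 0, 0) = 12 * harm (K + num_contexts x + total_rounds x)"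
    show "exec x ((1 + (200 * S\<^sup>2 + 20 * S + 1) + 1 + 7) * S + (1 + (200 * S\<^sup>2 + 150 * S\<^sup>2 + 1) + 1) + 1) s1
      (Seq (For 7 Round (Seq (SetV 6 (PastContext (V 7))) (Seq com_prep com_post)))
     (Seq (SetV 6 CurrentContext) (Seq com_prep com_next))) ?Q"
    proof (rule exec_Seq, rule exec_For[where I = ?I and N = ?R])
      show "?I 0 s1" using s1 by (auto simp: rep_def same_fst[of "{8}" "{0}"] L_def)
      fix k s assume k: "k < ?R" and s: "?I k s" "fst s (7, 0, 0) = k"
      show "exec x (1 + (200 * S\<^sup>2 + 20 * S + 1) + 1) s (Seq (SetV 6 (PastContext (V 7))) (Seq com_prep com_post))
        (\<lambda>s'. ?I (Suc k) s' \<and> fst s' (7, 0, 0) = k)"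
      proof (rule exec_Seq[where R = "\<lambda>s'. ?I k s' \<and> fst s' (7, 0, 0) = k \<and> fst s' (6, 0, 0) = ctx k"])
        show "exec x 1 s (SetV 6 (PastContext (V 7))) (\<lambda>s'. ?I k s' \<and> fst s' (7, 0, 0) = k \<and> fst s' (6, 0, 0) = ctx k)"
          by (rule exec_mono, rule exec_straight) (use s k in \<open>auto simp: nstore_def rep_def ctx_def ctx_of_def\<close>)
        fix s2 assume s2: "?I k s2 \<and> fst s2 (7, 0, 0) = k \<and> fst s2 (6, 0, 0) = ctx k"
        show "exec x (200 * S\<^sup>2 + 20 * S + 1) s2 (Seq com_prep com_post) (\<lambda>s'. ?I (Suc k) s' \<and> fst s' (7, 0, 0) = k)"
        proof (rule exec_Seq, rule exec_prep)
          show "rep s2 (simulate K G Z ctx pact k)" "fst s2 (7, 0, 0) = k" "k \<le> ?R" "fst s2 (6, 0, 0) = ctx k"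
            "snd s2 (0, 0, 0) = L" "fst s2 (5, 0, 0) = ?pv k" using s2 by auto
          fix s3
          assume "rep s3 (prep K G k (?pv k \<noteq> Suc (ctx k)) (survivors L K (obs_count G pact k)
            (\<lambda>a. \<Sum>u<k. prew u (ctx k, a))) (simulate K G Z ctx pact k)) \<and>
            fst s3 (7, 0, 0) = k \<and> fst s3 (5, 0, 0) = Suc (ctx k) \<and> snd s3 (0, 0, 0) = L"
          then have s3: "rep s3 (prep K G k (fresh ctx k) (Z k) (simulate K G Z ctx pact k))"
            "fst s3 (7, 0, 0) = k" "fst s3 (5, 0, 0) = Suc (ctx k)" "snd s3 (0, 0, 0) = L"
            unfolding pv Z_def by auto
          show "exec x (20 * S) s3 com_post (\<lambda>s'. ?I (Suc k) s' \<and> fst s' (7, 0, 0) = k)"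
            by (rule exec_mono[OF exec_post[OF s3(1,2) k] order_refl])
               (use s3 k in \<open>auto simp: same_def\<close>)
        qed
      qed
    next
      fix s2 assume s2: "?I ?R s2 \<and> fst s2 (7, 0, 0) = ?R"
      show "exec x (1 + (200 * S\<^sup>2 + 150 * S\<^sup>2 + 1) + 1) s2 (Seq (SetV 6 CurrentContext) (Seq com_prep com_next)) ?Q"
      proof (rule exec_Seq[where R = "\<lambda>s'. ?I ?R s' \<and> fst s' (7, 0, 0) = ?R \<and> fst s' (6, 0, 0) = ctx ?R"])
        show "exec x 1 s2 (SetV 6 CurrentContext) (\<lambda>s'. ?I ?R s' \<and> fst s' (7, 0, 0) = ?R \<and> fst s' (6, 0, 0) = ctx ?R)"
          by (rule exec_mono, rule exec_straight) (use s2 in \<open>auto simp: nstore_def rep_def ctx_def ctx_of_def\<close>)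
        fix s3 assume s3: "?I ?R s3 \<and> fst s3 (7, 0, 0) = ?R \<and> fst s3 (6, 0, 0) = ctx ?R"
        show "exec x (200 * S\<^sup>2 + 150 * S\<^sup>2 + 1) s3 (Seq com_prep com_next) ?Q"
        proof (rule exec_Seq, rule exec_prep)
          show "rep s3 (simulate K G Z ctx pact ?R)" "fst s3 (7, 0, 0) = ?R" "?R \<le> ?R" "fst s3 (6, 0, 0) = ctx ?R"
            "snd s3 (0, 0, 0) = L" "fst s3 (5, 0, 0) = ?pv ?R" using s3 by auto
          fix s4
          assume "rep s4 (prep K G ?R (?pv ?R \<noteq> Suc (ctx ?R)) (survivors L K (obs_count G pact ?R)
            (\<lambda>a. \<Sum>u<?R. prew u (ctx ?R, a))) (simulate K G Z ctx pact ?R)) \<and>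
            fst s4 (7, 0, 0) = ?R \<and> fst s4 (5, 0, 0) = Suc (ctx ?R) \<and> snd s4 (0, 0, 0) = L"
          then have "rep s4 (ready K G Z ctx pact ?R)"
            unfolding pv Z_def ready_def by auto
          then show "exec x (150 * S\<^sup>2) s4 com_next ?Q" by (rule exec_next)
        qed
      qed
    qed (use R_le S1 in \<open>auto simp: rep_def\<close>)
  qed auto
  moreover have "8 * S + ((1 + (200 * S\<^sup>2 + 20 * S + 1) + 1 + 7) * S + (1 + (200 * S\<^sup>2 + 150 * S\<^sup>2 + 1) + 1) + 1) + 1 \<le> 1000 * S ^ 3"
  proof -
    have "S\<^sup>2 \<le> S ^ 3" "S \<le> S ^ 3" "1 \<le> S ^ 3"
      using S1 power_increasing[of 2 3 S] power_increasing[of 1 3 S] by simp_all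
    moreover have "(1 + (200 * S\<^sup>2 + 20 * S + 1) + 1 + 7) * S = 200 * S ^ 3 + 20 * S\<^sup>2 + 10 * S"
      by (simp add: power3_eq_cube power2_eq_square algebra_simps)
    ultimately show ?thesis by linarith
  qed
  ultimately show ?thesis by (rule exec_mono) auto
qed

end

lemma poly_time_elim_policy: "poly_time_implementable elim_policy"
  unfolding poly_time_implementable_def
proof (rule exI[of _ com_main], rule exI[of _ 1000], rule exI[of _ 3], intro allI impI ballI, elim conjE)
  fix K M T :: nat and E :: "(nat \<times> nat) set" and cs as :: "nat list" and r :: "nat \<Rightarrow> rewards"
  assume KMT: "1 \<le> K" "1 \<le> M" "1 \<le> T" and len: "length as < T"
  define h where "h = history_of M E cs r as"
  define c where "c = cs ! length as"
  let ?x = "\<lparr>num_actions = K, num_contexts = M, total_rounds = T, graph = E, past = h, current = c\<rparr>"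
  let ?n = "1000 * (K + M + T) ^ 3"
  have "length h = length as" by (simp add: h_def history_of_def)
  then interpret program_run ?x "K + M + T" by unfold_locales (use len KMT in auto)
  \<comment> \<open>The threshold \<open>12 * harm\<close> of the program is four times
    \<open>conf\<close>, the level that \<open>passes\<close> uses.\<close>
  from exec_main obtain n s where n: "n \<le> ?n" "reach ?x n (com_main, (\<lambda>_. 0, \<lambda>_. 0)) (Skip, s)"
    "fst s (0, 0, 0) = decide K M T E h c"
    unfolding exec_def decide_def passes_def[abs_def] conf_def by auto
  from run_halted[OF n(2,1)] n(3)
  have "halts_within ?x com_main ?n \<and> output_law ?x com_main ?n = elim_policy K M T E h c"
    by (simp add: halts_within_def output_law_def elim_policy_def)
  then show "let h = history_of M E cs r as; c = cs ! length as;
        x = \<lparr>num_actions = K, num_contexts = M, total_rounds = T, graph = E, past = h, current = c\<rparr>;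
        n = 1000 * (K + M + T) ^ 3
      in halts_within x com_main n \<and> output_law x com_main n = elim_policy K M T E h c"
    by (simp only: Let_def h_def c_def)
qed

theorem theorem1p2:
  shows "\<exists>(\<pi> :: nat \<Rightarrow> nat \<Rightarrow> nat \<Rightarrow> (nat \<times> nat) set \<Rightarrow> policy) (C :: real) (d :: nat).
    poly_time_implementable \<pi> \<and>
    (\<forall>K M T E. K \<ge> 1 \<and> M \<ge> 1 \<and> T \<ge> 1 \<and> digraph_on K E \<and> strongly_observable K E \<longrightarrow>
       is_policy K M T E (\<pi> K M T E) \<and>
       regret K M T E (\<pi> K M T E) (self_avoiding M T)
         \<le> ereal (C * (1 + ln (real K) + ln (real M) + ln (real T)) ^ d
                    * sqrt (real (beta K E M) * real T)))"
proof (intro exI conjI allI impI)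
  show "poly_time_implementable elim_policy" by (rule poly_time_elim_policy)
  fix K M T :: nat and E :: "(nat \<times> nat) set"
  assume *: "1 \<le> K \<and> 1 \<le> M \<and> 1 \<le> T \<and> digraph_on K E \<and> strongly_observable K E"
  then show "is_policy K M T E (elim_policy K M T E)" by (intro is_policy_elim_policy) simp
  from * show "regret K M T E (elim_policy K M T E) (self_avoiding M T) \<le>
    ereal (200 * (1 + ln (real K) + ln (real M) + ln (real T)) ^ 1 * sqrt (real (beta K E M) * real T))"
    by (intro regret_elim_policy) simp_all
qed

end
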